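(* Let $q\ge 1$, let $z_1,\dots,z_q\in\mathbb{C}\setminus\mathbb{R}$, let $\gamma_1,\dots,\gamma_q>0$, $T=\sum_{j=1}^q\gamma_j$, and $\varphi(x)=\sum_{j=1}^q\gamma_j\log|x-z_j|$. For $t\in(0,T)$ let $\mu_t$ denote the equilibrium measure of mass $t$ on $\mathbb{R}$ in the external field $\varphi$, and $S_t$ its support. Then: <br> (i) There exists the limit of the equilibrium measure when $t\to T$, $\lim_{t\to T}\mu_t=\mu_T$, in the sense that $\lim_{t\to T}\mu_t(I)=\mu_T(I)$ for any Borel set $I\subset\mathbb{R}$. <br> (ii) For $t$ sufficiently close to $T$, the support $S_t$ consists of a single interval. In particular, using the $AB$-representation (see context), the zeros $a_1<a_2$ of the polynomial $A$ (the endpoints of $S_t$) diverge: $\lim_{t\to T}a_1=-\infty$ and $\lim_{t\to T}a_2=+\infty$; and the zeros of the polynomial $B$ converge to the zeros of the rational function $$\sum_{j=1}^q\left(\frac{\gamma_j}{2(z-z_j)}-\frac{\gamma_j}{2(z-\overline{z}_j)}\right),$$ which belong to $\mathbb{C}\setminus\mathbb{R}$. <br> (iii) The density of the limit measure $\mu_T$ is given by $$\frac{d\mu_T}{dx}=\frac{1}{T\,\pi}\sum_{j=1}^q\frac{\gamma_j\operatorname{Im}z_j}{(x-\operatorname{Re}z_j)^2+(\operatorname{Im}z_j)^2}.$$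
   Context: For a measure $\sigma$ put $V^\sigma(x)=-\int\log|x-s|\,d\sigma(s)$. For $t\in(0,T)$, the equilibrium measure $\mu_t$ in the external field $\varphi$ is the unique positive measure on $\mathbb{R}$ with $\mu_t(\mathbb{R})=t$ and compact support $S_t\subset\mathbb{R}$ such that, for some constant $c_t$, $V^{\mu_t}+\varphi=c_t$ on $S_t$ and $V^{\mu_t}+\varphi\ge c_t$ on $\mathbb{R}$. $AB$-representation: let $\widehat{\mu_t}(z)=\int\frac{d\mu_t(s)}{z-s}$, $D(z)=\prod_{j=1}^q(z-z_j)(z-\overline{z}_j)$, and $\varphi'(z)=\sum_{j=1}^q\gamma_j\frac{z-\operatorname{Re}z_j}{(z-z_j)(z-\overline{z}_j)}$. If $S_t=\bigcup_{j=1}^k[a_{2j-1},a_{2j}]$ with real $a_1<\dots<a_{2k}$, then $$-\widehat{\mu_t}(z)+\varphi'(z)=(T-t)\,\frac{B(z)\sqrt{A(z)}}{D(z)},\qquad z\in\mathbb{C}\setminus S_t,$$ where $A(z)=\prod_{j=1}^{2k}(z-a_j)$, $B$ is a monic polynomial of degree $2q-k-1$ (both depending on $t$), and the branch of $\sqrt{A}$ is the one with $\sqrt{A(z)}\sim z^k$ as $z\to\infty$.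
   Formalization: In (ii), (iii) z_j is replaced by its representative with Im z_j>0; the density in (iii) is that of μ_T/T, as μ_T has mass T; if charges coincide up to conjugation, the limits of B's zeros also include common zeros of numerator and denominator of the rational function over D. *)

theory Defs
  imports "HOL-Analysis.Analysis" "HOL-Computational_Algebra.Computational_Algebra"
begin

definition measure_support :: "real measure \<Rightarrow> real set" where
  "measure_support \<mu> = {x. \<forall>U. open U \<and> x \<in> U \<longrightarrow> emeasure \<mu> U > 0}"

(* V(x) = - int log|x - s| d sigma(s) with values in (-infinity, +infinity] for compactly
   supported finite sigma: the first integral is that of the positive part of the kernel
   (which is +infinity at s = x, whereas ln 0 = 0 in the library), the second one is that of the
   negative part. *)
definition log_potential :: "real measure \<Rightarrow> real \<Rightarrow> ereal" where
  "log_potential \<sigma> x =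
     enn2ereal (\<integral>\<^sup>+ s. (if s = x then \<infinity> else ennreal (- ln \<bar>x - s\<bar>)) \<partial>\<sigma>)
     - enn2ereal (\<integral>\<^sup>+ s. ennreal (ln \<bar>x - s\<bar>) \<partial>\<sigma>)"

definition is_equilibrium_measure :: "(real \<Rightarrow> real) \<Rightarrow> real \<Rightarrow> real measure \<Rightarrow> bool" where
  "is_equilibrium_measure \<phi> t \<mu> \<longleftrightarrow>
     sets \<mu> = sets borel \<and> emeasure \<mu> UNIV = ennreal t \<and> compact (measure_support \<mu>) \<and>
     (\<exists>c::real.
        (\<forall>x\<in>measure_support \<mu>. log_potential \<mu> x + ereal (\<phi> x) = ereal c) \<and>
        (\<forall>x. log_potential \<mu> x + ereal (\<phi> x) \<ge> ereal c))"

definition ext_field :: "nat \<Rightarrow> (nat \<Rightarrow> real) \<Rightarrow> (nat \<Rightarrow> complex) \<Rightarrow> real \<Rightarrow> real" where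
  "ext_field q \<gamma> z x = (\<Sum>j=1..q. \<gamma> j * ln (cmod (of_real x - z j)))"

definition ext_field_deriv :: "nat \<Rightarrow> (nat \<Rightarrow> real) \<Rightarrow> (nat \<Rightarrow> complex) \<Rightarrow> complex \<Rightarrow> complex" where
  "ext_field_deriv q \<gamma> z \<zeta> =
     (\<Sum>j=1..q. of_real (\<gamma> j) * ((\<zeta> - of_real (Re (z j))) / ((\<zeta> - z j) * (\<zeta> - cnj (z j)))))"

definition cauchy_transform :: "real measure \<Rightarrow> complex \<Rightarrow> complex" where
  "cauchy_transform \<mu> \<zeta> = (\<integral>s. 1 / (\<zeta> - of_real s) \<partial>\<mu>)"

definition D_poly :: "nat \<Rightarrow> (nat \<Rightarrow> complex) \<Rightarrow> complex poly" where
  "D_poly q z = (\<Prod>j=1..q. [:- z j, 1:] * [:- cnj (z j), 1:])"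

definition A_poly :: "nat \<Rightarrow> (nat \<Rightarrow> real) \<Rightarrow> complex poly" where
  "A_poly k a = (\<Prod>j=1..2*k. [:- of_real (a j), 1:])"

definition is_sqrt_branch :: "complex poly \<Rightarrow> nat \<Rightarrow> complex set \<Rightarrow> (complex \<Rightarrow> complex) \<Rightarrow> bool" where
  "is_sqrt_branch A k S r \<longleftrightarrow>
     r holomorphic_on (- S) \<and> (\<forall>\<zeta>\<in>- S. (r \<zeta>)\<^sup>2 = poly A \<zeta>) \<and>
     ((\<lambda>\<zeta>. r \<zeta> / \<zeta> ^ k) \<longlongrightarrow> 1) at_infinity"

(* The zeros of D, where both sides of the identity may have poles, are excluded because
   division is total. *)
definition is_AB_representation ::
    "nat \<Rightarrow> (nat \<Rightarrow> real) \<Rightarrow> (nat \<Rightarrow> complex) \<Rightarrow> real \<Rightarrow> real measure \<Rightarrow>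
     nat \<Rightarrow> (nat \<Rightarrow> real) \<Rightarrow> complex poly \<Rightarrow> bool" where
  "is_AB_representation q \<gamma> z t \<mu> k a B \<longleftrightarrow>
     strict_mono_on {1..2*k} a \<and>
     measure_support \<mu> = (\<Union>j\<in>{1..k}. {a (2*j - 1)..a (2*j)}) \<and>
     lead_coeff B = 1 \<and> degree B + k + 1 = 2 * q \<and>
     (\<exists>r. is_sqrt_branch (A_poly k a) k (of_real ` measure_support \<mu>) r \<and>
        (\<forall>\<zeta>. \<zeta> \<notin> of_real ` measure_support \<mu> \<and> poly (D_poly q z) \<zeta> \<noteq> 0 \<longrightarrow>
           - cauchy_transform \<mu> \<zeta> + ext_field_deriv q \<gamma> z \<zeta> =
           of_real ((\<Sum>j=1..q. \<gamma> j) - t) * (poly B \<zeta> * r \<zeta> / poly (D_poly q z) \<zeta>)))"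

(* The representative of {z, cnj z} in the upper half-plane. On the real line |x - z| = |x - cnj z|,
   so the external field determines each z_j only up to conjugation, while the limit density
   and the limit rational function below are written for the points with Im z_j > 0. *)
definition upper :: "complex \<Rightarrow> complex" where
  "upper z = Complex (Re z) \<bar>Im z\<bar>"

definition limit_fun :: "nat \<Rightarrow> (nat \<Rightarrow> real) \<Rightarrow> (nat \<Rightarrow> complex) \<Rightarrow> complex \<Rightarrow> complex" where
  "limit_fun q \<gamma> z \<zeta> =
     (\<Sum>j=1..q. of_real (\<gamma> j) / (2 * (\<zeta> - z j)) - of_real (\<gamma> j) / (2 * (\<zeta> - cnj (z j))))"

(* Z is the multiset of zeros, with multiplicity, of the rational function R written as a fraction
   with denominator D. If that fraction is in lowest terms, these are the zeros of R;
   otherwise Z also contains the zeros common to numerator and denominator. *)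
definition is_zeros_of_fraction ::
    "(complex \<Rightarrow> complex) \<Rightarrow> complex poly \<Rightarrow> complex multiset \<Rightarrow> bool" where
  "is_zeros_of_fraction R D Z \<longleftrightarrow>
     (\<exists>N. N \<noteq> 0 \<and> (\<forall>\<zeta>. poly D \<zeta> \<noteq> 0 \<longrightarrow> R \<zeta> = poly N \<zeta> / poly D \<zeta>) \<and> Z = proots N)"

(* Matching of the zeros with multiplicity: for every eps, eventually the zeros of P t
   can be paired off with Z at distances less than eps. *)
definition zeros_tendsto ::
    "(real \<Rightarrow> complex poly) \<Rightarrow> complex multiset \<Rightarrow> real filter \<Rightarrow> bool" where
  "zeros_tendsto P Z F \<longleftrightarrow>
     (\<forall>\<epsilon>>0. \<forall>\<^sub>F t in F. rel_mset (\<lambda>b \<zeta>. dist b \<zeta> < \<epsilon>) (proots (P t)) Z)"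

end

theory Submission
  imports Defs "HOL-Probability.Distribution_Functions" "HOL-Probability.Sinc_Integral"
begin

text \<open>For $t$ close to $T$ the equilibrium measure is guessed and then recognised by uniqueness.
  Let $w_j$ be the poles in the upper half-plane and $R(z) = \sqrt{(z-a)(z-b)}$. The function
  $R\,G$ with $G(z) = \frac12 \sum_j \gamma_j \bigl(\frac{1}{R(w_j)(z-w_j)} +
  \frac{1}{R(\overline{w}_j)(z-\overline{w}_j)}\bigr)$ has the same poles as $\varphi'$, and
  $\varphi' - R\,G$ is the Cauchy transform of a measure of mass $t$ on $[a,b]$ as soon as
  $R(z)\,G(z) = (T-t)/z + O(z^{-2})$ at infinity. These are two real equations for the endpoints;
  with $h = (b-a)/2$ they become a fixed point problem close to a constant map as $t \to T$, and
  $h\,(T-t)$ stays bounded away from $0$. The density of this measure is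
  $\frac1\pi \sqrt{(b-x)(x-a)}\,G(x)$, and $h\,G(x)$ tends to
  $\sum_j \gamma_j \,\mathrm{Im}\, w_j / |x-w_j|^2$ with a relative error that is uniform in $x$.
  This gives positivity, the variational inequalities off $[a,b]$, dominated convergence to the
  limit measure, and convergence of the polynomial $B = D\,G/(T-t)$.\<close>

section \<open>Uniqueness of equilibrium measures\<close>

text \<open>No existence theory and no structure theory of supports enters: \<open>\<mu> t\<close>
  is given, and uniqueness identifies it with the explicit candidate. The factor
  \<open>1 / R(w_j)\<close> gives the j-th term of \<open>R G\<close> the residue \<gamma>_j/2 at
  w_j, as in \<phi>', and the conjugate term makes \<open>G\<close> real on the line, so that the
  jump of \<open>R G\<close> across the cut is a real density. All limits come from one fact: for a
  bounded midpoint and h -> infinity, R(w_j) is asymptotic to i h, where the sign is fixed because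
  \<open>R\<close> preserves the upper half-plane. Hence h G tends to -i times the limit function,
  and the condition at infinity gives h (T - t) -> sum of \<gamma>_j Im w_j. To this order the
  vanishing of the constant term at infinity says nothing, since 1/(i h) has real part zero; the
  midpoint is visible only in the correction of relative order 1/h^2. This is why the square root is
  expanded to second order. In the uniqueness proof potentials and energies may be infinite a
  priori, so the argument is phrased with nonnegative kernels and sums instead of
  differences.\<close>

lemma measure_complement_support:
  fixes \<mu> :: "real measure"
  assumes sets: "sets \<mu> = sets borel"
  shows "emeasure \<mu> (- measure_support \<mu>) = 0"
proof -
  define \<F> where "\<F> = {U::real set. open U \<and> emeasure \<mu> U = 0}"
  \<comment> \<open>The null open sets covering the complement of the support may be uncountably
    many; a countable subfamily has the same union, and countable subadditivity applies to
    it.\<close>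
  obtain \<F>' where F': "\<F>' \<subseteq> \<F>" "countable \<F>'" "\<Union>\<F>' = \<Union>\<F>"
    using Lindelof[of \<F>] unfolding \<F>_def by auto
  have "- measure_support \<mu> = \<Union>\<F>"
    by (auto simp: measure_support_def \<F>_def zero_less_iff_neq_zero)
  moreover have "(\<Union>U\<in>\<F>'. U) \<in> null_sets \<mu>"
    using F' by (intro null_sets_UN') (auto simp: \<F>_def null_sets_def sets)
  ultimately show ?thesis
    using F' by (simp add: null_sets_def)
qed

lemma open_complement_support:
  fixes \<mu> :: "real measure"
  shows "open (- measure_support \<mu>)"
proof -
  have "- measure_support \<mu> = \<Union>{U. open U \<and> \<not> emeasure \<mu> U > 0}"
    by (auto simp: measure_support_def)
  then show ?thesis by auto
qed

lemma AE_measure_support: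
  fixes \<mu> :: "real measure"
  assumes sets: "sets \<mu> = sets borel"
  shows "AE x in \<mu>. x \<in> measure_support \<mu>"
proof (rule AE_I)
  show "emeasure \<mu> (- measure_support \<mu>) = 0"
    by (rule measure_complement_support[OF sets])
  show "- measure_support \<mu> \<in> sets \<mu>"
    using open_complement_support[of \<mu>] sets by auto
qed auto

section \<open>Positive definiteness of the logarithmic energy\<close>

text \<open>For a kernel of the form \<integral> g(x,p) g(y,p) d\<kappa>(p), Fubini turns the mutual
  energy into \<integral> m \<alpha> p * m \<beta> p d\<kappa>, so both claims are the pointwise
  relation between u^2 + v^2 and 2 u v. The values lie in \<open>ennreal\<close>, where differences
  are unreliable; hence the additive form, and the finiteness of \<open>m\<close> only where the
  square of a difference appears.\<close>

lemma nn_integral_energy_parallelogram: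
  fixes g :: "'a \<Rightarrow> 'p \<Rightarrow> ennreal"
  assumes "sigma_finite_measure \<kappa>" "finite_measure \<mu>" "finite_measure \<nu>" and sets: "sets \<nu> = sets \<mu>"
    and g[measurable]: "(\<lambda>(x, p). g x p) \<in> borel_measurable (\<mu> \<Otimes>\<^sub>M \<kappa>)"
  defines "I \<equiv> \<lambda>\<alpha> \<beta>. \<integral>\<^sup>+x. (\<integral>\<^sup>+y. (\<integral>\<^sup>+p. g x p * g y p \<partial>\<kappa>) \<partial>\<beta>) \<partial>\<alpha>"
    and "m \<equiv> \<lambda>\<alpha> p. \<integral>\<^sup>+x. g x p \<partial>\<alpha>"
  shows "2 * I \<mu> \<nu> \<le> I \<mu> \<mu> + I \<nu> \<nu>"
    and "(\<And>p. m \<mu> p < \<infinity>) \<Longrightarrow> (\<And>p. m \<nu> p < \<infinity>) \<Longrightarrow>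
           I \<mu> \<mu> + I \<nu> \<nu> = 2 * I \<mu> \<nu> + (\<integral>\<^sup>+p. ennreal ((enn2real (m \<mu> p) - enn2real (m \<nu> p))\<^sup>2) \<partial>\<kappa>)"
proof -
  interpret \<kappa>: sigma_finite_measure \<kappa> by fact
  have I: "I \<alpha> \<beta> = (\<integral>\<^sup>+p. m \<alpha> p * m \<beta> p \<partial>\<kappa>)"
    if "finite_measure \<alpha>" "finite_measure \<beta>" and [measurable_cong]: "sets \<alpha> = sets \<mu>" "sets \<beta> = sets \<mu>" for \<alpha> \<beta>
  proof -
    interpret \<alpha>: finite_measure \<alpha> by fact
    interpret \<beta>: finite_measure \<beta> by fact
    interpret \<beta>\<kappa>: pair_sigma_finite \<beta> \<kappa> ..
    interpret \<alpha>\<kappa>: pair_sigma_finite \<alpha> \<kappa> ..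
    have "I \<alpha> \<beta> = (\<integral>\<^sup>+x. (\<integral>\<^sup>+p. (\<integral>\<^sup>+y. g x p * g y p \<partial>\<beta>) \<partial>\<kappa>) \<partial>\<alpha>)"
      unfolding I_def
    proof (intro nn_integral_cong \<beta>\<kappa>.Fubini'[symmetric])
      fix x assume "x \<in> space \<alpha>"
      then have "x \<in> space \<mu>" using sets_eq_imp_space_eq[OF that(3)] by simp
      from measurable_Pair2[OF g this] have [measurable]: "g x \<in> borel_measurable \<kappa>" by simp
      show "(\<lambda>(y, p). g x p * g y p) \<in> borel_measurable (\<beta> \<Otimes>\<^sub>M \<kappa>)" by measurable
    qed
    also have "\<dots> = (\<integral>\<^sup>+x. (\<integral>\<^sup>+p. g x p * m \<beta> p \<partial>\<kappa>) \<partial>\<alpha>)"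
      unfolding m_def by (intro nn_integral_cong nn_integral_cmult) measurable
    also have "\<dots> = (\<integral>\<^sup>+p. (\<integral>\<^sup>+x. g x p * m \<beta> p \<partial>\<alpha>) \<partial>\<kappa>)"
      unfolding m_def by (intro \<alpha>\<kappa>.Fubini'[symmetric]) measurable
    also have "\<dots> = (\<integral>\<^sup>+p. m \<alpha> p * m \<beta> p \<partial>\<kappa>)"
      unfolding m_def by (intro nn_integral_cong nn_integral_multc) measurable
    finally show ?thesis .
  qed
  have m[measurable]: "m \<alpha> \<in> borel_measurable \<kappa>"
    if "finite_measure \<alpha>" and [measurable_cong]: "sets \<alpha> = sets \<mu>" for \<alpha>
  proof -
    interpret \<alpha>: finite_measure \<alpha> by fact
    show ?thesis unfolding m_def by measurable
  qed
  note [measurable] = m[OF assms(2) refl] m[OF assms(3) sets]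
  have *: "I \<mu> \<mu> + I \<nu> \<nu> = (\<integral>\<^sup>+p. m \<mu> p * m \<mu> p + m \<nu> p * m \<nu> p \<partial>\<kappa>)"
    using I assms(2,3) sets by (simp add: nn_integral_add)
  have **: "2 * I \<mu> \<nu> = (\<integral>\<^sup>+p. 2 * (m \<mu> p * m \<nu> p) \<partial>\<kappa>)"
    using I assms(2,3) sets by (simp add: nn_integral_cmult)
  have sq: "u * u + v * v = 2 * (u * v) + ennreal ((enn2real u - enn2real v)\<^sup>2)"
    if fin: "u < \<infinity>" "v < \<infinity>" for u v :: ennreal
  proof -
    obtain a b where ab: "u = ennreal a" "0 \<le> a" "v = ennreal b" "0 \<le> b"
      using fin by (cases u; cases v) auto
    have "u * u + v * v = ennreal (2 * (a * b) + (a - b)\<^sup>2)"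
      using ab by (simp add: power2_eq_square algebra_simps flip: ennreal_mult ennreal_plus)
    also have "\<dots> = ennreal (2 * (a * b)) + ennreal ((a - b)\<^sup>2)"
      using ab by (intro ennreal_plus) auto
    finally show ?thesis using ab by (simp add: ennreal_mult)
  qed
  have le: "2 * (u * v) \<le> u * u + v * v" for u v :: ennreal
  proof (cases "u < \<infinity> \<and> v < \<infinity>")
    case True
    then show ?thesis using sq[of u v] by simp
  next
    case False
    then have "u = \<infinity> \<or> v = \<infinity>" by (auto simp flip: top.not_eq_extremum)
    then show ?thesis by (auto simp: ennreal_top_mult)
  qed
  show "2 * I \<mu> \<nu> \<le> I \<mu> \<mu> + I \<nu> \<nu>"
    unfolding * ** by (intro nn_integral_mono le)
  assume fin: "\<And>p. m \<mu> p < \<infinity>" "\<And>p. m \<nu> p < \<infinity>"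
  have "I \<mu> \<mu> + I \<nu> \<nu> = (\<integral>\<^sup>+p. 2 * (m \<mu> p * m \<nu> p) + ennreal ((enn2real (m \<mu> p) - enn2real (m \<nu> p))\<^sup>2) \<partial>\<kappa>)"
    unfolding * by (intro nn_integral_cong sq fin)
  also have "\<dots> = 2 * I \<mu> \<nu> + (\<integral>\<^sup>+p. ennreal ((enn2real (m \<mu> p) - enn2real (m \<nu> p))\<^sup>2) \<partial>\<kappa>)"
    unfolding ** by (rule nn_integral_add) measurable
  finally show "I \<mu> \<mu> + I \<nu> \<nu> = 2 * I \<mu> \<nu> + (\<integral>\<^sup>+p. ennreal ((enn2real (m \<mu> p) - enn2real (m \<nu> p))\<^sup>2) \<partial>\<kappa>)" .
qed

text \<open>The shift by \<open>ln R\<close> makes the kernel -ln|x - y| nonnegative for |x - y|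
  \<le> R, so that energies are integrals in \<open>ennreal\<close>. The diagonal is set to infinity
  by hand because \<open>ln 0 = 0\<close>.\<close>

definition log_kernel :: "real \<Rightarrow> real \<Rightarrow> real \<Rightarrow> ennreal" where
  "log_kernel R x y = (if x = y then \<infinity> else ennreal (ln R - ln \<bar>x - y\<bar>))"

lemma nn_integral_tent:
  fixes x y r :: real
  assumes "r \<ge> 0"
  shows "(\<integral>\<^sup>+v. indicator {x..x+r} v * indicator {y..y+r} v \<partial>lborel) = ennreal (max 0 (r - \<bar>x - y\<bar>))"
proof -
  have "(\<integral>\<^sup>+v. indicator {x..x+r} v * indicator {y..y+r} v \<partial>lborel)
      = (\<integral>\<^sup>+v. indicator {max x y..min x y + r} v \<partial>lborel)"
    by (intro nn_integral_cong) (auto simp: indicator_def)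
  also have "\<dots> = emeasure lborel {max x y..min x y + r}"
    by simp
  also have "\<dots> = ennreal (max 0 (r - \<bar>x - y\<bar>))"
    by (auto simp: max_def min_def abs_if ennreal_neg)
  finally show ?thesis .
qed

text \<open>The tent $(r - |x-y|)_+$ is the autocorrelation of an interval of length $r$, so this
  representation exhibits the logarithmic kernel as positive definite without Fourier analysis.\<close>

lemma log_kernel_eq_tents:
  fixes R x y :: real
  assumes "R > 0" "\<bar>x - y\<bar> \<le> R"
  shows "log_kernel R x y =
    (\<integral>\<^sup>+r. ennreal (max 0 (r - \<bar>x - y\<bar>) / r\<^sup>2) * indicator {0<..<R} r \<partial>lborel)
      + ennreal (1 - \<bar>x - y\<bar> / R)"
proof -
  define J where "J d = (\<integral>\<^sup>+r. ennreal (max 0 (r - d) / r\<^sup>2) * indicator {0<..<R} r \<partial>lborel)" for d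
  have pos: "J d = ennreal (ln R - ln d - 1 + d / R)" if d: "0 < d" "d \<le> R" for d
  proof -
    have "J d = (\<integral>\<^sup>+r. ennreal ((r - d) / r\<^sup>2) * indicator {d..R} r \<partial>lborel)"
      unfolding J_def
    proof (rule nn_integral_cong_AE)
      show "AE r in lborel. ennreal (max 0 (r - d) / r\<^sup>2) * indicator {0<..<R} r = ennreal ((r - d) / r\<^sup>2) * indicator {d..R} r"
        using AE_lborel_singleton[of R]
        by (rule eventually_mono) (use d in \<open>auto simp: indicator_def max_def\<close>)
    qed
    \<comment> \<open>The primitive of (r - d)/r^2 is ln r + d/r.\<close>
    also have "\<dots> = ennreal ((ln R + d / R) - (ln d + d / d))"
      using d by (intro nn_integral_FTC_Icc)
        (auto intro!: derivative_eq_intros simp: power2_eq_square field_simps)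
    finally show ?thesis using d by (simp add: algebra_simps)
  qed
  have J0: "J 0 = \<infinity>"
  proof -
    \<comment> \<open>\<open>J\<close> decreases in its argument, and at
      \<open>R * exp (- n - 1)\<close> its closed form is at least n.\<close>
    have "ennreal (real n) \<le> J 0" for n
    proof -
      have "ennreal (real n) \<le> ennreal (ln R - ln (R * exp (- real n - 1)) - 1 + R * exp (- real n - 1) / R)"
        using assms by (intro ennreal_leI) (simp add: ln_mult)
      also have "\<dots> = J (R * exp (- real n - 1))"
        using assms by (subst pos) auto
      also have "\<dots> \<le> J 0"
        unfolding J_def using assms
        by (intro nn_integral_mono mult_right_mono ennreal_leI divide_right_mono)
            (auto simp: le_max_iff_disj intro: order.trans[of _ 0])
      finally show ?thesis .
    qed
    then have "\<And>n::nat. of_nat n \<le> J 0" by (simp add: ennreal_of_nat_eq_real_of_nat)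
    then show ?thesis
      by (metis ennreal_Ex_less_of_nat infinity_ennreal_def leD top.not_eq_extremum)
  qed
  show ?thesis
  proof (cases "x = y")
    case True
    then show ?thesis using J0 by (simp add: J_def log_kernel_def)
  next
    case False
    then have d: "0 < \<bar>x - y\<bar>" by simp
    have "ln \<bar>x - y\<bar> \<le> ln R" using d assms by simp
    have "ln R - ln \<bar>x - y\<bar> - 1 + \<bar>x - y\<bar> / R \<ge> 0"
    proof -
      have "ln (\<bar>x - y\<bar> / R) \<le> \<bar>x - y\<bar> / R - 1"
        using d assms by (intro ln_le_minus_one) auto
      then show ?thesis using d assms by (simp add: ln_div)
    qed
    then have "ennreal (ln R - ln \<bar>x - y\<bar>) = J \<bar>x - y\<bar> + ennreal (1 - \<bar>x - y\<bar> / R)"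
      using assms d by (subst pos) (auto simp flip: ennreal_plus)
    then show ?thesis using False by (simp add: J_def log_kernel_def)
  qed
qed

text \<open>Pointwise, positive part plus \<open>ln R\<close> equals negative part plus shifted
  kernel, as long as |x - s| \<le> R. Integrated, this is the additive identity
  \<open>P + t ln R = N + K\<close>; since \<open>N\<close> is at most \<open>t ln R\<close>, it is
  finite and can be moved to the other side even if the potential is infinite.\<close>

lemma log_potential_eq_kernel:
  fixes \<sigma> :: "real measure"
  assumes sets[measurable_cong]: "sets \<sigma> = sets borel" and fin: "emeasure \<sigma> UNIV = ennreal t" "0 \<le> t"
    and "1 \<le> R" and R: "AE s in \<sigma>. \<bar>x - s\<bar> \<le> R"
  shows "log_potential \<sigma> x + ereal (t * ln R) = enn2ereal (\<integral>\<^sup>+s. log_kernel R x s \<partial>\<sigma>)"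
proof -
  have sp: "space \<sigma> = UNIV" using sets_eq_imp_space_eq[OF sets] by simp
  define P where "P = (\<integral>\<^sup>+ s. (if s = x then \<infinity> else ennreal (- ln \<bar>x - s\<bar>)) \<partial>\<sigma>)"
  define N where "N = (\<integral>\<^sup>+ s. ennreal (ln \<bar>x - s\<bar>) \<partial>\<sigma>)"
  define K where "K = (\<integral>\<^sup>+s. log_kernel R x s \<partial>\<sigma>)"
  have [measurable]: "log_kernel R x \<in> borel_measurable borel"
    unfolding log_kernel_def by measurable
  have const: "(\<integral>\<^sup>+ s. ennreal (ln R) \<partial>\<sigma>) = ennreal (t * ln R)"
    using fin assms(4) by (simp add: sp ennreal_mult' mult.commute)
  have "P + ennreal (t * ln R) = (\<integral>\<^sup>+ s. (if s = x then \<infinity> else ennreal (- ln \<bar>x - s\<bar>)) + ennreal (ln R) \<partial>\<sigma>)"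
    unfolding P_def const[symmetric] by (rule nn_integral_add[symmetric]) measurable
  also have "\<dots> = (\<integral>\<^sup>+ s. ennreal (ln \<bar>x - s\<bar>) + log_kernel R x s \<partial>\<sigma>)"
  proof (rule nn_integral_cong_AE, use R in \<open>rule eventually_mono\<close>)
    fix s assume s: "\<bar>x - s\<bar> \<le> R"
    show "(if s = x then \<infinity> else ennreal (- ln \<bar>x - s\<bar>)) + ennreal (ln R) = ennreal (ln \<bar>x - s\<bar>) + log_kernel R x s"
    proof (cases "s = x")
      case False
      then have "ln \<bar>x - s\<bar> \<le> ln R" using s by simp
      then show ?thesis using False \<open>1 \<le> R\<close>
        by (cases "ln \<bar>x - s\<bar> \<ge> 0") (auto simp: log_kernel_def ennreal_neg simp flip: ennreal_plus)
    qed (simp add: log_kernel_def)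
  qed
  also have "\<dots> = N + K"
    unfolding N_def K_def by (rule nn_integral_add) measurable
  finally have eq: "P + ennreal (t * ln R) = N + K" .
  have "N \<le> ennreal (t * ln R)"
    unfolding N_def const[symmetric]
  proof (rule nn_integral_mono_AE, use R in \<open>rule eventually_mono\<close>)
    fix s assume s: "\<bar>x - s\<bar> \<le> R"
    then show "ennreal (ln \<bar>x - s\<bar>) \<le> ennreal (ln R)"
      using \<open>1 \<le> R\<close> by (cases "x = s") (auto intro!: ennreal_leI)
  qed
  then obtain n where n: "N = ennreal n" "0 \<le> n"
    by (metis ennreal_cases ennreal_less_top infinity_ennreal_def leD)
  have nn: "0 \<le> t * ln R" using assms by auto
  have "log_potential \<sigma> x = enn2ereal P - ereal n"
    unfolding log_potential_def P_def[symmetric] N_def[symmetric] using n by simp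
  moreover have "enn2ereal P + ereal (t * ln R) = ereal n + enn2ereal K"
    using arg_cong[OF eq, of enn2ereal] n nn by (simp add: plus_ennreal.rep_eq)
  ultimately show ?thesis
    unfolding K_def[symmetric]
    by (cases "enn2ereal P"; cases "enn2ereal K") (auto simp: algebra_simps)
qed

text \<open>A point where the distribution functions differ would, by right continuity, give a whole
  interval to its right where they differ, which has positive length. Equal total mass then passes
  from left to right half-lines.\<close>

lemma finite_measures_eqI_AE_atMost:
  fixes \<mu> \<nu> :: "real measure"
  assumes sets: "sets \<mu> = sets borel" "sets \<nu> = sets borel"
    and fin: "finite_measure \<mu>" "finite_measure \<nu>"
    and eq: "AE v in lborel. emeasure \<mu> {..v} = emeasure \<nu> {..v}" and UNIV: "emeasure \<mu> UNIV = emeasure \<nu> UNIV"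
  shows "\<mu> = \<nu>"
proof -
  have sp: "space \<mu> = UNIV" "space \<nu> = UNIV" using sets[THEN sets_eq_imp_space_eq] by auto
  interpret \<mu>: finite_borel_measure \<mu> by (intro finite_borel_measure.intro finite_borel_measure_axioms.intro fin sets)
  interpret \<nu>: finite_borel_measure \<nu> by (intro finite_borel_measure.intro finite_borel_measure_axioms.intro fin sets)
  have cdf: "cdf \<mu> v = cdf \<nu> v" for v
  proof -
    have lim: "((\<lambda>u. cdf \<mu> u - cdf \<nu> u) \<longlongrightarrow> cdf \<mu> v - cdf \<nu> v) (at_right v)"
      using \<mu>.cdf_is_right_cont \<nu>.cdf_is_right_cont unfolding continuous_within by (intro tendsto_diff) auto
    show ?thesis
    proof (rule ccontr)
      assume "cdf \<mu> v \<noteq> cdf \<nu> v"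
      then have "\<forall>\<^sub>F u in at_right v. cdf \<mu> u - cdf \<nu> u \<noteq> 0"
        by (intro tendsto_imp_eventually_ne[OF lim]) auto
      then obtain b where b: "b > v" "\<And>u. v < u \<Longrightarrow> u < b \<Longrightarrow> cdf \<mu> u \<noteq> cdf \<nu> u"
        unfolding eventually_at_right_field by auto
      have "AE u in lborel. u \<notin> {v<..<b}"
        using eq
      proof (rule eventually_mono)
        fix u assume "emeasure \<mu> {..u} = emeasure \<nu> {..u}"
        then have "cdf \<mu> u = cdf \<nu> u" by (simp add: cdf_def measure_def)
        then show "u \<notin> {v<..<b}" using b(2)[of u] by auto
      qed
      then have "emeasure lborel {v<..<b} = 0"
        by (subst (asm) AE_iff_measurable[where N = "{v<..<b}"]) auto
      then show False using b(1) by simp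
    qed
  qed
  show ?thesis
  proof (rule measure_eqI_lessThan)
    fix x
    show "emeasure \<mu> {x<..} < \<infinity>" by (simp add: less_top[symmetric])
    have "measure \<mu> {x<..} = measure \<mu> UNIV - cdf \<mu> x" "measure \<nu> {x<..} = measure \<nu> UNIV - cdf \<nu> x"
      using \<mu>.finite_measure_compl[of "{..x}"] \<nu>.finite_measure_compl[of "{..x}"] sets sp
      by (auto simp: cdf_def Compl_eq_Diff_UNIV[symmetric])
    then show "emeasure \<mu> {x<..} = emeasure \<nu> {x<..}"
      using cdf UNIV by (simp add: \<mu>.emeasure_eq_measure \<nu>.emeasure_eq_measure)
  qed (use sets in auto)
qed

text \<open>The kernel is a superposition of tents of all widths r < R plus one tent of width R. The
  superposition only needs the energy inequality; the equality case is read off from the single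
  tent, which shows that the measures agree on almost every window [v - R, v]. As R is at least the
  diameter of a set carrying both measures, such windows determine the distribution
  functions.\<close>

lemma log_energy_equality_imp_eq:
  fixes \<mu> \<nu> :: "real measure"
  assumes sets: "sets \<mu> = sets borel" "sets \<nu> = sets borel"
    and fin: "finite_measure \<mu>" "finite_measure \<nu>" and UNIV: "emeasure \<mu> UNIV = emeasure \<nu> UNIV"
    and L: "AE s in \<mu>. \<bar>s\<bar> \<le> L" "AE s in \<nu>. \<bar>s\<bar> \<le> L" and R: "0 < R" "2 * L \<le> R"
  defines "E \<equiv> \<lambda>\<alpha> \<beta>. \<integral>\<^sup>+x. (\<integral>\<^sup>+y. log_kernel R x y \<partial>\<beta>) \<partial>\<alpha>"
  assumes finE: "E \<mu> \<mu> < \<infinity>" "E \<nu> \<nu> < \<infinity>" and E: "E \<mu> \<mu> + E \<nu> \<nu> \<le> 2 * E \<mu> \<nu>"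
  shows "\<mu> = \<nu>"
proof -
  interpret \<mu>: finite_measure \<mu> by fact
  interpret \<nu>: finite_measure \<nu> by fact
  note [measurable_cong] = sets
  have sp: "space \<mu> = UNIV" "space \<nu> = UNIV" using sets[THEN sets_eq_imp_space_eq] by auto
  \<comment> \<open>The parameter is p = (r, v): an interval of length r ending its sweep at v. The
    factor 1/r occurs twice in the product and yields the weight 1/r^2 of the tent
    representation.\<close>
  define g1 where "g1 x p = (case p of (r, v) \<Rightarrow> if 0 < r \<and> r < R \<and> x \<le> v \<and> v \<le> x + r then ennreal (1 / r) else 0)"
    for x :: real and p :: "real \<times> real"
  \<comment> \<open>The correlation of two such functions is (R - |x - y|)/R, the remaining summand
    of the tent representation.\<close>
  define g2 where "g2 x v = ennreal (1 / sqrt R) * indicator {x..x+R} v" for x v :: real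
  have g1[measurable]: "(\<lambda>(x, p). g1 x p) \<in> borel_measurable (borel \<Otimes>\<^sub>M (borel \<Otimes>\<^sub>M borel))"
    unfolding g1_def by measurable
  have "(\<lambda>(x, v). g2 x v) = (\<lambda>(x::real, v). if x \<le> v \<and> v \<le> x + R then ennreal (1 / sqrt R) else 0)"
    unfolding g2_def by (auto simp: fun_eq_iff indicator_def)
  then have g2[measurable]: "(\<lambda>(x, v). g2 x v) \<in> borel_measurable (borel \<Otimes>\<^sub>M borel)"
    by simp
  define T1 where "T1 x y = (\<integral>\<^sup>+p. g1 x p * g1 y p \<partial>(lborel \<Otimes>\<^sub>M lborel))" for x y
  define T2 where "T2 x y = (\<integral>\<^sup>+v. g2 x v * g2 y v \<partial>lborel)" for x y
  have sf: "sigma_finite_measure (lborel \<Otimes>\<^sub>M lborel :: (real \<times> real) measure)"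
    by (simp add: lborel_prod lborel.sigma_finite_measure_axioms)
  interpret sf: sigma_finite_measure "lborel \<Otimes>\<^sub>M lborel :: (real \<times> real) measure" by (rule sf)
  have T1_meas[measurable]: "(\<lambda>(x, y). T1 x y) \<in> borel_measurable (borel \<Otimes>\<^sub>M borel)"
    unfolding T1_def by measurable
  have T2_meas[measurable]: "(\<lambda>(x, y). T2 x y) \<in> borel_measurable (borel \<Otimes>\<^sub>M borel)"
    unfolding T2_def by measurable
  have T1: "T1 x y = (\<integral>\<^sup>+r. ennreal (max 0 (r - \<bar>x - y\<bar>) / r\<^sup>2) * indicator {0<..<R} r \<partial>lborel)" for x y
  proof -
    have "T1 x y = (\<integral>\<^sup>+r. (\<integral>\<^sup>+v. g1 x (r, v) * g1 y (r, v) \<partial>lborel) \<partial>lborel)"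
      unfolding T1_def by (rule lborel.nn_integral_fst[symmetric]) measurable
    also have "\<dots> = (\<integral>\<^sup>+r. ennreal (max 0 (r - \<bar>x - y\<bar>) / r\<^sup>2) * indicator {0<..<R} r \<partial>lborel)"
    proof (rule nn_integral_cong)
      fix r :: real
      show "(\<integral>\<^sup>+v. g1 x (r, v) * g1 y (r, v) \<partial>lborel) = ennreal (max 0 (r - \<bar>x - y\<bar>) / r\<^sup>2) * indicator {0<..<R} r"
      proof (cases "0 < r \<and> r < R")
        case True
        then have "(\<integral>\<^sup>+v. g1 x (r, v) * g1 y (r, v) \<partial>lborel)
            = (\<integral>\<^sup>+v. ennreal (1 / r\<^sup>2) * (indicator {x..x+r} v * indicator {y..y+r} v) \<partial>lborel)"
          by (intro nn_integral_cong)
            (auto simp: g1_def indicator_def ennreal_mult[symmetric] power2_eq_square)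
        also have "\<dots> = ennreal (1 / r\<^sup>2) * ennreal (max 0 (r - \<bar>x - y\<bar>))"
          using True by (subst nn_integral_cmult) (auto simp: nn_integral_tent)
        finally show ?thesis using True by (simp add: ennreal_mult[symmetric])
      qed (auto simp: g1_def)
    qed
    finally show ?thesis .
  qed
  have T2: "T2 x y = ennreal (1 - \<bar>x - y\<bar> / R)" if "\<bar>x - y\<bar> \<le> R" for x y
  proof -
    have "T2 x y = (\<integral>\<^sup>+v. ennreal (1 / R) * (indicator {x..x+R} v * indicator {y..y+R} v) \<partial>lborel)"
      unfolding T2_def using R
      by (intro nn_integral_cong) (auto simp: g2_def indicator_def ennreal_mult[symmetric])
    also have "\<dots> = ennreal (1 / R) * ennreal (max 0 (R - \<bar>x - y\<bar>))"
      using R by (subst nn_integral_cmult) (auto simp: nn_integral_tent)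
    also have "\<dots> = ennreal (1 - \<bar>x - y\<bar> / R)"
      using R that by (simp add: ennreal_mult[symmetric] field_simps)
    finally show ?thesis .
  qed
  define E1 where "E1 \<alpha> \<beta> = (\<integral>\<^sup>+x. (\<integral>\<^sup>+y. T1 x y \<partial>\<beta>) \<partial>\<alpha>)" for \<alpha> \<beta>
  define E2 where "E2 \<alpha> \<beta> = (\<integral>\<^sup>+x. (\<integral>\<^sup>+y. T2 x y \<partial>\<beta>) \<partial>\<alpha>)" for \<alpha> \<beta>
  have split: "E \<alpha> \<beta> = E1 \<alpha> \<beta> + E2 \<alpha> \<beta>"
    if "finite_measure \<alpha>" "finite_measure \<beta>" and [measurable_cong]: "sets \<alpha> = sets borel" "sets \<beta> = sets borel"
      and L': "AE s in \<alpha>. \<bar>s\<bar> \<le> L" "AE s in \<beta>. \<bar>s\<bar> \<le> L" for \<alpha> \<beta>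
  proof -
    interpret \<alpha>: finite_measure \<alpha> by fact
    interpret \<beta>: finite_measure \<beta> by fact
    have "E \<alpha> \<beta> = (\<integral>\<^sup>+x. (\<integral>\<^sup>+y. T1 x y \<partial>\<beta>) + (\<integral>\<^sup>+y. T2 x y \<partial>\<beta>) \<partial>\<alpha>)"
      unfolding E_def
    proof (rule nn_integral_cong_AE, use L'(1) in \<open>rule eventually_mono\<close>)
      fix x assume x: "\<bar>x\<bar> \<le> L"
      have "(\<integral>\<^sup>+y. log_kernel R x y \<partial>\<beta>) = (\<integral>\<^sup>+y. T1 x y + T2 x y \<partial>\<beta>)"
      proof (rule nn_integral_cong_AE, use L'(2) in \<open>rule eventually_mono\<close>)
        fix y assume "\<bar>y\<bar> \<le> L"
        then have "\<bar>x - y\<bar> \<le> R" using x R by linarith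
        then show "log_kernel R x y = T1 x y + T2 x y"
          using R by (simp add: T1 T2 log_kernel_eq_tents)
      qed
      also have "\<dots> = (\<integral>\<^sup>+y. T1 x y \<partial>\<beta>) + (\<integral>\<^sup>+y. T2 x y \<partial>\<beta>)"
        by (rule nn_integral_add) measurable
      finally show "(\<integral>\<^sup>+y. log_kernel R x y \<partial>\<beta>) = (\<integral>\<^sup>+y. T1 x y \<partial>\<beta>) + (\<integral>\<^sup>+y. T2 x y \<partial>\<beta>)" .
    qed
    also have "\<dots> = E1 \<alpha> \<beta> + E2 \<alpha> \<beta>"
      unfolding E1_def E2_def by (rule nn_integral_add) measurable
    finally show ?thesis .
  qed
  define m where "m \<alpha> v = (\<integral>\<^sup>+x. g2 x v \<partial>\<alpha>)" for \<alpha> v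
  have m: "m \<alpha> v = ennreal (1 / sqrt R) * emeasure \<alpha> {v-R..v}" if [measurable_cong]: "sets \<alpha> = sets borel" for \<alpha> v
  proof -
    have "m \<alpha> v = (\<integral>\<^sup>+x. ennreal (1 / sqrt R) * indicator {v-R..v} x \<partial>\<alpha>)"
      unfolding m_def g2_def by (intro nn_integral_cong) (auto simp: indicator_def)
    also have "\<dots> = ennreal (1 / sqrt R) * emeasure \<alpha> {v-R..v}"
      by (rule nn_integral_cmult_indicator) measurable
    finally show ?thesis .
  qed
  have mfin: "m \<mu> v < \<infinity>" "m \<nu> v < \<infinity>" for v
    using R by (simp_all add: m sets \<mu>.emeasure_eq_measure \<nu>.emeasure_eq_measure flip: ennreal_mult)
  define Q where "Q = (\<integral>\<^sup>+v. ennreal ((enn2real (m \<mu> v) - enn2real (m \<nu> v))\<^sup>2) \<partial>lborel)"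
  have [measurable]: "m \<mu> \<in> borel_measurable borel" "m \<nu> \<in> borel_measurable borel"
    unfolding m_def by measurable
  have seq: "sets \<nu> = sets \<mu>" using sets by simp
  have g1': "(\<lambda>(x, p). g1 x p) \<in> borel_measurable (\<mu> \<Otimes>\<^sub>M (lborel \<Otimes>\<^sub>M lborel))"
    and g2': "(\<lambda>(x, v). g2 x v) \<in> borel_measurable (\<mu> \<Otimes>\<^sub>M lborel)"
    by measurable
  have 1: "2 * E1 \<mu> \<nu> \<le> E1 \<mu> \<mu> + E1 \<nu> \<nu>"
    unfolding E1_def T1_def by (rule nn_integral_energy_parallelogram(1)[OF sf fin seq g1'])
  have 2: "E2 \<mu> \<mu> + E2 \<nu> \<nu> = 2 * E2 \<mu> \<nu> + Q"
    unfolding E2_def T2_def Q_def m_def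
    by (rule nn_integral_energy_parallelogram(2)[OF lborel.sigma_finite_measure_axioms fin seq g2' mfin[unfolded m_def]])
  have "2 * E \<mu> \<nu> + Q \<le> E \<mu> \<mu> + E \<nu> \<nu>"
    using add_mono[OF 1 eq_refl[OF 2[symmetric]]]
    by (simp add: split[OF fin sets L] split[OF fin(1,1) sets(1,1) L(1,1)] split[OF fin(2,2) sets(2,2) L(2,2)]
        distrib_left add_ac)
  moreover have "E \<mu> \<mu> + E \<nu> \<nu> < \<infinity>" using finE by simp
  \<comment> \<open>Finiteness of the energies is what allows \<open>2 * E \<mu> \<nu>\<close> to be
    cancelled.\<close>
  ultimately have "Q = 0"
    using E by (metis (no_types, lifting) add.commute add_0 ennreal_add_left_cancel_le infinity_ennreal_def
        le_zero_eq less_le_not_le linorder_not_less order_trans top.not_eq_extremum top_greatest)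
  then have ae: "AE v in lborel. enn2real (m \<mu> v) = enn2real (m \<nu> v)"
    unfolding Q_def by (subst (asm) nn_integral_0_iff_AE) auto
  show ?thesis
  proof (rule finite_measures_eqI_AE_atMost[OF sets fin _ UNIV])
    show "AE v in lborel. emeasure \<mu> {..v} = emeasure \<nu> {..v}"
      using ae
    proof (rule eventually_mono)
      fix v assume "enn2real (m \<mu> v) = enn2real (m \<nu> v)"
      then have *: "measure \<mu> {v-R..v} = measure \<nu> {v-R..v}"
        using R by (simp add: m sets \<mu>.emeasure_eq_measure \<nu>.emeasure_eq_measure enn2real_mult)
      \<comment> \<open>For v \<le> L the window starts at v - R \<le> L - 2 L = -L, so nothing of
        the measure lies to its left; for v > L the half-line carries everything.\<close>
      have **: "measure \<alpha> {..v} = (if v > L then measure \<alpha> UNIV else measure \<alpha> {v-R..v})"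
        if "finite_measure \<alpha>" and s: "sets \<alpha> = sets borel" and L': "AE s in \<alpha>. \<bar>s\<bar> \<le> L" for \<alpha>
      proof -
        interpret \<alpha>: finite_measure \<alpha> by fact
        show ?thesis
        proof (cases "v > L")
          case True
          then show ?thesis using s
            by (simp, intro \<alpha>.finite_measure_eq_AE) (auto intro!: eventually_mono[OF L'])
        next
          case False
          then show ?thesis using s R
            by (simp, intro \<alpha>.finite_measure_eq_AE) (auto intro!: eventually_mono[OF L'])
        qed
      qed
      have "measure \<mu> UNIV = measure \<nu> UNIV" using UNIV by (simp add: measure_def)
      then show "emeasure \<mu> {..v} = emeasure \<nu> {..v}"
        using * **[OF fin(1) sets(1) L(1)] **[OF fin(2) sets(2) L(2)]
        by (simp add: \<mu>.emeasure_eq_measure \<nu>.emeasure_eq_measure)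
    qed
  qed
qed

text \<open>Each variational condition is integrated against both measures: equality on the own
  support gives the self-energy, the inequality everywhere bounds the mutual energy from below.
  Adding up, the field terms and the constants match because the masses are equal, and
  E(\<mu>,\<mu>) + E(\<nu>,\<nu>) \<le> 2 E(\<mu>,\<nu>) remains, which is the equality case of
  positive definiteness.\<close>

theorem equilibrium_measure_unique:
  assumes \<mu>: "is_equilibrium_measure \<phi> t \<mu>" and \<nu>: "is_equilibrium_measure \<phi> t \<nu>"
    and t: "t > 0" and \<phi>: "continuous_on UNIV \<phi>"
  shows "\<mu> = \<nu>"
proof -
  have [measurable]: "\<phi> \<in> borel_measurable borel"
    using \<phi> by (rule borel_measurable_continuous_onI)
  obtain c1 where 1: "sets \<mu> = sets borel" "emeasure \<mu> UNIV = ennreal t" "compact (measure_support \<mu>)"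
    "\<And>x. x \<in> measure_support \<mu> \<Longrightarrow> log_potential \<mu> x + ereal (\<phi> x) = ereal c1"
    "\<And>x. log_potential \<mu> x + ereal (\<phi> x) \<ge> ereal c1"
    using \<mu> unfolding is_equilibrium_measure_def by auto
  obtain c2 where 2: "sets \<nu> = sets borel" "emeasure \<nu> UNIV = ennreal t" "compact (measure_support \<nu>)"
    "\<And>x. x \<in> measure_support \<nu> \<Longrightarrow> log_potential \<nu> x + ereal (\<phi> x) = ereal c2"
    "\<And>x. log_potential \<nu> x + ereal (\<phi> x) \<ge> ereal c2"
    using \<nu> unfolding is_equilibrium_measure_def by auto
  note [measurable_cong] = 1(1) 2(1)
  have sp: "space \<mu> = UNIV" "space \<nu> = UNIV" using 1(1)[THEN sets_eq_imp_space_eq] 2(1)[THEN sets_eq_imp_space_eq] by auto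
  interpret \<mu>: finite_measure \<mu> by standard (simp add: sp 1)
  interpret \<nu>: finite_measure \<nu> by standard (simp add: sp 2)
  have "bounded (measure_support \<mu> \<union> measure_support \<nu>)"
    using 1(3) 2(3) by (simp add: compact_imp_bounded)
  then obtain L where L: "\<And>x. x \<in> measure_support \<mu> \<union> measure_support \<nu> \<Longrightarrow> \<bar>x\<bar> \<le> L"
    unfolding bounded_iff by auto
  have AEL: "AE s in \<mu>. \<bar>s\<bar> \<le> L" "AE s in \<nu>. \<bar>s\<bar> \<le> L"
    using AE_measure_support[OF 1(1)] AE_measure_support[OF 2(1)] L by (auto elim!: eventually_mono)
  obtain F where F: "\<And>x. \<bar>x\<bar> \<le> L \<Longrightarrow> \<bar>\<phi> x\<bar> \<le> F"
  proof -
    have "bounded (\<phi> ` {-L..L})"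
      using \<phi> by (intro compact_imp_bounded compact_continuous_image) (auto intro: continuous_on_subset)
    then show ?thesis using that unfolding bounded_iff by (metis abs_le_iff atLeastAtMost_iff imageI minus_le_iff real_norm_def)
  qed
  \<comment> \<open>The entry 1 makes \<open>ln R\<close> nonnegative, \<open>2 * L\<close> makes
    the kernel nonnegative on the supports, and the exponentials make the shifted constants dominate
    \<phi> on [-L, L], so that the conversion to \<open>ennreal\<close> does not truncate
    \<open>C1 - \<phi>\<close> and \<open>C2 - \<phi>\<close>.\<close>
  define R where "R = Max {1, 2 * L, exp ((F - c1) / t), exp ((F - c2) / t)}"
  have R: "1 \<le> R" "2 * L \<le> R" "exp ((F - c1) / t) \<le> R" "exp ((F - c2) / t) \<le> R"
    unfolding R_def by (auto intro!: Max_ge)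
  have lnR: "F \<le> c + t * ln R" if "exp ((F - c) / t) \<le> R" for c
  proof -
    have "(F - c) / t \<le> ln R"
      using that ln_ge_iff[of R "(F - c) / t"] R(1) by linarith
    then show ?thesis using t by (simp add: field_simps)
  qed
  define C1 where "C1 = c1 + t * ln R"
  define C2 where "C2 = c2 + t * ln R"
  have C: "0 \<le> C1 - \<phi> x" "0 \<le> C2 - \<phi> x" if "\<bar>x\<bar> \<le> L" for x
    using F[OF that] lnR[OF R(3)] lnR[OF R(4)] by (auto simp: C1_def C2_def)
  define E where "E \<alpha> \<beta> = (\<integral>\<^sup>+x. (\<integral>\<^sup>+y. log_kernel R x y \<partial>\<beta>) \<partial>\<alpha>)" for \<alpha> \<beta>
  have pot: "(x \<in> measure_support \<alpha> \<longrightarrow> (\<integral>\<^sup>+y. log_kernel R x y \<partial>\<alpha>) = ennreal (c + t * ln R - \<phi> x))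
      \<and> ennreal (c + t * ln R - \<phi> x) \<le> (\<integral>\<^sup>+y. log_kernel R x y \<partial>\<alpha>)"
    if "sets \<alpha> = sets borel" "emeasure \<alpha> UNIV = ennreal t" "AE s in \<alpha>. \<bar>s\<bar> \<le> L"
      "\<And>x. x \<in> measure_support \<alpha> \<Longrightarrow> log_potential \<alpha> x + ereal (\<phi> x) = ereal c"
      "\<And>x. log_potential \<alpha> x + ereal (\<phi> x) \<ge> ereal c" and x: "\<bar>x\<bar> \<le> L" "0 \<le> c + t * ln R - \<phi> x" for \<alpha> c x
  proof -
    have ae: "AE s in \<alpha>. \<bar>x - s\<bar> \<le> R"
      using that(3) by (rule eventually_mono) (use x R in auto)
    let ?K = "\<integral>\<^sup>+y. log_kernel R x y \<partial>\<alpha>"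
    have K: "log_potential \<alpha> x + ereal (t * ln R) = enn2ereal ?K"
      by (rule log_potential_eq_kernel) (use that t R ae in auto)
    have "x \<in> measure_support \<alpha> \<Longrightarrow> enn2ereal ?K = ereal (c + t * ln R - \<phi> x)"
      using that(4)[of x] K by (cases "log_potential \<alpha> x") auto
    moreover have "ereal (c + t * ln R - \<phi> x) \<le> enn2ereal ?K"
      unfolding K[symmetric] using that(5)[of x] by (cases "log_potential \<alpha> x") auto
    moreover have "?K = e2ennreal (enn2ereal ?K)" by simp
    ultimately show ?thesis
      by (metis e2ennreal_mono ennreal.rep_eq e2ennreal_enn2ereal enn2ereal_ennreal x(2))
  qed
  note pot1 = pot[OF 1(1,2) AEL(1) 1(4,5), folded C1_def]
  note pot2 = pot[OF 2(1,2) AEL(2) 2(4,5), folded C2_def]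
  have int\<phi>: "integrable \<mu> \<phi>" "integrable \<nu> \<phi>"
    using AEL F by (auto intro!: \<mu>.integrable_const_bound[where B=F] \<nu>.integrable_const_bound[where B=F] elim!: eventually_mono)
  have meas: "measure \<mu> UNIV = t" "measure \<nu> UNIV = t" using 1(2) 2(2) t by (auto simp: measure_def)
  have int: "(\<integral>\<^sup>+x. ennreal (c - \<phi> x) \<partial>\<mu>) = ennreal (c * t - (\<integral>x. \<phi> x \<partial>\<mu>))"
       "0 \<le> c * t - (\<integral>x. \<phi> x \<partial>\<mu>)"
       "(\<integral>\<^sup>+x. ennreal (c - \<phi> x) \<partial>\<nu>) = ennreal (c * t - (\<integral>x. \<phi> x \<partial>\<nu>))"
       "0 \<le> c * t - (\<integral>x. \<phi> x \<partial>\<nu>)"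
    if c: "\<And>x. \<bar>x\<bar> \<le> L \<Longrightarrow> 0 \<le> c - \<phi> x" for c
  proof -
    have p: "AE x in \<mu>. 0 \<le> c - \<phi> x" "AE x in \<nu>. 0 \<le> c - \<phi> x" using AEL c by (auto elim!: eventually_mono)
    have e: "(\<integral>x. c - \<phi> x \<partial>\<mu>) = c * t - (\<integral>x. \<phi> x \<partial>\<mu>)" "(\<integral>x. c - \<phi> x \<partial>\<nu>) = c * t - (\<integral>x. \<phi> x \<partial>\<nu>)"
      using int\<phi> meas sp by (auto simp: mult.commute)
    show "(\<integral>\<^sup>+x. ennreal (c - \<phi> x) \<partial>\<mu>) = ennreal (c * t - (\<integral>x. \<phi> x \<partial>\<mu>))"
       "(\<integral>\<^sup>+x. ennreal (c - \<phi> x) \<partial>\<nu>) = ennreal (c * t - (\<integral>x. \<phi> x \<partial>\<nu>))"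
      unfolding e[symmetric] using int\<phi> p by (intro nn_integral_eq_integral; simp)+
    show "0 \<le> c * t - (\<integral>x. \<phi> x \<partial>\<mu>)" "0 \<le> c * t - (\<integral>x. \<phi> x \<partial>\<nu>)"
      unfolding e[symmetric] using p by (auto intro!: integral_nonneg_AE)
  qed
  note I1 = int[OF C(1)] and I2 = int[OF C(2)]
  have "E \<mu> \<mu> = (\<integral>\<^sup>+x. ennreal (C1 - \<phi> x) \<partial>\<mu>)"
    unfolding E_def by (rule nn_integral_cong_AE, rule eventually_mono[OF AE_measure_support[OF 1(1)]])
      (use pot1 L C in auto)
  then have X: "E \<mu> \<mu> = ennreal (C1 * t - (\<integral>x. \<phi> x \<partial>\<mu>))" using I1 by simp
  have "E \<nu> \<nu> = (\<integral>\<^sup>+x. ennreal (C2 - \<phi> x) \<partial>\<nu>)"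
    unfolding E_def by (rule nn_integral_cong_AE, rule eventually_mono[OF AE_measure_support[OF 2(1)]])
      (use pot2 L C in auto)
  then have Y: "E \<nu> \<nu> = ennreal (C2 * t - (\<integral>x. \<phi> x \<partial>\<nu>))" using I2 by simp
  have "(\<integral>\<^sup>+x. ennreal (C2 - \<phi> x) \<partial>\<mu>) \<le> E \<mu> \<nu>"
    unfolding E_def by (rule nn_integral_mono_AE, rule eventually_mono[OF AEL(1)])
      (use pot2 L C in auto)
  then have Z: "ennreal (C2 * t - (\<integral>x. \<phi> x \<partial>\<mu>)) \<le> E \<mu> \<nu>" using I2 by simp
  have "(\<integral>\<^sup>+x. ennreal (C1 - \<phi> x) \<partial>\<nu>) \<le> E \<nu> \<mu>"
    unfolding E_def by (rule nn_integral_mono_AE, rule eventually_mono[OF AEL(2)])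
      (use pot1 L C in auto)
  then have Z': "ennreal (C1 * t - (\<integral>x. \<phi> x \<partial>\<nu>)) \<le> E \<nu> \<mu>" using I1 by simp
  have "(\<lambda>(x, y). log_kernel R x y) \<in> borel_measurable (borel \<Otimes>\<^sub>M borel)"
    unfolding log_kernel_def by measurable
  then have [measurable]: "(\<lambda>(x, y). log_kernel R x y) \<in> borel_measurable (\<mu> \<Otimes>\<^sub>M \<nu>)" by measurable
  interpret pair_sigma_finite \<mu> \<nu> ..
  have "E \<nu> \<mu> = (\<integral>\<^sup>+x. (\<integral>\<^sup>+y. log_kernel R y x \<partial>\<mu>) \<partial>\<nu>)"
    unfolding E_def log_kernel_def by (intro nn_integral_cong) (auto simp: abs_minus_commute)
  also have "\<dots> = E \<mu> \<nu>"
    unfolding E_def by (rule Fubini') measurable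
  finally have sym: "E \<nu> \<mu> = E \<mu> \<nu>" .
  have "E \<mu> \<mu> + E \<nu> \<nu> \<le> 2 * E \<mu> \<nu>"
  proof -
    \<comment> \<open>Here equal mass is used: \<open>C1 * t\<close> and \<open>C2 * t\<close> can
      be interchanged between the two terms.\<close>
    have "E \<mu> \<mu> + E \<nu> \<nu> = ennreal (C2 * t - (\<integral>x. \<phi> x \<partial>\<mu>)) + ennreal (C1 * t - (\<integral>x. \<phi> x \<partial>\<nu>))"
      unfolding X Y using I1 I2 by (simp flip: ennreal_plus)
    also have "\<dots> \<le> E \<mu> \<nu> + E \<mu> \<nu>" using Z Z' sym by (intro add_mono) auto
    finally show ?thesis by (simp add: mult_2)
  qed
  then show ?thesis
    using X Y unfolding E_def
    by (intro log_energy_equality_imp_eq[OF 1(1) 2(1) \<mu>.finite_measure_axioms \<nu>.finite_measure_axioms _ AEL _ R(2)])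
      (use R 1 2 in auto)
qed

section \<open>The square root and the semicircle integral\<close>

text \<open>The quotient (z - b)/(z - a) maps (a, b] onto the nonpositive half-line, which is the
  cut of \<open>csqrt\<close>, and tends to 1 at infinity. So this formula is holomorphic off [a, b]
  and behaves like z, whereas \<open>csqrt ((z - a) * (z - b))\<close> would have further
  cuts.\<close>

definition sqrt_branch :: "real \<Rightarrow> real \<Rightarrow> complex \<Rightarrow> complex" where
  "sqrt_branch a b z = (z - of_real a) * csqrt ((z - of_real b) / (z - of_real a))"

lemma sqrt_branch_quotient_notin:
  assumes "a < b" "z \<notin> complex_of_real ` {a..b}"
  shows "z \<noteq> of_real a" "(z - of_real b) / (z - of_real a) \<notin> \<real>\<^sub>\<le>\<^sub>0"
proof -
  show na: "z \<noteq> of_real a" using assms by (metis atLeastAtMost_iff imageI less_eq_real_def order_refl)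
  show "(z - of_real b) / (z - of_real a) \<notin> \<real>\<^sub>\<le>\<^sub>0"
  proof
    assume "(z - of_real b) / (z - of_real a) \<in> \<real>\<^sub>\<le>\<^sub>0"
    then obtain s where s: "(z - of_real b) / (z - of_real a) = of_real (- s)" "s \<ge> 0"
      by (metis minus_minus neg_0_le_iff_le nonpos_Reals_cases)
    then have "z - of_real b = of_real (- s) * (z - of_real a)" using na by (simp add: divide_eq_eq)
    then have "z * of_real (1 + s) = of_real (b + s * a)" by (simp add: algebra_simps)
    then have "z = of_real ((b + s * a) / (1 + s))" using s(2)
      by (smt (verit) divide_eq_eq nonzero_mult_div_cancel_right of_real_divide of_real_eq_0_iff)
    moreover have "(b + s * a) / (1 + s) \<in> {a..b}"
    proof -
      have "a * (1 + s) \<le> b + s * a" "b + s * a \<le> b * (1 + s)"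
        using assms(1) s(2) mult_left_mono[of a b s] by (auto simp: algebra_simps)
      then show ?thesis using s(2) by (auto simp: field_simps)
    qed
    ultimately show False using assms(2) by blast
  qed
qed

lemma power2_sqrt_branch:
  assumes "z \<noteq> of_real a"
  shows "(sqrt_branch a b z)\<^sup>2 = (z - of_real a) * (z - of_real b)"
  using assms by (simp add: sqrt_branch_def power_mult_distrib) (simp add: power2_eq_square field_simps)

lemma holomorphic_on_sqrt_branch:
  assumes "a < b"
  shows "sqrt_branch a b holomorphic_on - (complex_of_real ` {a..b})"
  unfolding sqrt_branch_def
  using sqrt_branch_quotient_notin[OF assms]
  by (intro holomorphic_intros) auto

lemma cnj_sqrt_branch:
  assumes "a < b" "z \<notin> complex_of_real ` {a..b}"
  shows "sqrt_branch a b (cnj z) = cnj (sqrt_branch a b z)"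
  using cnj_csqrt[OF sqrt_branch_quotient_notin(2)[OF assms]] by (simp add: sqrt_branch_def)

lemma sqrt_branch_at_infinity:
  "((\<lambda>z. sqrt_branch a b z / z) \<longlongrightarrow> 1) at_infinity"
proof -
  have inv: "((\<lambda>z. c / z) \<longlongrightarrow> 0) at_infinity" for c :: complex
    by (rule tendsto_divide_0[OF tendsto_const]) (simp add: filterlim_ident)
  have *: "((\<lambda>z. (1 - of_real a / z) * csqrt ((1 - of_real b / z) / (1 - of_real a / z))) \<longlongrightarrow> (1 - 0) * csqrt ((1 - 0) / (1 - 0))) at_infinity"
    by (intro tendsto_intros inv isCont_tendsto_compose[OF continuous_at_csqrt]) auto
  show ?thesis
  proof (rule Lim_transform_eventually)
    show "((\<lambda>z. (1 - of_real a / z) * csqrt ((1 - of_real b / z) / (1 - of_real a / z))) \<longlongrightarrow> 1) at_infinity"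
      using * by simp
    show "\<forall>\<^sub>F z in at_infinity. (1 - of_real a / z) * csqrt ((1 - of_real b / z) / (1 - of_real a / z)) = sqrt_branch a b z / z"
      using eventually_not_equal_at_infinity[of 0]
    proof (rule eventually_mono)
      fix z :: complex assume "z \<noteq> 0"
      then have "1 - of_real a / z = (z - of_real a) / z" "1 - of_real b / z = (z - of_real b) / z" by (simp_all add: field_simps)
      then show "(1 - of_real a / z) * csqrt ((1 - of_real b / z) / (1 - of_real a / z)) = sqrt_branch a b z / z"
        using \<open>z \<noteq> 0\<close> by (simp add: sqrt_branch_def)
    qed
  qed
qed

text \<open>With $c$ the square root in the definition of the branch, $(z - m)/h = (1 + c^2)/(1 - c^2)$,
  $\sqrt{(z-a)(z-b)}/h = 2c/(1 - c^2)$, and their difference is the inverse Joukowski map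
  $(1 - c)/(1 + c)$, which lies in the unit disc because $\mathrm{Re}\, c > 0$.\<close>

lemma sqrt_branch_cayley:
  assumes "a < b" "z \<notin> complex_of_real ` {a..b}"
  obtains c where "Re c > 0" "c\<^sup>2 \<noteq> 1" 
    "z - of_real ((a + b) / 2) = of_real ((b - a) / 2) * ((1 + c\<^sup>2) / (1 - c\<^sup>2))"
    "sqrt_branch a b z = of_real ((b - a) / 2) * (2 * c / (1 - c\<^sup>2))"
proof -
  define c where "c = csqrt ((z - of_real b) / (z - of_real a))"
  note n = sqrt_branch_quotient_notin[OF assms]
  have za: "z - of_real a \<noteq> 0" using n by simp
  have c2: "c\<^sup>2 = (z - of_real b) / (z - of_real a)" by (simp add: c_def)
  have "Re c \<noteq> 0"
  proof
    assume "Re c = 0"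
    then have "c\<^sup>2 = of_real (- (Im c)\<^sup>2)" by (simp add: complex_eq_iff power2_eq_square)
    then have "c\<^sup>2 \<in> \<real>\<^sub>\<le>\<^sub>0" by (simp only: nonpos_Reals_of_real_iff) simp
    then show False using n c2 by simp
  qed
  then have "Re c > 0" using Re_csqrt[of "(z - of_real b) / (z - of_real a)"] by (simp add: c_def)
  have ba: "of_real b - of_real a \<noteq> (0::complex)" using assms(1) by simp
  have m: "1 - c\<^sup>2 = (of_real b - of_real a) / (z - of_real a)" "1 + c\<^sup>2 = (2 * z - of_real a - of_real b) / (z - of_real a)"
  proof -
    have 1: "1 = (z - of_real a) / (z - of_real a)" using za by simp
    show "1 - c\<^sup>2 = (of_real b - of_real a) / (z - of_real a)"
      unfolding c2 by (subst 1) (simp only: diff_divide_distrib[symmetric], simp)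
    show "1 + c\<^sup>2 = (2 * z - of_real a - of_real b) / (z - of_real a)"
      unfolding c2 by (subst 1) (simp only: add_divide_distrib[symmetric], simp)
  qed
  have canc: "of_real ((b - a) / 2) * (X / (of_real b - of_real a)) = X / 2" for X :: complex
  proof -
    have "B / 2 * (X / B) = X / 2" if "B \<noteq> 0" for B :: complex using that by simp
    from this[OF ba] show ?thesis by simp
  qed
  show ?thesis
  proof (rule that[of c])
    show "Re c > 0" by fact
    show "c\<^sup>2 \<noteq> 1" using m(1) ba za by auto
    show "z - of_real ((a + b) / 2) = of_real ((b - a) / 2) * ((1 + c\<^sup>2) / (1 - c\<^sup>2))"
    proof -
      have "(1 + c\<^sup>2) / (1 - c\<^sup>2) = (2 * z - of_real a - of_real b) / (of_real b - of_real a)"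
        unfolding m using za by simp
      then show ?thesis by (simp only: canc) (simp add: diff_divide_distrib add_divide_distrib)
    qed
    show "sqrt_branch a b z = of_real ((b - a) / 2) * (2 * c / (1 - c\<^sup>2))"
    proof -
      have "2 * c / (1 - c\<^sup>2) = 2 * c * (z - of_real a) / (of_real b - of_real a)"
        unfolding m using za by simp
      then show ?thesis unfolding sqrt_branch_def c_def[symmetric] by (simp only: canc) simp
    qed
  qed
qed

text \<open>In the parameter \<open>c\<close>, both Im z and the imaginary part of the root are
  positive multiples of Im c. This makes the root nonzero in the upper half-plane and later decides
  the sign in \<open>sqrt_branch_centered\<close>.\<close>

lemma Im_sqrt_branch_pos:
  assumes "a < b" "Im z > 0"
  shows "Im (sqrt_branch a b z) > 0"
proof -
  have z: "z \<notin> complex_of_real ` {a..b}" using assms(2) by auto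
  obtain c where c: "Re c > 0" "c\<^sup>2 \<noteq> 1" 
    "z - of_real ((a + b) / 2) = of_real ((b - a) / 2) * ((1 + c\<^sup>2) / (1 - c\<^sup>2))"
    "sqrt_branch a b z = of_real ((b - a) / 2) * (2 * c / (1 - c\<^sup>2))"
    using sqrt_branch_cayley[OF assms(1) z] by blast
  define h where "h = (b - a) / 2"
  note c = c[folded h_def]
  have h: "h > 0" using assms(1) by (simp add: h_def)
  define N where "N = (cmod (1 - c\<^sup>2))\<^sup>2"
  have N: "N > 0" using c(2) by (simp add: N_def)
  have div: "u / (1 - c\<^sup>2) = (u * cnj (1 - c\<^sup>2)) / of_real N" for u
    unfolding N_def by (rule complex_div_cnj)
  have "Im z = Im (z - of_real ((a + b) / 2))" by simp
  also have "\<dots> = h * (4 * Re c * Im c / N)"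
    unfolding c(3) div by (simp add: power2_eq_square) (simp add: algebra_simps)
  finally have "0 < h * (4 * Re c * Im c / N)" using assms(2) by simp
  then have ic: "Im c > 0" using N c(1) h by (simp add: zero_less_divide_iff zero_less_mult_iff)
  have "Im (sqrt_branch a b z) = h * (2 * Im c * (1 + (Re c)\<^sup>2 + (Im c)\<^sup>2) / N)"
    unfolding c(4) div by (simp add: power2_eq_square) (simp add: algebra_simps)
  also have "\<dots> > 0" using h N ic
    by (intro mult_pos_pos divide_pos_pos) (auto intro!: add_pos_nonneg)
  finally show ?thesis .
qed

text \<open>The imaginary part of r^2 is 2 Re r Im r with Im r > 0, which gives the signs. For the
  bound on the cut, 2 (Re r)^2 = |r^2| + Re(r^2), and |r^2| \<le> (x - a + y)(b - x + y), whose sum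
  with Re(r^2) collapses to y (b - a).\<close>

lemma Re_sqrt_branch:
  assumes "a < b" "y > 0"
  shows "x \<ge> (a + b) / 2 \<Longrightarrow> Re (sqrt_branch a b (Complex x y)) \<ge> 0"
    and "x \<le> (a + b) / 2 \<Longrightarrow> Re (sqrt_branch a b (Complex x y)) \<le> 0"
    and "x \<in> {a..b} \<Longrightarrow> (Re (sqrt_branch a b (Complex x y)))\<^sup>2 \<le> y * (b - a) / 2"
proof -
  define r where "r = sqrt_branch a b (Complex x y)"
  have r2: "r\<^sup>2 = (Complex x y - of_real a) * (Complex x y - of_real b)"
    unfolding r_def by (rule power2_sqrt_branch) (use assms in \<open>auto simp: complex_eq_iff\<close>)
  have pos: "Im r > 0" using Im_sqrt_branch_pos[OF assms(1), of "Complex x y"] assms(2) by (simp add: r_def)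
  have im: "2 * Re r * Im r = y * (2 * x - a - b)"
    using arg_cong[OF r2, of Im] by (simp add: power2_eq_square algebra_simps)
  show "Re r \<ge> 0" if "x \<ge> (a + b) / 2"
  proof -
    have "0 \<le> y * (2 * x - a - b)" using that assms by (intro mult_nonneg_nonneg) auto
    then have "0 \<le> Re r * Im r" using im by linarith
    then show ?thesis using pos by (simp add: zero_le_mult_iff)
  qed
  show "Re r \<le> 0" if "x \<le> (a + b) / 2"
  proof -
    have "y * (2 * x - a - b) \<le> 0" using that assms by (intro mult_nonneg_nonpos) auto
    then have "Re r * Im r \<le> 0" using im by linarith
    then show ?thesis using pos by (simp add: mult_le_0_iff)
  qed
  show "(Re r)\<^sup>2 \<le> y * (b - a) / 2" if x: "x \<in> {a..b}"
  proof -
    have re: "(Re r)\<^sup>2 - (Im r)\<^sup>2 = (x - a) * (x - b) - y\<^sup>2"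
      using arg_cong[OF r2, of Re] by (simp add: power2_eq_square algebra_simps)
    have "(Re r)\<^sup>2 + (Im r)\<^sup>2 = cmod (r\<^sup>2)"
      by (simp add: norm_power cmod_power2)
    also have "\<dots> = cmod (Complex (x - a) y) * cmod (Complex (x - b) y)"
      unfolding r2 by (simp add: norm_mult complex_of_real_def complex_diff)
    also have "\<dots> \<le> ((x - a) + y) * ((b - x) + y)"
      using x assms cmod_le[of "Complex (x - a) y"] cmod_le[of "Complex (x - b) y"]
      by (intro mult_mono) auto
    finally show ?thesis using re by (simp add: power2_eq_square algebra_simps)
  qed
qed

text \<open>With $x = \cos\theta$, $u = e^{i\theta}$ and $z = (\zeta + 1/\zeta)/2$ one has
  $\sin^2\theta/(z - \cos\theta) = \zeta + u\,k(u) + \overline{u}\,k(\overline{u})$ with $k$ holomorphic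
  on the closed disc. A primitive $K$ of $k$ turns the last two terms into the derivative of
  $K(u) - K(\overline{u})$, which vanishes at both ends.\<close>

lemma semicircle_cauchy_transform_unit:
  fixes \<zeta> :: complex
  assumes \<zeta>: "norm \<zeta> < 1" "\<zeta> \<noteq> 0"
  shows "((\<lambda>x. of_real (sqrt (1 - x\<^sup>2)) / ((\<zeta> + 1 / \<zeta>) / 2 - of_real x)) has_integral of_real pi * \<zeta>) {-1..1}"
proof -
  define k where "k u = \<zeta> * (\<zeta> - u) / (1 - \<zeta> * u) / 2" for u :: complex
  define \<rho> where "\<rho> = 1 / norm \<zeta>"
  have \<rho>: "\<rho> > 1" using \<zeta> by (simp add: \<rho>_def)
  have nz: "1 - \<zeta> * u \<noteq> 0" if "u \<in> ball 0 \<rho>" for u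
  proof
    assume "1 - \<zeta> * u = 0"
    then have "norm (\<zeta> * u) = 1" by (metis eq_iff_diff_eq_0 norm_one)
    then show False using that \<zeta> by (simp add: norm_mult \<rho>_def field_simps)
  qed
  \<comment> \<open>Since \<zeta> (\<zeta> - u) = (1 - \<zeta> u) + (\<zeta>^2 - 1),
    \<open>k\<close> is a constant plus a simple pole. Below the radius 1/|\<zeta>| the number 1 -
    \<zeta> u stays in the right half-plane, so the principal logarithm is a primitive.\<close>
  define K where "K u = (u - (\<zeta>\<^sup>2 - 1) / \<zeta> * Ln (1 - \<zeta> * u)) / 2" for u :: complex
  have K: "(K has_field_derivative k u) (at u)" if u: "u \<in> ball 0 \<rho>" for u
  proof -
    have "norm (\<zeta> * u) < 1" using u \<zeta> by (simp add: norm_mult \<rho>_def field_simps)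
    then have "Re (1 - \<zeta> * u) > 0" using complex_Re_le_cmod[of "\<zeta> * u"] by simp
    then have "1 - \<zeta> * u \<notin> \<real>\<^sub>\<le>\<^sub>0" by (auto simp: complex_nonpos_Reals_iff)
    then show ?thesis unfolding K_def k_def
      using \<zeta>(2) nz[OF u] by (auto intro!: derivative_eq_intros) (simp add: field_simps power2_eq_square)
  qed
  define e where "e x = cis (arccos x)" for x
  have e_ball: "e x \<in> ball 0 \<rho>" "cnj (e x) \<in> ball 0 \<rho>" for x
    using \<rho> by (auto simp: e_def)
  \<comment> \<open>The primitive in \<theta>, pulled back by \<open>arccos\<close>; the sign comes
    from dx = -sin \<theta> d\<theta>. As \<open>arccos\<close> is not differentiable at -1 and 1,
    only the interior version of the fundamental theorem applies.\<close>
  define P where "P x = - (of_real (arccos x) * \<zeta> + (K (e x) - K (cnj (e x))) / \<i>)" for x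
  have Kc: "continuous_on (ball 0 \<rho>) K"
    using K by (meson DERIV_continuous continuous_at_imp_continuous_on)
  have contP: "continuous_on {-1..1} P"
  proof -
    have "continuous_on {-1..1} arccos" using continuous_on_arccos' .
    then have ec: "continuous_on {-1..1} e" unfolding e_def by (intro continuous_intros) auto
    show ?thesis unfolding P_def
      by (intro continuous_intros continuous_on_arccos' continuous_on_compose2[OF Kc] ec) (use e_ball in \<open>auto simp: continuous_on_arccos'\<close>)
  qed
  have deriv: "(P has_vector_derivative of_real (sqrt (1 - x\<^sup>2)) / ((\<zeta> + 1 / \<zeta>) / 2 - of_real x)) (at x)"
    if x: "x \<in> {-1<..<1}" for x
  proof -
    define u where "u = e x"
    have uu: "u * cnj u = 1" by (simp add: u_def e_def cis_cnj cis_mult)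
    define s where "s = sqrt (1 - x\<^sup>2)"
    have "x\<^sup>2 < 1" using x by (simp add: abs_square_less_1 abs_less_iff)
    then have s: "s > 0" "s\<^sup>2 = 1 - x\<^sup>2" by (simp_all add: s_def)
    have ux: "u = Complex x s"
      using x by (simp add: u_def e_def cis.code complex_eq_iff s_def sin_arccos_nonzero sin_arccos)
    have da: "(arccos has_real_derivative inverse (- s)) (at x)"
      using DERIV_arccos[of x] x by (simp add: s_def)
    have de: "(e has_vector_derivative (of_real (inverse (- s)) * (\<i> * u))) (at x)"
    proof -
      have "((\<lambda>x. \<i> * of_real (arccos x)) has_vector_derivative \<i> * of_real (inverse (- s))) (at x)"
        using da by (intro has_vector_derivative_mult_right has_vector_derivative_of_real)
          (simp add: has_real_derivative_iff_has_vector_derivative)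
      from field_vector_diff_chain_at[OF this DERIV_exp] show ?thesis
        by (simp add: o_def e_def[abs_def] u_def cis_conv_exp mult_ac)
    qed
    have dce: "((\<lambda>x. cnj (e x)) has_vector_derivative cnj (of_real (inverse (- s)) * (\<i> * u))) (at x)"
      using de by (rule has_vector_derivative_cnj)
    have dK: "((\<lambda>x. K (e x)) has_vector_derivative (of_real (inverse (- s)) * (\<i> * u)) * k u) (at x)"
      using field_vector_diff_chain_at[OF de, of K "k u"] K e_ball by (simp add: o_def u_def)
    have dKc: "((\<lambda>x. K (cnj (e x))) has_vector_derivative cnj (of_real (inverse (- s)) * (\<i> * u)) * k (cnj u)) (at x)"
      using field_vector_diff_chain_at[OF dce, of K "k (cnj u)"] K e_ball by (simp add: o_def u_def)
    have "(P has_vector_derivative - (of_real (inverse (- s)) * \<zeta> + ((of_real (inverse (- s)) * (\<i> * u)) * k u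
        - cnj (of_real (inverse (- s)) * (\<i> * u)) * k (cnj u)) / \<i>)) (at x)"
      unfolding P_def
      by (intro has_vector_derivative_minus has_vector_derivative_add has_vector_derivative_diff
          has_vector_derivative_divide has_vector_derivative_mult_left dK dKc has_vector_derivative_of_real)
        (use da in \<open>simp add: has_real_derivative_iff_has_vector_derivative\<close>)
    also have "- (of_real (inverse (- s)) * \<zeta> + ((of_real (inverse (- s)) * (\<i> * u)) * k u
        - cnj (of_real (inverse (- s)) * (\<i> * u)) * k (cnj u)) / \<i>) = (\<zeta> + u * k u + cnj u * k (cnj u)) / of_real s"
      using s(1) by (simp add: field_simps)
    also have "\<dots> = of_real s / ((\<zeta> + 1 / \<zeta>) / 2 - of_real x)"
    proof -
      have n: "1 - \<zeta> * u \<noteq> 0" "1 - \<zeta> * cnj u \<noteq> 0" using nz e_ball by (auto simp: u_def)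
      have x2: "of_real x = (u + cnj u) / 2" "(of_real s)\<^sup>2 = - (u - cnj u)\<^sup>2 / 4"
        using ux by (simp_all add: complex_eq_iff power2_eq_square)
      have den: "(\<zeta> + 1 / \<zeta>) / 2 - of_real x = (1 - \<zeta> * u) * (1 - \<zeta> * cnj u) / (2 * \<zeta>)"
      proof -
        have "(1 - \<zeta> * u) * (1 - \<zeta> * cnj u) = 1 - \<zeta> * (u + cnj u) + \<zeta>\<^sup>2 * (u * cnj u)"
          by (simp add: algebra_simps power2_eq_square)
        then show ?thesis unfolding uu x2 using \<zeta>(2) by (simp add: field_simps power2_eq_square)
      qed
      \<comment> \<open>The term \<zeta> is shared equally between u and its conjugate. Over the
        common denominator, which is 4 \<zeta> (z - x), the numerators add up to -\<zeta> (u - cnj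
        u)^2 = 4 \<zeta> s^2.\<close>
      have half: "\<zeta> / 2 + v * k v = \<zeta> * (1 - v\<^sup>2) / (2 * (1 - \<zeta> * v))" if v: "1 - \<zeta> * v \<noteq> 0" for v
      proof -
        have "A / N / 2 * (2 * N) = A" if "N \<noteq> 0" for A N :: complex using that by simp
        from this[OF v] have "k v * (2 * (1 - \<zeta> * v)) = \<zeta> * (\<zeta> - v)"
          unfolding k_def .
        have "(\<zeta> / 2 + v * K) * (2 * N) = \<zeta> * N + v * (K * (2 * N))" for K N
          by (simp add: algebra_simps)
        from this[of "k v" "1 - \<zeta> * v"] have "(\<zeta> / 2 + v * k v) * (2 * (1 - \<zeta> * v)) = \<zeta> * (1 - \<zeta> * v) + v * (\<zeta> * (\<zeta> - v))"
          unfolding \<open>k v * (2 * (1 - \<zeta> * v)) = \<zeta> * (\<zeta> - v)\<close> .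
        also have "\<dots> = \<zeta> * (1 - v\<^sup>2)" by (simp add: algebra_simps power2_eq_square)
        finally have "(\<zeta> / 2 + v * k v) * (2 * (1 - \<zeta> * v)) = \<zeta> * (1 - v\<^sup>2)" .
        moreover have "2 * (1 - \<zeta> * v) \<noteq> 0" using v by (simp del: distrib_left_numeral right_diff_distrib_numeral)
        ultimately show ?thesis by (rule eq_divide_imp[rotated])
      qed
      have comb: "\<zeta> * A / (2 * N) + \<zeta> * B / (2 * M) = \<zeta> * (A * M + B * N) / (2 * (N * M))"
        if "N \<noteq> 0" "M \<noteq> 0" for A B N M :: complex
        using that by (simp add: field_simps)
      have "\<zeta> + u * k u + cnj u * k (cnj u) = (\<zeta> / 2 + u * k u) + (\<zeta> / 2 + cnj u * k (cnj u))"
        by simp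
      also have "\<dots> = \<zeta> * ((1 - u\<^sup>2) * (1 - \<zeta> * cnj u) + (1 - (cnj u)\<^sup>2) * (1 - \<zeta> * u)) / (2 * ((1 - \<zeta> * u) * (1 - \<zeta> * cnj u)))"
        unfolding half[OF n(1)] half[OF n(2)] by (rule comb[OF n])
      also have "(1 - u\<^sup>2) * (1 - \<zeta> * cnj u) + (1 - (cnj u)\<^sup>2) * (1 - \<zeta> * u) = - (u - cnj u)\<^sup>2"
        using uu by algebra
      also have "- (u - cnj u)\<^sup>2 = 4 * (of_real s)\<^sup>2" unfolding x2 by simp
      finally have "\<zeta> + u * k u + cnj u * k (cnj u) = of_real s * of_real s / ((\<zeta> + 1 / \<zeta>) / 2 - of_real x)"
        unfolding den using n \<zeta>(2) by (simp add: power2_eq_square)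
      then show ?thesis using s(1) by simp
    qed
    finally show ?thesis by (simp add: s_def)
  qed
  have "((\<lambda>x. of_real (sqrt (1 - x\<^sup>2)) / ((\<zeta> + 1 / \<zeta>) / 2 - of_real x)) has_integral P 1 - P (-1)) {-1..1}"
    by (rule fundamental_theorem_of_calculus_interior) (use contP deriv in auto)
  \<comment> \<open>At both ends u is real, so the two values of \<open>K\<close> cancel and only
    the jump of \<open>arccos\<close> from pi to 0 is left.\<close>
  moreover have "P 1 - P (-1) = of_real pi * \<zeta>"
    by (simp add: P_def e_def)
  ultimately show ?thesis by simp
qed

text \<open>The case of the unit interval, transported by x -> m + h x. The point \<zeta> = (1 -
  c)/(1 + c) satisfies (z - m)/h = (\<zeta> + 1/\<zeta>)/2 and h \<zeta> = z - m - R(z).\<close>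

lemma semicircle_cauchy_transform:
  assumes ab: "a < b" and z: "z \<notin> complex_of_real ` {a..b}"
  shows "((\<lambda>x. of_real (sqrt ((b - x) * (x - a))) / (z - of_real x)) has_integral
     of_real pi * (z - of_real ((a + b) / 2) - sqrt_branch a b z)) {a..b}"
proof -
  obtain c where c: "Re c > 0" "c\<^sup>2 \<noteq> 1" 
    "z - of_real ((a + b) / 2) = of_real ((b - a) / 2) * ((1 + c\<^sup>2) / (1 - c\<^sup>2))"
    "sqrt_branch a b z = of_real ((b - a) / 2) * (2 * c / (1 - c\<^sup>2))"
    using sqrt_branch_cayley[OF assms] by blast
  define h where "h = (b - a) / 2"
  define m where "m = (a + b) / 2"
  define \<zeta> where "\<zeta> = (1 - c) / (1 + c)"
  have h: "h > 0" using ab by (simp add: h_def)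
  have cn: "1 - c \<noteq> 0" "1 + c \<noteq> 0" using c(2) c(1) by (auto simp: power2_eq_square add_eq_0_iff)
  have cf: "1 - c\<^sup>2 = (1 - c) * (1 + c)" by (simp add: power2_eq_square algebra_simps)
  have "(cmod (1 - c))\<^sup>2 < (cmod (1 + c))\<^sup>2"
    unfolding cmod_power2 using c(1) by (simp add: power2_eq_square algebra_simps)
  then have "cmod (1 - c) < cmod (1 + c)" by (simp add: power_less_imp_less_base)
  then have \<zeta>: "norm \<zeta> < 1" "\<zeta> \<noteq> 0" using cn by (auto simp: \<zeta>_def norm_divide)
  have zeq: "z = of_real m + of_real h * ((\<zeta> + 1 / \<zeta>) / 2)"
  proof -
    have X: "(\<zeta> + 1 / \<zeta>) / 2 = (1 + c\<^sup>2) / (1 - c\<^sup>2)"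
    proof -
      have "\<zeta> + 1 / \<zeta> = ((1 - c) * (1 - c) + (1 + c) * (1 + c)) / ((1 + c) * (1 - c))"
        unfolding \<zeta>_def using add_frac_eq[OF cn(2,1), of "1 - c" "1 + c"] by simp
      also have "(1 - c) * (1 - c) + (1 + c) * (1 + c) = 2 * (1 + c\<^sup>2)"
        by (simp add: power2_eq_square algebra_simps)
      finally have "\<zeta> + 1 / \<zeta> = 2 * (1 + c\<^sup>2) / ((1 + c) * (1 - c))" .
      then show ?thesis unfolding cf by (simp add: mult.commute del: distrib_left_numeral)
    qed
    have "z - of_real m = of_real h * ((\<zeta> + 1 / \<zeta>) / 2)" unfolding X m_def h_def by (rule c(3))
    then show ?thesis by (metis add.commute diff_eq_eq)
  qed
  have req: "z - of_real m - sqrt_branch a b z = of_real h * \<zeta>"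
  proof -
    have "of_real h * ((1 + c\<^sup>2) / (1 - c\<^sup>2)) - of_real h * (2 * c / (1 - c\<^sup>2)) = of_real h * (((1 + c\<^sup>2) - 2 * c) / (1 - c\<^sup>2))"
      by (simp add: right_diff_distrib diff_divide_distrib)
    also have "(1 + c\<^sup>2) - 2 * c = (1 - c)\<^sup>2" by (simp add: power2_eq_square algebra_simps)
    also have "of_real h * ((1 - c)\<^sup>2 / (1 - c\<^sup>2)) = of_real h * \<zeta>"
      unfolding \<zeta>_def cf using cn by (simp add: power2_eq_square)
    finally show ?thesis using c(3,4) by (simp add: m_def h_def)
  qed
  have *: "((\<lambda>x. of_real (sqrt (1 - (1 / h * x + (- m / h))\<^sup>2)) / ((\<zeta> + 1 / \<zeta>) / 2 - of_real (1 / h * x + (- m / h)))) has_integral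
      (1 / \<bar>1 / h\<bar> ^ DIM(real)) *\<^sub>R (of_real pi * \<zeta>)) ((\<lambda>x. (1 / (1 / h)) *\<^sub>R x + - ((1 / (1 / h)) *\<^sub>R (- m / h))) ` cbox (-1) 1)"
    using has_integral_affinity[OF semicircle_cauchy_transform_unit[OF \<zeta>, folded cbox_interval], of "1 / h" "- m / h"] h
    by simp
  have img: "(\<lambda>x. (1 / (1 / h)) *\<^sub>R x + - ((1 / (1 / h)) *\<^sub>R (- m / h))) ` cbox (-1) 1 = {a..b}"
  proof -
    have eq: "(\<lambda>x. (1 / (1 / h)) *\<^sub>R x + - ((1 / (1 / h)) *\<^sub>R (- m / h))) = (\<lambda>x. h * x + m)"
      using h by (simp add: fun_eq_iff)
    have "(\<lambda>x. h * x + m) ` {-1..1} = {h * (-1) + m..h * 1 + m}"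
      using h by (simp add: image_affinity_atLeastAtMost)
    moreover have "h * (-1) + m = a" "h * 1 + m = b" by (simp_all add: m_def h_def field_simps)
    ultimately show ?thesis by (simp only: eq cbox_interval)
  qed
  have "((\<lambda>x. of_real (sqrt (1 - (1 / h * x + (- m / h))\<^sup>2)) / ((\<zeta> + 1 / \<zeta>) / 2 - of_real (1 / h * x + (- m / h)))) has_integral
      of_real h * (of_real pi * \<zeta>)) {a..b}"
    using * h unfolding img by (simp add: scaleR_conv_of_real)
  moreover have "of_real (sqrt (1 - (1 / h * x + (- m / h))\<^sup>2)) / ((\<zeta> + 1 / \<zeta>) / 2 - of_real (1 / h * x + (- m / h)))
      = of_real (sqrt ((b - x) * (x - a))) / (z - of_real x)" for x
  proof -
    have "(b - x) * (x - a) = h\<^sup>2 * (1 - (1 / h * x + (- m / h))\<^sup>2)"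
    proof -
      have e: "1 / h * x + (- m / h) = (x - m) / h" by (simp add: diff_divide_distrib)
      have "b = m + h" "a = m - h" by (simp_all add: m_def h_def field_simps)
      then show ?thesis unfolding e using h
        by (simp add: power_divide right_diff_distrib) (simp add: power2_eq_square algebra_simps)
    qed
    then have "sqrt ((b - x) * (x - a)) = h * sqrt (1 - (1 / h * x + (- m / h))\<^sup>2)"
      using h by (simp add: real_sqrt_mult)
    moreover have "z - of_real x = of_real h * ((\<zeta> + 1 / \<zeta>) / 2 - of_real (1 / h * x + (- m / h)))"
      unfolding zeq using h by (simp add: field_simps)
    ultimately show ?thesis using h by simp
  qed
  ultimately show ?thesis
    using req by (simp add: m_def mult_ac)
qed

text \<open>Partial fractions in x reduce this to a difference quotient of the preceding transform
  in its argument; its linear part contributes the 1. Poles p are needed because the density is a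
  semicircle times a rational function.\<close>

lemma semicircle_cauchy_transform_diff:
  assumes ab: "a < b" and z: "z \<notin> complex_of_real ` {a..b}" and p: "p \<notin> complex_of_real ` {a..b}" and "z \<noteq> p"
  shows "((\<lambda>x. of_real (sqrt ((b - x) * (x - a))) / ((of_real x - p) * (z - of_real x))) has_integral
     of_real pi * (1 - (sqrt_branch a b z - sqrt_branch a b p) / (z - p))) {a..b}"
proof -
  have zp: "z - p \<noteq> 0" using assms by simp
  have "((\<lambda>x. (of_real (sqrt ((b - x) * (x - a))) / (z - of_real x) - of_real (sqrt ((b - x) * (x - a))) / (p - of_real x)) / (z - p))
    has_integral (of_real pi * (z - of_real ((a + b) / 2) - sqrt_branch a b z)
       - of_real pi * (p - of_real ((a + b) / 2) - sqrt_branch a b p)) / (z - p)) {a..b}"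
    by (intro has_integral_divide has_integral_diff semicircle_cauchy_transform assms)
  also have "(of_real pi * (z - of_real ((a + b) / 2) - sqrt_branch a b z)
       - of_real pi * (p - of_real ((a + b) / 2) - sqrt_branch a b p)) / (z - p)
     = of_real pi * (((z - p) - (sqrt_branch a b z - sqrt_branch a b p)) / (z - p))"
    by (simp add: algebra_simps)
  also have "\<dots> = of_real pi * (1 - (sqrt_branch a b z - sqrt_branch a b p) / (z - p))"
    by (simp only: diff_divide_distrib[of "z - p"] divide_self[OF zp])
  finally show ?thesis
  proof (rule has_integral_eq[rotated])
    fix x assume "x \<in> {a..b}"
    then have "z - of_real x \<noteq> 0" "of_real x - p \<noteq> 0" "p - of_real x \<noteq> 0" using z p by auto
    then have "1 / (z - of_real x) - 1 / (p - of_real x) = (z - p) / ((of_real x - p) * (z - of_real x))"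
      by (simp add: divide_simps) (simp add: algebra_simps)
    then have "S / (z - of_real x) - S / (p - of_real x) = S * ((z - p) / ((of_real x - p) * (z - of_real x)))" for S
      by (metis mult.right_neutral right_diff_distrib times_divide_eq_right)
    then show "(of_real (sqrt ((b - x) * (x - a))) / (z - of_real x) - of_real (sqrt ((b - x) * (x - a))) / (p - of_real x)) / (z - p)
      = of_real (sqrt ((b - x) * (x - a))) / ((of_real x - p) * (z - of_real x))"
      using zp by simp
  qed
qed

section \<open>Measures with one cut\<close>

text \<open>The assumptions \<open>eq1\<close> and \<open>eq2\<close> prescribe the expansion
  $R(z)\,G(z) = (T-t)/z + O(z^{-2})$ at infinity.\<close>

locale one_cut =
  fixes q :: nat and \<gamma> :: "nat \<Rightarrow> real" and w :: "nat \<Rightarrow> complex" and a b t :: real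
  assumes ab: "a < b" and w: "\<And>j. j \<in> {1..q} \<Longrightarrow> Im (w j) > 0" and \<gamma>: "\<And>j. j \<in> {1..q} \<Longrightarrow> \<gamma> j > 0"
    and eq1: "(\<Sum>j=1..q. \<gamma> j * Re (1 / sqrt_branch a b (w j))) = 0"
    and eq2: "(\<Sum>j=1..q. \<gamma> j * Re (w j / sqrt_branch a b (w j))) = (\<Sum>j=1..q. \<gamma> j) - t"
    and density_pos: "\<And>x. 0 < (\<Sum>j=1..q. \<gamma> j * Re (1 / (sqrt_branch a b (w j) * (of_real x - w j))))"
    and t: "t > 0"
begin

abbreviation R where "R \<equiv> sqrt_branch a b"

definition g :: "real \<Rightarrow> real" where
  "g x = (\<Sum>j=1..q. \<gamma> j * Re (1 / (R (w j) * (of_real x - w j))))"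

text \<open>The conjugate-symmetric extension of \<open>g\<close> off the real line; each index
  contributes residue \<open>\<gamma> j / 2\<close> to \<open>R G\<close> at \<open>w j\<close> and
  at its conjugate.\<close>

definition G :: "complex \<Rightarrow> complex" where
  "G z = (\<Sum>j=1..q. of_real (\<gamma> j / 2) * (1 / (R (w j) * (z - w j)) + 1 / (cnj (R (w j)) * (z - cnj (w j)))))"

text \<open>Stieltjes inversion: \<open>R\<close> has boundary value i sqrt((b - x)(x - a)) from
  above on the cut, and the density is the imaginary part of \<open>R G\<close> there, divided by
  pi.\<close>

definition \<rho> :: "real \<Rightarrow> real" where
  "\<rho> x = indicator {a..b} x * (sqrt ((b - x) * (x - a)) * g x / pi)"

definition \<nu> :: "real measure" where
  "\<nu> = density lborel (\<lambda>x. ennreal (\<rho> x))"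

lemma G_of_real: "G (of_real x) = of_real (g x)"
proof -
  have "of_real (\<gamma> j / 2) * (1 / (R (w j) * (of_real x - w j)) + 1 / (cnj (R (w j)) * (of_real x - cnj (w j))))
      = complex_of_real (\<gamma> j * Re (1 / (R (w j) * (of_real x - w j))))" for j
  proof -
    have "1 / (cnj (R (w j)) * (of_real x - cnj (w j))) = cnj (1 / (R (w j) * (of_real x - w j)))" by simp
    then show ?thesis by (simp only: complex_add_cnj) simp
  qed
  then show ?thesis unfolding G_def g_def of_real_sum by (intro sum.cong) auto
qed

lemma g_pos: "g x > 0"
  using density_pos[of x] by (simp add: g_def)

lemma w_notin:
  assumes "j \<in> {1..q}"
  shows "w j \<notin> complex_of_real ` {a..b}" "cnj (w j) \<notin> complex_of_real ` {a..b}"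
proof -
  have "w j \<noteq> of_real x" "cnj (w j) \<noteq> of_real x" for x
    using w[OF assms] by (auto simp: complex_eq_iff)
  then show "w j \<notin> complex_of_real ` {a..b}" "cnj (w j) \<notin> complex_of_real ` {a..b}" by blast+
qed

lemma R_nz: "j \<in> {1..q} \<Longrightarrow> R (w j) \<noteq> 0"
  using Im_sqrt_branch_pos[OF ab w, of j] by (metis less_irrefl zero_complex.simps(2))

lemma R_cnj: "j \<in> {1..q} \<Longrightarrow> R (cnj (w j)) = cnj (R (w j))"
  by (rule cnj_sqrt_branch[OF ab w_notin(1)])

lemma continuous_on_g: "continuous_on A g"
proof -
  have "of_real x - w j \<noteq> 0" if "j \<in> {1..q}" for x j
    using w[OF that] by (auto simp: complex_eq_iff)
  then show ?thesis
    unfolding g_def using R_nz by (intro continuous_intros) auto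
qed

lemma continuous_on_\<rho>: "continuous_on {a..b} \<rho>"
proof -
  have "continuous_on {a..b} (\<lambda>x. sqrt ((b - x) * (x - a)) * g x / pi)"
    by (intro continuous_intros continuous_on_g) auto
  then show ?thesis by (rule continuous_on_eq) (auto simp: \<rho>_def)
qed

lemma \<rho>_measurable[measurable]: "\<rho> \<in> borel_measurable borel"
proof -
  have [measurable]: "g \<in> borel_measurable borel" by (intro borel_measurable_continuous_onI continuous_on_g)
  show ?thesis unfolding \<rho>_def[abs_def] by measurable
qed

lemma \<rho>_nonneg: "\<rho> x \<ge> 0"
  using g_pos[of x] by (auto simp: \<rho>_def indicator_def)

text \<open>Each pole p of \<open>G\<close> contributes 1/R(p) + 1/(z - p) - R(z)/(R(p)(z - p)). The
  first terms sum to zero by \<open>eq1\<close>, the second ones form the derivative of the external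
  field, the third ones form \<open>R G\<close>.\<close>

lemma cauchy_integral:
  assumes z: "z \<notin> complex_of_real ` {a..b}" "\<And>j. j \<in> {1..q} \<Longrightarrow> z \<noteq> w j \<and> z \<noteq> cnj (w j)"
  shows "((\<lambda>x. of_real (\<rho> x) / (z - of_real x)) has_integral (ext_field_deriv q \<gamma> w z - R z * G z)) {a..b}"
proof -
  let ?S = "\<lambda>x. complex_of_real (sqrt ((b - x) * (x - a)))"
  have "((\<lambda>x. \<Sum>j=1..q. of_real (\<gamma> j / (2 * pi)) * (1 / R (w j) * (?S x / ((of_real x - w j) * (z - of_real x)))
        + 1 / cnj (R (w j)) * (?S x / ((of_real x - cnj (w j)) * (z - of_real x)))))
     has_integral (\<Sum>j=1..q. of_real (\<gamma> j / (2 * pi)) * (1 / R (w j) * (of_real pi * (1 - (R z - R (w j)) / (z - w j)))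
       + 1 / cnj (R (w j)) * (of_real pi * (1 - (R z - R (cnj (w j))) / (z - cnj (w j))))))) {a..b}"
    using z w_notin ab
    by (intro has_integral_sum has_integral_mult_right has_integral_add semicircle_cauchy_transform_diff) auto
  also have "(\<Sum>j=1..q. of_real (\<gamma> j / (2 * pi)) * (1 / R (w j) * (of_real pi * (1 - (R z - R (w j)) / (z - w j)))
       + 1 / cnj (R (w j)) * (of_real pi * (1 - (R z - R (cnj (w j))) / (z - cnj (w j))))))
    = (\<Sum>j=1..q. of_real (\<gamma> j * Re (1 / R (w j))) 
        + of_real (\<gamma> j) * ((z - of_real (Re (w j))) / ((z - w j) * (z - cnj (w j))))
        - R z * (of_real (\<gamma> j / 2) * (1 / (R (w j) * (z - w j)) + 1 / (cnj (R (w j)) * (z - cnj (w j))))))"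
  proof (rule sum.cong[OF refl])
    fix j assume j: "j \<in> {1..q}"
    have part: "1 / r * (of_real pi * (1 - (R z - r) / (z - p))) = of_real pi * (1 / r + 1 / (z - p) - R z * (1 / (r * (z - p))))"
      if "r \<noteq> 0" "z - p \<noteq> 0" for r p
    proof -
      have "1 / r * (P * (1 - (Z - r) / u)) = P * (1 / r + 1 / u - Z * (1 / (r * u)))" if "r \<noteq> 0" "u \<noteq> 0" for P Z u :: complex
        using that by (simp add: field_simps)
      from this[OF that] show ?thesis .
    qed
    have nz: "z - w j \<noteq> 0" "z - cnj (w j) \<noteq> 0" using z j by auto
    have s1: "1 / R (w j) + 1 / cnj (R (w j)) = complex_of_real (2 * Re (1 / R (w j)))"
      using complex_add_cnj[of "1 / R (w j)"] by simp
    have s2: "1 / (z - w j) + 1 / (z - cnj (w j)) = 2 * ((z - of_real (Re (w j))) / ((z - w j) * (z - cnj (w j))))"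
    proof -
      have "1 / (z - w j) + 1 / (z - cnj (w j)) = ((z - cnj (w j)) + (z - w j)) / ((z - w j) * (z - cnj (w j)))"
        using nz add_frac_eq[of "z - w j" "z - cnj (w j)" 1 1] by simp
      also have "(z - cnj (w j)) + (z - w j) = 2 * (z - of_real (Re (w j)))"
        by (simp add: complex_eq_iff)
      finally show ?thesis by (simp only: times_divide_eq_right)
    qed
    have sum2: "(1 / R (w j) + 1 / (z - w j) - X) + (1 / cnj (R (w j)) + 1 / (z - cnj (w j)) - Y)
      = complex_of_real (2 * Re (1 / R (w j))) + 2 * ((z - of_real (Re (w j))) / ((z - w j) * (z - cnj (w j)))) - (X + Y)" for X Y
      unfolding s1[symmetric] s2[symmetric] by simp
    have "of_real (\<gamma> j / (2 * pi)) * (of_real pi * X + of_real pi * Y) = of_real (\<gamma> j / 2) * (X + Y)" for X Y :: complex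
    proof -
      have "complex_of_real (\<gamma> j / (2 * pi)) * of_real pi = of_real (\<gamma> j / 2)"
        by (simp only: of_real_mult[symmetric]) simp
      then show ?thesis by (simp only: distrib_left[symmetric] mult.assoc[symmetric])
    qed
    then show "of_real (\<gamma> j / (2 * pi)) * (1 / R (w j) * (of_real pi * (1 - (R z - R (w j)) / (z - w j)))
       + 1 / cnj (R (w j)) * (of_real pi * (1 - (R z - R (cnj (w j))) / (z - cnj (w j)))))
      = of_real (\<gamma> j * Re (1 / R (w j))) 
        + of_real (\<gamma> j) * ((z - of_real (Re (w j))) / ((z - w j) * (z - cnj (w j))))
        - R z * (of_real (\<gamma> j / 2) * (1 / (R (w j) * (z - w j)) + 1 / (cnj (R (w j)) * (z - cnj (w j)))))"
      unfolding R_cnj[OF j] using part[of "R (w j)" "w j"] part[of "cnj (R (w j))" "cnj (w j)"] R_nz[OF j] nz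
      by (simp only: sum2 complex_cnj_zero_iff not_False_eq_True) (simp add: algebra_simps)
  qed
  also have "\<dots> = of_real (\<Sum>j=1..q. \<gamma> j * Re (1 / R (w j))) + ext_field_deriv q \<gamma> w z - R z * G z"
    unfolding ext_field_deriv_def G_def sum_distrib_left of_real_sum by (simp add: sum.distrib sum_subtractf)
  also have "\<dots> = ext_field_deriv q \<gamma> w z - R z * G z" using eq1 by simp
  finally show ?thesis
  proof (rule has_integral_eq[rotated])
    fix x assume x: "x \<in> {a..b}"
    have "of_real (\<rho> x) / (z - of_real x) = ?S x / of_real pi * G (of_real x) / (z - of_real x)"
      using x by (simp add: \<rho>_def G_of_real)
    also have "\<dots> = (\<Sum>j=1..q. of_real (\<gamma> j / (2 * pi)) * (1 / R (w j) * (?S x / ((of_real x - w j) * (z - of_real x)))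
        + 1 / cnj (R (w j)) * (?S x / ((of_real x - cnj (w j)) * (z - of_real x)))))"
      unfolding G_def sum_distrib_left sum_divide_distrib
    proof (rule sum.cong[OF refl])
      fix j
      have "S / of_real pi * (of_real (\<gamma> j / 2) * (1 / (r * u) + 1 / (r' * u'))) / v
         = of_real (\<gamma> j / (2 * pi)) * (1 / r * (S / (u * v)) + 1 / r' * (S / (u' * v)))" for S r u r' u' v :: complex
        by (simp add: distrib_left add_divide_distrib mult_ac)
      then show "?S x / of_real pi * (of_real (\<gamma> j / 2) * (1 / (R (w j) * (of_real x - w j)) + 1 / (cnj (R (w j)) * (of_real x - cnj (w j))))) / (z - of_real x)
        = of_real (\<gamma> j / (2 * pi)) * (1 / R (w j) * (?S x / ((of_real x - w j) * (z - of_real x)))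
        + 1 / cnj (R (w j)) * (?S x / ((of_real x - cnj (w j)) * (z - of_real x))))" .
    qed
    finally show "(\<Sum>j=1..q. of_real (\<gamma> j / (2 * pi)) * (1 / R (w j) * (?S x / ((of_real x - w j) * (z - of_real x)))
        + 1 / cnj (R (w j)) * (?S x / ((of_real x - cnj (w j)) * (z - of_real x))))) = of_real (\<rho> x) / (z - of_real x)" by simp
  qed
qed

text \<open>The integral of the semicircle over x - p is -pi (p - (a+b)/2 - R(p)). Weighted with
  1/R(p) and summed, the midpoint drops out by \<open>eq1\<close>, and \<open>eq2\<close> turns the
  rest into the mass t.\<close>

lemma mass_integral: "(\<rho> has_integral t) {a..b}"
proof -
  let ?S = "\<lambda>x. complex_of_real (sqrt ((b - x) * (x - a)))"
  let ?m = "complex_of_real ((a + b) / 2)"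
  have "((\<lambda>x. \<Sum>j=1..q. of_real (- \<gamma> j / (2 * pi)) * (1 / R (w j) * (?S x / (w j - of_real x))
        + 1 / cnj (R (w j)) * (?S x / (cnj (w j) - of_real x))))
     has_integral (\<Sum>j=1..q. of_real (- \<gamma> j / (2 * pi)) * (1 / R (w j) * (of_real pi * (w j - ?m - R (w j)))
       + 1 / cnj (R (w j)) * (of_real pi * (cnj (w j) - ?m - R (cnj (w j))))))) {a..b}"
    using w_notin ab
    by (intro has_integral_sum has_integral_mult_right has_integral_add semicircle_cauchy_transform) auto
  also have "(\<Sum>j=1..q. of_real (- \<gamma> j / (2 * pi)) * (1 / R (w j) * (of_real pi * (w j - ?m - R (w j)))
       + 1 / cnj (R (w j)) * (of_real pi * (cnj (w j) - ?m - R (cnj (w j))))))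
     = (\<Sum>j=1..q. of_real (\<gamma> j - \<gamma> j * Re (w j / R (w j)) + (a + b) / 2 * (\<gamma> j * Re (1 / R (w j)))))"
  proof (rule sum.cong[OF refl])
    fix j assume j: "j \<in> {1..q}"
    define r where "r = R (w j)"
    have r: "r \<noteq> 0" using R_nz[OF j] by (simp add: r_def)
    have e1: "1 / r * (of_real pi * (w j - ?m - r)) = of_real pi * (w j / r - ?m * (1 / r) - 1)"
      using r by (simp add: algebra_simps diff_divide_distrib)
    have "Re (of_real pi * (u - of_real m * v - 1)) = pi * (Re u - m * Re v - 1)" for u v m by simp
    then have e2: "Re (1 / r * (of_real pi * (w j - ?m - r))) = pi * (Re (w j / r) - (a + b) / 2 * Re (1 / r) - 1)"
      unfolding e1 .
    have "1 / cnj r * (of_real pi * (cnj (w j) - ?m - cnj r)) = cnj (1 / r * (of_real pi * (w j - ?m - r)))" by simp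
    then have "1 / r * (of_real pi * (w j - ?m - r)) + 1 / cnj r * (of_real pi * (cnj (w j) - ?m - cnj r)) 
      = of_real (2 * (pi * (Re (w j / r) - (a + b) / 2 * Re (1 / r) - 1)))" by (simp only: complex_add_cnj e2)
    then show "of_real (- \<gamma> j / (2 * pi)) * (1 / R (w j) * (of_real pi * (w j - ?m - R (w j)))
       + 1 / cnj (R (w j)) * (of_real pi * (cnj (w j) - ?m - R (cnj (w j)))))
     = complex_of_real (\<gamma> j - \<gamma> j * Re (w j / R (w j)) + (a + b) / 2 * (\<gamma> j * Re (1 / R (w j))))"
      unfolding R_cnj[OF j] r_def[symmetric] by (simp only: of_real_mult[symmetric] of_real_eq_iff) (simp add: field_simps)
  qed
  also have "\<dots> = of_real t"
  proof -
    have "(\<Sum>j=1..q. \<gamma> j - \<gamma> j * Re (w j / R (w j)) + (a + b) / 2 * (\<gamma> j * Re (1 / R (w j)))) =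
      (\<Sum>j=1..q. \<gamma> j) - (\<Sum>j=1..q. \<gamma> j * Re (w j / R (w j))) + (a + b) / 2 * (\<Sum>j=1..q. \<gamma> j * Re (1 / R (w j)))"
      by (simp only: sum.distrib sum_subtractf sum_distrib_left)
    then show ?thesis unfolding of_real_sum[symmetric] eq1 eq2 by simp
  qed
  finally have "((\<lambda>x. complex_of_real (\<rho> x)) has_integral of_real t) {a..b}"
  proof (rule has_integral_eq[rotated])
    fix x assume x: "x \<in> {a..b}"
    have "of_real (\<rho> x) = ?S x / of_real pi * G (of_real x)"
      using x by (simp add: \<rho>_def G_of_real)
    also have "\<dots> = (\<Sum>j=1..q. of_real (- \<gamma> j / (2 * pi)) * (1 / R (w j) * (?S x / (w j - of_real x))
        + 1 / cnj (R (w j)) * (?S x / (cnj (w j) - of_real x))))"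
      unfolding G_def sum_distrib_left
    proof (rule sum.cong[OF refl])
      fix j
      have "S / of_real pi * (of_real (\<gamma> j / 2) * (1 / (r * (X - p)) + 1 / (r' * (X - p'))))
         = of_real (- \<gamma> j / (2 * pi)) * (1 / r * (S / (p - X)) + 1 / r' * (S / (p' - X)))" for S r r' X p p' :: complex
      proof -
        have "S / of_real pi * (of_real (\<gamma> j / 2) * (1 / (r * u) + 1 / (r' * u')))
          = of_real (- \<gamma> j / (2 * pi)) * (1 / r * (S / (- u)) + 1 / r' * (S / (- u')))" for u u' :: complex
          by (simp only: divide_minus_right mult_minus_right minus_add_distrib[symmetric] minus_divide_left[symmetric]
              of_real_minus mult_minus_left minus_minus) (simp add: distrib_left add_divide_distrib mult_ac)
        from this[of "X - p" "X - p'"] show ?thesis by (simp only: minus_diff_eq)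
      qed
      then show "?S x / of_real pi * (of_real (\<gamma> j / 2) * (1 / (R (w j) * (of_real x - w j)) + 1 / (cnj (R (w j)) * (of_real x - cnj (w j)))))
        = of_real (- \<gamma> j / (2 * pi)) * (1 / R (w j) * (?S x / (w j - of_real x))
        + 1 / cnj (R (w j)) * (?S x / (cnj (w j) - of_real x)))" .
    qed
    finally show "(\<Sum>j=1..q. of_real (- \<gamma> j / (2 * pi)) * (1 / R (w j) * (?S x / (w j - of_real x))
        + 1 / cnj (R (w j)) * (?S x / (cnj (w j) - of_real x)))) = of_real (\<rho> x)" by simp
  qed
  from has_integral_Re[OF this] show ?thesis by simp
qed

end

section \<open>Variational inequalities for the one-cut measure\<close>

lemma log_potential_eq_integral:
  fixes \<sigma> :: "real measure"
  assumes [measurable_cong]: "sets \<sigma> = sets borel"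
    and int: "integrable \<sigma> (\<lambda>s. ln \<bar>x - s\<bar>)" and ae: "AE s in \<sigma>. s \<noteq> x"
  shows "log_potential \<sigma> x = ereal (- (\<integral>s. ln \<bar>x - s\<bar> \<partial>\<sigma>))"
proof -
  define P where "P = (\<integral>\<^sup>+ s. ennreal (- ln \<bar>x - s\<bar>) \<partial>\<sigma>)"
  define N where "N = (\<integral>\<^sup>+ s. ennreal (ln \<bar>x - s\<bar>) \<partial>\<sigma>)"
  have P: "(\<integral>\<^sup>+ s. (if s = x then \<infinity> else ennreal (- ln \<bar>x - s\<bar>)) \<partial>\<sigma>) = P"
    unfolding P_def by (rule nn_integral_cong_AE, use ae in \<open>rule eventually_mono\<close>) auto
  have fin: "P \<noteq> \<infinity>" "N \<noteq> \<infinity>"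
    using int unfolding real_integrable_def P_def N_def by auto
  then obtain p n where pn: "P = ennreal p" "0 \<le> p" "N = ennreal n" "0 \<le> n"
    by (metis ennreal_cases infinity_ennreal_def)
  have "(\<integral>s. ln \<bar>x - s\<bar> \<partial>\<sigma>) = n - p"
    using real_lebesgue_integral_def[OF int] pn unfolding P_def[symmetric] N_def[symmetric] by simp
  then show ?thesis
    unfolding log_potential_def P N_def[symmetric] using pn by simp
qed

lemma integrable_inverse_sqrt_abs:
  "integrable lborel (\<lambda>s. indicator {-1..1} (x - s) * \<bar>x - s\<bar> powr (-1/2) :: real)"
proof -
  define f where "f r = indicator {0..1} r * r powr (-1/2)" for r :: real
  have "((\<lambda>r::real. r powr (-1/2)) has_integral 2) {0..1}"
    using has_integral_powr_from_0[of "-1/2" 1] by simp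
  then have "((\<lambda>r::real. if r \<in> {0..1} then r powr (-1/2) else 0) has_integral 2) UNIV"
    by (simp only: has_integral_restrict_UNIV)
  also have "(\<lambda>r::real. if r \<in> {0..1} then r powr (-1/2) else 0) = f" by (auto simp: f_def fun_eq_iff)
  finally have "(f has_integral 2) UNIV" .
  moreover have "f \<in> borel_measurable borel" unfolding f_def by measurable
  moreover have "f r \<ge> 0" for r unfolding f_def by auto
  ultimately have f: "integrable lborel f"
    by (subst integrable_iff_bounded) (auto simp: nn_integral_has_integral_lborel ennreal_less_top)
  \<comment> \<open>Two reflected halves cover both sides of x. The point s = x, where they overlap,
    causes no double counting because \<open>0 powr (-1/2) = 0\<close>.\<close>
  have "integrable lborel (\<lambda>s. f (x + (-1) * s) + f (- x + 1 * s))"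
    by (intro Bochner_Integration.integrable_add lborel_integrable_real_affine f) auto
  moreover have "f (x + (-1) * s) + f (- x + 1 * s) = indicator {-1..1} (x - s) * \<bar>x - s\<bar> powr (-1/2)" for s
    by (cases "x = s"; cases "x < s") (auto simp: f_def indicator_def)
  ultimately show ?thesis by simp
qed

text \<open>A majorant of the logarithm that is uniform in the height y \<in> [0, 1]: the inverse
  square root absorbs the singularity at s = x and the quadratic term the growth.\<close>

abbreviation log_bound :: "real \<Rightarrow> real \<Rightarrow> real" where
  "log_bound x s \<equiv> 2 * (indicator {-1..1} (x - s) * \<bar>x - s\<bar> powr (-1/2)) + ((x - s)\<^sup>2 + 1)"

lemma abs_ln_sqrt_bound:
  fixes x s y :: real
  assumes "s \<noteq> x" "0 \<le> y" "y \<le> 1"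
  shows "\<bar>ln ((x - s)\<^sup>2 + y\<^sup>2) / 2\<bar> \<le> log_bound x s"
proof -
  define d where "d = \<bar>x - s\<bar>"
  have d: "d > 0" "(x - s)\<^sup>2 = d\<^sup>2" using assms by (auto simp: d_def)
  have pos: "0 < d\<^sup>2 + y\<^sup>2" using d by (simp add: add_pos_nonneg)
  have y2: "y\<^sup>2 \<le> 1" using assms by (simp add: power_le_one)
  have "ln (d\<^sup>2 + y\<^sup>2) \<le> d\<^sup>2 + y\<^sup>2 - 1" using pos by (rule ln_le_minus_one)
  then have up: "ln (d\<^sup>2 + y\<^sup>2) / 2 \<le> d\<^sup>2 + 1" using y2 zero_le_power2[of d] by linarith
  have "ln (d\<^sup>2) \<le> ln (d\<^sup>2 + y\<^sup>2)" using d pos by (subst ln_le_cancel_iff) auto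
  moreover have "ln (d\<^sup>2) = 2 * ln d" using d by (simp add: ln_realpow)
  ultimately have lo: "ln d \<le> ln (d\<^sup>2 + y\<^sup>2) / 2" by simp
  have lo2: "- ln d \<le> 2 * (indicator {-1..1} (x - s) * d powr (-1/2))"
  proof (cases "d \<le> 1")
    case True
    then have "indicator {-1..1} (x - s) = (1::real)" by (auto simp: indicator_def d_def)
    \<comment> \<open>The inequality ln u \<le> u - 1 at u = d^(-1/2) bounds -ln d by 2 d^(-1/2),
      which is integrable against a bounded density.\<close>
    moreover have "ln (d powr (-1/2)) \<le> d powr (-1/2) - 1" using d by (intro ln_le_minus_one) auto
    ultimately show ?thesis using d by (simp add: ln_powr)
  next
    case False
    then have "ln d \<ge> 0" by simp
    moreover have "indicator {-1..1} (x - s) = (0::real)" using False by (auto simp: indicator_def d_def)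
    ultimately show ?thesis by simp
  qed
  have "0 \<le> indicator {-1..1} (x - s) * d powr (-1/2)" by simp
  then show ?thesis
    using up lo lo2 zero_le_power2[of d] unfolding d(2) d_def[symmetric] by (intro abs_leI) linarith+
qed

lemma DERIV_lower_bound_increment:
  fixes f :: "real \<Rightarrow> real"
  assumes "u \<le> v" and d: "\<And>x. u \<le> x \<Longrightarrow> x \<le> v \<Longrightarrow> (f has_real_derivative f' x) (at x)"
    and lo: "\<And>x. u \<le> x \<Longrightarrow> x \<le> v \<Longrightarrow> c \<le> f' x"
  shows "c * (v - u) \<le> f v - f u"
proof (cases "u = v")
  case False
  then obtain z where z: "u < z" "z < v" "f v - f u = (v - u) * f' z"
    using MVT2[of u v f f'] assms(1) d by (metis less_eq_real_def)
  then show ?thesis using lo[of z] assms(1) by (simp add: mult.commute mult_left_mono)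
qed simp

context one_cut
begin

lemma sets_\<nu>[measurable_cong, simp]: "sets \<nu> = sets borel" and space_\<nu>[simp]: "space \<nu> = UNIV"
  by (simp_all add: \<nu>_def)

lemma \<rho>_0: "x \<notin> {a..b} \<Longrightarrow> \<rho> x = 0"
  by (simp add: \<rho>_def)

lemma \<rho>_bound: obtains K where "K > 0" "\<And>x. \<rho> x \<le> K"
proof -
  have "bounded (\<rho> ` {a..b})"
    by (intro compact_imp_bounded compact_continuous_image continuous_on_\<rho>) auto
  then obtain K where K: "K > 0" "\<And>x. x \<in> {a..b} \<Longrightarrow> \<bar>\<rho> x\<bar> \<le> K"
    unfolding bounded_pos by auto
  have "\<rho> x \<le> K" for x
    using K \<rho>_0[of x] by (cases "x \<in> {a..b}") (force intro: order.trans[OF abs_ge_self])+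
  with K(1) that show ?thesis by blast
qed

lemma emeasure_\<nu>: "emeasure \<nu> UNIV = ennreal t"
proof -
  have "(\<rho> has_integral t) UNIV"
    by (rule has_integral_on_superset[OF mass_integral]) (auto simp: \<rho>_0)
  then show ?thesis
    unfolding \<nu>_def using nn_integral_has_integral_lborel[of \<rho> t] \<rho>_nonneg by (simp add: emeasure_density)
qed

sublocale \<nu>: finite_measure \<nu>
  by standard (simp add: emeasure_\<nu>)

lemma AE_\<nu>I: "(AE x in lborel. P x) \<Longrightarrow> AE x in \<nu>. P x"
  unfolding \<nu>_def by (subst AE_density) auto

lemma AE_\<nu>_in: "AE x in \<nu>. x \<in> {a..b}"
  unfolding \<nu>_def by (subst AE_density) (use \<rho>_0 in \<open>force intro!: AE_I2\<close>)+

text \<open>As \<open>g\<close> is positive everywhere, the density is positive on the whole open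
  interval, and every neighbourhood of a point of the closed interval contains a ball inside the
  open one.\<close>

lemma measure_support_\<nu>: "measure_support \<nu> = {a..b}"
proof (rule set_eqI)
  fix x
  show "x \<in> measure_support \<nu> \<longleftrightarrow> x \<in> {a..b}"
  proof
    assume x: "x \<in> measure_support \<nu>"
    have "emeasure \<nu> (- {a..b}) = 0"
      by (rule AE_iff_measurable[THEN iffD1, OF _ _ AE_\<nu>_in]) auto
    moreover have "open (- {a..b})" by auto
    ultimately show "x \<in> {a..b}" using x unfolding measure_support_def by force
  next
    assume x: "x \<in> {a..b}"
    show "x \<in> measure_support \<nu>"
      unfolding measure_support_def
    proof (intro CollectI allI impI)
      fix U assume U: "open U \<and> x \<in> U"
      have "x \<in> closure {a<..<b}" using x ab by simp
      then obtain y where y: "y \<in> {a<..<b}" "y \<in> U"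
        using U unfolding closure_iff_nhds_not_empty by (metis Int_iff equals0I order_refl)
      have "open (U \<inter> {a<..<b})" using U by auto
      then obtain e where e: "e > 0" "ball y e \<subseteq> U \<inter> {a<..<b}" using y open_contains_ball by (metis Int_iff)
      show "0 < emeasure \<nu> U"
      proof (rule ccontr)
        assume "\<not> 0 < emeasure \<nu> U"
        then have "emeasure \<nu> U = 0" by simp
        then have "AE s in \<nu>. s \<notin> U" using U by (intro AE_not_in) (auto simp: null_sets_def)
        then have "AE s in lborel. 0 < ennreal (\<rho> s) \<longrightarrow> s \<notin> U"
          unfolding \<nu>_def by (subst (asm) AE_density) auto
        then have "AE s in lborel. s \<notin> ball y e"
        proof (rule eventually_mono)
          fix s assume s: "0 < ennreal (\<rho> s) \<longrightarrow> s \<notin> U"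
          show "s \<notin> ball y e"
          proof
            assume "s \<in> ball y e"
            then have "s \<in> U" "a < s" "s < b" using e(2) by auto
            moreover have "0 < \<rho> s" using calculation g_pos[of s] by (simp add: \<rho>_def)
            ultimately show False using s by simp
          qed
        qed
        then have "emeasure lborel (ball y e) = 0"
          by (subst (asm) AE_iff_measurable[where N = "ball y e"]) auto
        then show False using e(1) by (simp add: ball_eq_greaterThanLessThan)
      qed
    qed
  qed
qed

lemma integral_\<nu>:
  fixes f :: "real \<Rightarrow> 'a::euclidean_space"
  assumes "continuous_on {a..b} f" and [measurable]: "f \<in> borel_measurable borel"
  shows "(\<integral>s. f s \<partial>\<nu>) = integral {a..b} (\<lambda>s. \<rho> s *\<^sub>R f s)"
proof -
  have c: "continuous_on {a..b} (\<lambda>s. \<rho> s *\<^sub>R f s)"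
    by (intro continuous_intros assms continuous_on_\<rho>)
  have "(\<integral>s. f s \<partial>\<nu>) = (\<integral>s. \<rho> s *\<^sub>R f s \<partial>lborel)"
    unfolding \<nu>_def using \<rho>_nonneg by (intro integral_density) auto
  also have "\<dots> = set_lebesgue_integral lborel {a..b} (\<lambda>s. \<rho> s *\<^sub>R f s)"
    unfolding set_lebesgue_integral_def
  proof (rule Bochner_Integration.integral_cong[OF refl])
    show "\<rho> s *\<^sub>R f s = indicator {a..b} s *\<^sub>R \<rho> s *\<^sub>R f s" for s
      by (cases "s \<in> {a..b}") (simp_all add: \<rho>_0 del: atLeastAtMost_iff)
  qed
  also have "\<dots> = integral {a..b} (\<lambda>s. \<rho> s *\<^sub>R f s)"
    by (rule set_borel_integral_eq_integral(2)[OF borel_integrable_atLeastAtMost'[OF c]])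
  finally show ?thesis .
qed

lemma cauchy_transform_\<nu>:
  assumes z: "z \<notin> complex_of_real ` {a..b}" "\<And>j. j \<in> {1..q} \<Longrightarrow> z \<noteq> w j \<and> z \<noteq> cnj (w j)"
  shows "cauchy_transform \<nu> z = ext_field_deriv q \<gamma> w z - R z * G z"
proof -
  have "cauchy_transform \<nu> z = integral {a..b} (\<lambda>s. \<rho> s *\<^sub>R (1 / (z - of_real s)))"
    unfolding cauchy_transform_def
  proof (rule integral_\<nu>)
    show "continuous_on {a..b} (\<lambda>s. 1 / (z - of_real s))"
      using z(1) by (intro continuous_intros) auto
  qed measurable
  also have "(\<lambda>s. \<rho> s *\<^sub>R (1 / (z - of_real s))) = (\<lambda>s. of_real (\<rho> s) / (z - of_real s))"
    by (simp add: scaleR_conv_of_real)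
  finally show ?thesis using integral_unique[OF cauchy_integral[OF assms]] by simp
qed

text \<open>At height $y > 0$ above the real line, the potential and the external field are smooth, and the
  derivative of their sum along the line is the real part of $R\,G$. As $y \to 0$ this real part
  vanishes on the cut, is nonnegative to the right of it and nonpositive to the left.\<close>

definition U :: "real \<Rightarrow> real \<Rightarrow> real" where
  "U y x = (\<integral>s. ln ((x - s)\<^sup>2 + y\<^sup>2) / 2 \<partial>\<nu>)"

lemma integrable_bound_\<nu>:
  "integrable \<nu> (\<lambda>s. log_bound x s)"
proof (rule Bochner_Integration.integrable_add)
  obtain K where K: "K > 0" "\<And>x. \<rho> x \<le> K" using \<rho>_bound by blast
  let ?f = "\<lambda>s. indicator {-1..1} (x - s) * \<bar>x - s\<bar> powr (-1/2) :: real"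
  have "integrable lborel (\<lambda>s. \<rho> s *\<^sub>R ?f s)"
  proof (rule Bochner_Integration.integrable_bound)
    show "integrable lborel (\<lambda>s. K * ?f s)" by (intro integrable_mult_right integrable_inverse_sqrt_abs)
    show "AE s in lborel. norm (\<rho> s *\<^sub>R ?f s) \<le> norm (K * ?f s)"
      using K \<rho>_nonneg by (intro AE_I2) (auto simp: abs_mult intro!: mult_right_mono)
  qed measurable
  then have "integrable \<nu> ?f"
    unfolding \<nu>_def by (subst integrable_density) (auto simp: \<rho>_nonneg)
  then show "integrable \<nu> (\<lambda>s. 2 * ?f s)" by simp
  show "integrable \<nu> (\<lambda>s. (x - s)\<^sup>2 + 1)"
  proof (rule \<nu>.integrable_const_bound[where B = "(\<bar>x\<bar> + \<bar>a\<bar> + \<bar>b\<bar>)\<^sup>2 + 1"])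
    show "AE s in \<nu>. norm ((x - s)\<^sup>2 + 1) \<le> (\<bar>x\<bar> + \<bar>a\<bar> + \<bar>b\<bar>)\<^sup>2 + 1"
      using AE_\<nu>_in
    proof (rule eventually_mono)
      fix s assume "s \<in> {a..b}"
      then have "\<bar>x - s\<bar> \<le> \<bar>x\<bar> + \<bar>a\<bar> + \<bar>b\<bar>" by auto
      then have "(x - s)\<^sup>2 \<le> (\<bar>x\<bar> + \<bar>a\<bar> + \<bar>b\<bar>)\<^sup>2" using power_mono[of "\<bar>x - s\<bar>" "\<bar>x\<bar> + \<bar>a\<bar> + \<bar>b\<bar>" 2] by simp
      then show "norm ((x - s)\<^sup>2 + 1) \<le> (\<bar>x\<bar> + \<bar>a\<bar> + \<bar>b\<bar>)\<^sup>2 + 1" by simp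
    qed
  qed measurable
qed

lemma AE_\<nu>_neq: "AE s in \<nu>. s \<noteq> x"
  by (rule AE_\<nu>I[OF AE_lborel_singleton])

lemma integrable_ln_\<nu>:
  assumes "0 \<le> y" "y \<le> 1"
  shows "integrable \<nu> (\<lambda>s. ln ((x - s)\<^sup>2 + y\<^sup>2) / 2)"
proof (rule Bochner_Integration.integrable_bound[OF integrable_bound_\<nu>[of x]])
  show "AE s in \<nu>. norm (ln ((x - s)\<^sup>2 + y\<^sup>2) / 2) \<le> norm (log_bound x s)"
    using AE_\<nu>_neq
  proof (rule eventually_mono)
    fix s assume "s \<noteq> x"
    from abs_ln_sqrt_bound[OF this assms]
    show "norm (ln ((x - s)\<^sup>2 + y\<^sup>2) / 2) \<le> norm (log_bound x s)"
      unfolding real_norm_def by (rule order.trans[OF _ abs_ge_self])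
  qed
qed measurable

lemma U_tendsto: "(\<lambda>n. U (inverse (real (Suc n))) x) \<longlonglongrightarrow> U 0 x"
  unfolding U_def
proof (rule integral_dominated_convergence[OF _ _ integrable_bound_\<nu>[of x]])
  show "AE s in \<nu>. (\<lambda>n. ln ((x - s)\<^sup>2 + (inverse (real (Suc n)))\<^sup>2) / 2) \<longlonglongrightarrow> ln ((x - s)\<^sup>2 + 0\<^sup>2) / 2"
    using AE_\<nu>_neq by (rule eventually_mono) (intro tendsto_intros LIMSEQ_inverse_real_of_nat, auto)
  show "AE s in \<nu>. norm (ln ((x - s)\<^sup>2 + (inverse (real (Suc n)))\<^sup>2) / 2)
    \<le> log_bound x s" for n
    using AE_\<nu>_neq[of x]
  proof (rule eventually_mono)
    fix s assume s: "s \<noteq> x"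
    have "inverse (real (Suc n)) \<le> 1" by (simp add: field_simps)
    then show "norm (ln ((x - s)\<^sup>2 + (inverse (real (Suc n)))\<^sup>2) / 2)
      \<le> log_bound x s"
      unfolding real_norm_def by (intro abs_ln_sqrt_bound s) auto
  qed
qed measurable

lemma log_potential_\<nu>: "log_potential \<nu> x = ereal (- U 0 x)"
proof -
  have "ln ((x - s)\<^sup>2 + 0\<^sup>2) / 2 = ln \<bar>x - s\<bar>" for s
  proof -
    have "ln ((x - s)\<^sup>2) = 2 * ln \<bar>x - s\<bar>" using ln_realpow[of "\<bar>x - s\<bar>" 2] by (cases "x = s") auto
    then show ?thesis by simp
  qed
  then show ?thesis
    using log_potential_eq_integral[OF sets_\<nu> _ AE_\<nu>_neq, of x] integrable_ln_\<nu>[of 0 x] by (simp add: U_def)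
qed

lemma DERIV_U:
  assumes y: "y > 0"
  shows "(U y has_real_derivative Re (cauchy_transform \<nu> (Complex x y))) (at x)"
proof -
  have pos: "0 < (x - s)\<^sup>2 + y\<^sup>2" for x s using y by (simp add: add_nonneg_pos)
  have nz: "(x - s)\<^sup>2 + y\<^sup>2 \<noteq> 0" for x s using pos[of x s] by linarith
  have 1: "((\<lambda>x. integral (cbox a b) (\<lambda>s. \<rho> s * (ln ((x - s)\<^sup>2 + y\<^sup>2) / 2))) has_real_derivative
     integral (cbox a b) (\<lambda>s. \<rho> s * ((x - s) / ((x - s)\<^sup>2 + y\<^sup>2)))) (at x within UNIV)"
  proof (rule leibniz_rule_field_derivative)
    fix x s
    show "((\<lambda>x. \<rho> s * (ln ((x - s)\<^sup>2 + y\<^sup>2) / 2)) has_real_derivative \<rho> s * ((x - s) / ((x - s)\<^sup>2 + y\<^sup>2))) (at x)"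
    proof (rule DERIV_cmult)
      have "((\<lambda>x. ln ((x - s)\<^sup>2 + y\<^sup>2)) has_real_derivative 2 * ((x - s) / ((x - s)\<^sup>2 + y\<^sup>2))) (at x)"
        using pos[of x s] by (auto intro!: derivative_eq_intros)
      from DERIV_cdivide[OF this, of 2]
      show "((\<lambda>x. ln ((x - s)\<^sup>2 + y\<^sup>2) / 2) has_real_derivative (x - s) / ((x - s)\<^sup>2 + y\<^sup>2)) (at x)"
        by (rule DERIV_cong) (rule nonzero_mult_div_cancel_left, simp)
    qed
  next
    fix x
    show "(\<lambda>s. \<rho> s * (ln ((x - s)\<^sup>2 + y\<^sup>2) / 2)) integrable_on cbox a b"
      using nz by (intro integrable_continuous continuous_intros) (auto intro!: continuous_on_\<rho>)
  next
    have "continuous_on (UNIV \<times> {a..b}) (\<lambda>p. \<rho> (snd p))"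
      by (rule continuous_on_compose2[OF continuous_on_\<rho>]) (auto intro!: continuous_intros)
    then show "continuous_on (UNIV \<times> cbox a b) (\<lambda>(x, s). \<rho> s * ((x - s) / ((x - s)\<^sup>2 + y\<^sup>2)))"
      unfolding case_prod_beta using nz by (intro continuous_intros) auto
  qed auto
  have m: "(\<lambda>s. ln ((x - s)\<^sup>2 + y\<^sup>2) / 2) \<in> borel_measurable borel" for x by measurable
  have c: "continuous_on {a..b} (\<lambda>s. ln ((x - s)\<^sup>2 + y\<^sup>2) / 2)" for x
    using nz by (intro continuous_intros) auto
  have U: "U y = (\<lambda>x. integral (cbox a b) (\<lambda>s. \<rho> s * (ln ((x - s)\<^sup>2 + y\<^sup>2) / 2)))"
    unfolding U_def fun_eq_iff using integral_\<nu>[OF c m] by simp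
  have ne: "Complex x y \<noteq> of_real s" for s using y by (auto simp: complex_eq_iff)
  have "cauchy_transform \<nu> (Complex x y) = integral {a..b} (\<lambda>s. \<rho> s *\<^sub>R (1 / (Complex x y - of_real s)))"
    unfolding cauchy_transform_def using ne by (intro integral_\<nu> continuous_intros) auto
  moreover have i: "(\<lambda>s. \<rho> s *\<^sub>R (1 / (Complex x y - of_real s))) integrable_on {a..b}"
    using ne by (intro integrable_continuous_real continuous_intros) (auto intro!: continuous_on_\<rho>)
  ultimately have "Re (cauchy_transform \<nu> (Complex x y)) = integral {a..b} (\<lambda>s. Re (\<rho> s *\<^sub>R (1 / (Complex x y - of_real s))))"
    using has_integral_Re[OF integrable_integral[OF i]] by (simp add: integral_unique)
  also have "(\<lambda>s. Re (\<rho> s *\<^sub>R (1 / (Complex x y - of_real s)))) = (\<lambda>s. \<rho> s * ((x - s) / ((x - s)\<^sup>2 + y\<^sup>2)))"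
    by (simp add: Re_divide fun_eq_iff)
  finally show ?thesis unfolding U using 1 by simp
qed

text \<open>On the line |x - w| = |x - cnj w|, so each logarithm may be split evenly between the two
  points. This symmetric form is the one whose x-derivative at height y is the real part of
  \<open>ext_field_deriv\<close> at x + i y, which has poles at both.\<close>

definition \<Phi> :: "real \<Rightarrow> real \<Rightarrow> real" where
  "\<Phi> y x = (\<Sum>j=1..q. \<gamma> j / 4 * (ln ((x - Re (w j))\<^sup>2 + (y - Im (w j))\<^sup>2) + ln ((x - Re (w j))\<^sup>2 + (y + Im (w j))\<^sup>2)))"

lemma \<Phi>_0: "\<Phi> 0 x = ext_field q \<gamma> w x"
  unfolding \<Phi>_def ext_field_def
proof (rule sum.cong[OF refl])
  fix j assume j: "j \<in> {1..q}"
  have "cmod (of_real x - w j) > 0" using w[OF j] by (auto simp: complex_eq_iff)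
  then have "ln ((cmod (of_real x - w j))\<^sup>2) = 2 * ln (cmod (of_real x - w j))" by (simp add: ln_realpow)
  then show "\<gamma> j / 4 * (ln ((x - Re (w j))\<^sup>2 + (0 - Im (w j))\<^sup>2) + ln ((x - Re (w j))\<^sup>2 + (0 + Im (w j))\<^sup>2))
    = \<gamma> j * ln (cmod (of_real x - w j))"
    by (simp add: cmod_power2)
qed

lemma \<Phi>_tendsto: "(\<lambda>n. \<Phi> (inverse (real (Suc n))) x) \<longlonglongrightarrow> \<Phi> 0 x"
  unfolding \<Phi>_def
proof (intro tendsto_sum)
  fix j assume j: "j \<in> {1..q}"
  have "(x - Re (w j))\<^sup>2 + (0 - Im (w j))\<^sup>2 \<noteq> 0" "(x - Re (w j))\<^sup>2 + (0 + Im (w j))\<^sup>2 \<noteq> 0"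
    using w[OF j] by (auto simp: sum_power2_eq_zero_iff)
  then show "(\<lambda>n. \<gamma> j / 4 * (ln ((x - Re (w j))\<^sup>2 + (inverse (real (Suc n)) - Im (w j))\<^sup>2) + ln ((x - Re (w j))\<^sup>2 + (inverse (real (Suc n)) + Im (w j))\<^sup>2)))
    \<longlonglongrightarrow> \<gamma> j / 4 * (ln ((x - Re (w j))\<^sup>2 + (0 - Im (w j))\<^sup>2) + ln ((x - Re (w j))\<^sup>2 + (0 + Im (w j))\<^sup>2))"
    by (intro tendsto_intros LIMSEQ_inverse_real_of_nat) auto
qed

lemma DERIV_\<Phi>:
  assumes y: "0 < y" "\<And>j. j \<in> {1..q} \<Longrightarrow> y < Im (w j)"
  shows "(\<Phi> y has_real_derivative Re (ext_field_deriv q \<gamma> w (Complex x y))) (at x)"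
proof -
  let ?z = "Complex x y"
  have "(\<Phi> y has_real_derivative (\<Sum>j=1..q. \<gamma> j / 4 * (2 * ((x - Re (w j)) / ((x - Re (w j))\<^sup>2 + (y - Im (w j))\<^sup>2))
     + 2 * ((x - Re (w j)) / ((x - Re (w j))\<^sup>2 + (y + Im (w j))\<^sup>2))))) (at x)"
    unfolding \<Phi>_def[abs_def]
  proof (intro DERIV_sum DERIV_cmult DERIV_add)
    fix j assume j: "j \<in> {1..q}"
    have "0 < (x - Re (w j))\<^sup>2 + (y - Im (w j))\<^sup>2" "0 < (x - Re (w j))\<^sup>2 + (y + Im (w j))\<^sup>2"
      using y(1) y(2)[OF j] by (auto intro!: add_nonneg_pos)
    then show "((\<lambda>x. ln ((x - Re (w j))\<^sup>2 + (y - Im (w j))\<^sup>2)) has_real_derivative 2 * ((x - Re (w j)) / ((x - Re (w j))\<^sup>2 + (y - Im (w j))\<^sup>2))) (at x)"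
      "((\<lambda>x. ln ((x - Re (w j))\<^sup>2 + (y + Im (w j))\<^sup>2)) has_real_derivative 2 * ((x - Re (w j)) / ((x - Re (w j))\<^sup>2 + (y + Im (w j))\<^sup>2))) (at x)"
      by (auto intro!: derivative_eq_intros)
  qed
  also have "(\<Sum>j=1..q. \<gamma> j / 4 * (2 * ((x - Re (w j)) / ((x - Re (w j))\<^sup>2 + (y - Im (w j))\<^sup>2))
     + 2 * ((x - Re (w j)) / ((x - Re (w j))\<^sup>2 + (y + Im (w j))\<^sup>2)))) = Re (ext_field_deriv q \<gamma> w ?z)"
    unfolding ext_field_deriv_def Re_sum
  proof (rule sum.cong[OF refl])
    fix j assume j: "j \<in> {1..q}"
    have nz: "?z - w j \<noteq> 0" "?z - cnj (w j) \<noteq> 0" using y(1) y(2)[OF j] by (auto simp: complex_eq_iff)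
    have "(?z - of_real (Re (w j))) = ((?z - cnj (w j)) + (?z - w j)) / 2" by (simp add: complex_eq_iff)
    have e: "(?z - of_real (Re (w j))) / ((?z - w j) * (?z - cnj (w j))) = (1 / (?z - w j) + 1 / (?z - cnj (w j))) / 2"
    proof -
      have "((B + A) / 2) / (A * B) = (1 / A + 1 / B) / 2" if "A \<noteq> 0" "B \<noteq> 0" for A B :: complex
        using that by (simp add: field_simps)
      from this[OF nz] show ?thesis
        unfolding \<open>?z - of_real (Re (w j)) = ((?z - cnj (w j)) + (?z - w j)) / 2\<close> .
    qed
    have r: "Re (1 / (?z - w j)) = (x - Re (w j)) / ((x - Re (w j))\<^sup>2 + (y - Im (w j))\<^sup>2)"
      "Re (1 / (?z - cnj (w j))) = (x - Re (w j)) / ((x - Re (w j))\<^sup>2 + (y + Im (w j))\<^sup>2)"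
      by (simp_all add: Re_divide)
    have "Re (of_real c * ((P + Q) / 2)) = c / 4 * (2 * Re P + 2 * Re Q)" for c P Q by simp
    then show "\<gamma> j / 4 * (2 * ((x - Re (w j)) / ((x - Re (w j))\<^sup>2 + (y - Im (w j))\<^sup>2))
     + 2 * ((x - Re (w j)) / ((x - Re (w j))\<^sup>2 + (y + Im (w j))\<^sup>2)))
      = Re (of_real (\<gamma> j) * ((?z - of_real (Re (w j))) / ((?z - w j) * (?z - cnj (w j)))))"
      unfolding e by (simp only: r)
  qed
  finally show ?thesis .
qed

abbreviation Re_RG :: "real \<Rightarrow> real \<Rightarrow> real" where
  "Re_RG x y \<equiv> Re (R (Complex x y) * G (Complex x y))"

text \<open>\<open>G\<close> is Lipschitz in y near the line and \<open>R\<close> is bounded on the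
  strip, so the product differs from \<open>R g\<close> by O(y); then g > 0 and the signs of Re R
  decide. The rate sqrt y, instead of y, is that of Re R on the cut, where it is worst at the
  endpoints.\<close>

lemma RG_estimate:
  assumes X: "-X \<le> a" "b \<le> X"
  obtains C y0 where "C \<ge> 0" "y0 > 0" "y0 \<le> 1" "\<And>j. j \<in> {1..q} \<Longrightarrow> y0 \<le> Im (w j)"
    "\<And>x y. 0 < y \<Longrightarrow> y < y0 \<Longrightarrow> x \<in> {a..b} \<Longrightarrow> \<bar>Re_RG x y\<bar> \<le> C * sqrt y"
    "\<And>x y. 0 < y \<Longrightarrow> y < y0 \<Longrightarrow> x \<in> {b..X} \<Longrightarrow> - (C * sqrt y) \<le> Re_RG x y"
    "\<And>x y. 0 < y \<Longrightarrow> y < y0 \<Longrightarrow> x \<in> {-X..a} \<Longrightarrow> Re_RG x y \<le> C * sqrt y"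
proof -
  \<comment> \<open>Below half of each \<open>Im (w j)\<close> the points x + i y keep the distance
    \<open>Im (w j) / 2\<close> from the poles, and below 1 the error O(y) is absorbed by sqrt
    y.\<close>
  define y0 where "y0 = Min (insert 1 ((\<lambda>j. Im (w j) / 2) ` {1..q}))"
  have y0: "y0 > 0" "y0 \<le> 1" "\<And>j. j \<in> {1..q} \<Longrightarrow> y0 \<le> Im (w j) / 2"
  proof -
    show "y0 > 0" unfolding y0_def using w by (subst Min_gr_iff) auto
    show "y0 \<le> 1" unfolding y0_def by (rule Min_le) auto
    show "y0 \<le> Im (w j) / 2" if "j \<in> {1..q}" for j unfolding y0_def using that by (intro Min_le) auto
  qed
  define C1 where "C1 = (\<Sum>j=1..q. \<gamma> j * (2 / (cmod (R (w j)) * (Im (w j))\<^sup>2)))"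
  have C1: "C1 \<ge> 0" unfolding C1_def using \<gamma> by (intro sum_nonneg mult_nonneg_nonneg divide_nonneg_nonneg) (auto intro: less_imp_le)
  have diff: "cmod (G (Complex x y) - of_real (g x)) \<le> C1 * y" if y: "0 < y" "y < y0" for x y
  proof -
    have eq: "G (Complex x y) - of_real (g x) = (\<Sum>j=1..q. of_real (\<gamma> j / 2) * ((1 / (R (w j) * (Complex x y - w j)) - 1 / (R (w j) * (of_real x - w j)))
       + (1 / (cnj (R (w j)) * (Complex x y - cnj (w j))) - 1 / (cnj (R (w j)) * (of_real x - cnj (w j))))))"
      unfolding G_of_real[symmetric] G_def sum_subtractf[symmetric] by (intro sum.cong) (auto simp: algebra_simps)
    have "cmod (G (Complex x y) - of_real (g x)) \<le> (\<Sum>j=1..q. \<gamma> j * (2 / (cmod (R (w j)) * (Im (w j))\<^sup>2)) * y)"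
      unfolding eq
    proof (rule sum_norm_le)
      fix j assume j: "j \<in> {1..q}"
      define v where "v = Im (w j)"
      have v: "v > 0" "y \<le> v / 2" using w[OF j] y0(3)[OF j] y by (auto simp: v_def)
      have one: "cmod (1 / (r * (Complex x y - p)) - 1 / (r * (of_real x - p))) \<le> 2 * y / (cmod r * v\<^sup>2)"
        if "r \<noteq> 0" "\<bar>Im p\<bar> = v" for r p
      proof -
        have A: "v / 2 \<le> cmod (Complex x y - p)"
          using abs_Im_le_cmod[of "Complex x y - p"] that(2) v y(1) by (auto simp: abs_if split: if_splits)
        have B: "v \<le> cmod (of_real x - p)"
          using abs_Im_le_cmod[of "of_real x - p"] that(2) by simp
        have nz: "Complex x y - p \<noteq> 0" "of_real x - p \<noteq> 0" using A B v by auto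
        have "1 / (r * (Complex x y - p)) - 1 / (r * (of_real x - p)) = ((of_real x - p) - (Complex x y - p)) / (r * ((Complex x y - p) * (of_real x - p)))"
        proof -
          have "1 / (r * A) - 1 / (r * B) = (B - A) / (r * (A * B))" if "A \<noteq> 0" "B \<noteq> 0" for A B
            using that \<open>r \<noteq> 0\<close> by (simp add: field_simps)
          from this[OF nz] show ?thesis .
        qed
        also have "(of_real x - p) - (Complex x y - p) = - \<i> * of_real y" by (simp add: complex_eq_iff)
        finally have "cmod (1 / (r * (Complex x y - p)) - 1 / (r * (of_real x - p))) = y / (cmod r * (cmod (Complex x y - p) * cmod (of_real x - p)))"
          using y by (simp add: norm_divide norm_mult)
        also have "\<dots> \<le> y / (cmod r * (v / 2 * v))"
          using A B v y that(1) by (intro divide_left_mono mult_left_mono mult_mono mult_pos_pos) (auto simp: nz)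
        also have "\<dots> = 2 * y / (cmod r * v\<^sup>2)" by (simp add: power2_eq_square)
        finally show ?thesis .
      qed
      have "cmod (of_real (\<gamma> j / 2) * (P + Q)) \<le> \<gamma> j * (2 / (cmod (R (w j)) * (Im (w j))\<^sup>2)) * y"
        if "cmod P \<le> 2 * y / (cmod (R (w j)) * v\<^sup>2)" "cmod Q \<le> 2 * y / (cmod (R (w j)) * v\<^sup>2)" for P Q
      proof -
        have "cmod (P + Q) \<le> 2 * (2 * y / (cmod (R (w j)) * v\<^sup>2))" using norm_triangle_ineq[of P Q] that by linarith
        then have "\<gamma> j / 2 * cmod (P + Q) \<le> \<gamma> j / 2 * (2 * (2 * y / (cmod (R (w j)) * v\<^sup>2)))"
          using \<gamma>[OF j] by (intro mult_left_mono) auto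
        then show ?thesis using \<gamma>[OF j] by (simp add: norm_mult v_def mult_ac)
      qed
      then show "cmod (of_real (\<gamma> j / 2) * ((1 / (R (w j) * (Complex x y - w j)) - 1 / (R (w j) * (of_real x - w j)))
       + (1 / (cnj (R (w j)) * (Complex x y - cnj (w j))) - 1 / (cnj (R (w j)) * (of_real x - cnj (w j))))))
       \<le> \<gamma> j * (2 / (cmod (R (w j)) * (Im (w j))\<^sup>2)) * y"
        using one[of "R (w j)" "w j"] one[of "cnj (R (w j))" "cnj (w j)"] R_nz[OF j] v by (simp add: v_def)
    qed
    then show ?thesis unfolding C1_def sum_distrib_right .
  qed
  define K where "K = 2 * X + 1"
  have K: "K > 0" using X ab by (simp add: K_def)
  have R: "cmod (R (Complex x y)) \<le> K" if y: "0 < y" "y < y0" and x: "x \<in> {-X..X}" for x y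
  proof -
    have *: "cmod (Complex x y - of_real c) \<le> K" if "-X \<le> c" "c \<le> X" for c
    proof -
      have "cmod (Complex x y - of_real c) \<le> \<bar>x - c\<bar> + \<bar>y\<bar>"
        using cmod_le[of "Complex x y - of_real c"] by simp
      also have "\<dots> \<le> K" using that x y y0 by (auto simp: K_def)
      finally show ?thesis .
    qed
    have "Complex x y \<noteq> of_real a" using y by (auto simp: complex_eq_iff)
    then have "(cmod (R (Complex x y)))\<^sup>2 = cmod (Complex x y - of_real a) * cmod (Complex x y - of_real b)"
      by (simp add: power2_sqrt_branch norm_mult flip: norm_power)
    also have "\<dots> \<le> K * K" using * X ab K by (intro mult_mono) auto
    finally have "(cmod (R (Complex x y)))\<^sup>2 \<le> K\<^sup>2" by (simp only: power2_eq_square[of K])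
    then show ?thesis by (rule power2_le_imp_le) (use K in simp)
  qed
  obtain M where M: "M \<ge> 0" "\<And>x. x \<in> {-X..X} \<Longrightarrow> g x \<le> M"
  proof -
    have "bounded (g ` {-X..X})" by (intro compact_imp_bounded compact_continuous_image continuous_on_g) auto
    then obtain M where "M > 0" "\<And>x. x \<in> {-X..X} \<Longrightarrow> \<bar>g x\<bar> \<le> M" unfolding bounded_pos by auto
    then show ?thesis by (intro that[of M]) force+
  qed
  have key: "\<bar>Re_RG x y - Re (R (Complex x y)) * g x\<bar> \<le> K * C1 * sqrt y"
    if y: "0 < y" "y < y0" and x: "x \<in> {-X..X}" for x y
  proof -
    have "Re_RG x y - Re (R (Complex x y)) * g x = Re (R (Complex x y) * (G (Complex x y) - of_real (g x)))"
      by (simp add: algebra_simps)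
    also have "\<bar>\<dots>\<bar> \<le> cmod (R (Complex x y)) * cmod (G (Complex x y) - of_real (g x))"
      unfolding norm_mult[symmetric] by (rule abs_Re_le_cmod)
    also have "\<dots> \<le> K * (C1 * y)" using R[OF y x] diff[OF y] K by (intro mult_mono) auto
    also have "\<dots> \<le> K * C1 * sqrt y"
    proof -
      have "y \<le> sqrt y" using y y0 by (intro real_le_rsqrt) (simp add: power2_eq_square mult_left_le)
      then show ?thesis using K C1 by (simp add: mult.assoc mult_left_mono)
    qed
    finally show ?thesis .
  qed
  define C where "C = K * C1 + sqrt ((b - a) / 2) * M"
  have s0: "0 \<le> sqrt ((b - a) / 2) * M * sqrt y" if "0 < y" for y using M ab that by simp
  show thesis
  proof (rule that[of C y0])
    show "C \<ge> 0" using K C1 M ab by (simp add: C_def)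
    show "y0 \<le> Im (w j)" if "j \<in> {1..q}" for j using y0(3)[OF that] w[OF that] by simp
    fix x y :: real assume y: "0 < y" "y < y0"
    show "\<bar>Re_RG x y\<bar> \<le> C * sqrt y" if x: "x \<in> {a..b}"
    proof -
      have x': "x \<in> {-X..X}" using x X by auto
      have "\<bar>Re (R (Complex x y))\<bar> \<le> sqrt (y * (b - a) / 2)"
        using Re_sqrt_branch(3)[OF ab y(1) x] by (intro real_le_rsqrt) simp
      also have "\<dots> = sqrt ((b - a) / 2) * sqrt y" by (simp add: real_sqrt_mult real_sqrt_divide)
      finally have "\<bar>Re (R (Complex x y))\<bar> * g x \<le> sqrt ((b - a) / 2) * sqrt y * M"
        using M(2)[OF x'] g_pos[of x] ab y by (intro mult_mono) auto
      moreover have "\<bar>Re (R (Complex x y)) * g x\<bar> = \<bar>Re (R (Complex x y))\<bar> * g x"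
        using g_pos[of x] by (simp add: abs_mult)
      ultimately show ?thesis using key[OF y x'] by (simp add: C_def algebra_simps)
    qed
    show "- (C * sqrt y) \<le> Re_RG x y" if x: "x \<in> {b..X}"
    proof -
      have "0 \<le> Re (R (Complex x y)) * g x"
        using Re_sqrt_branch(1)[OF ab y(1), of x] g_pos[of x] x ab by (intro mult_nonneg_nonneg) auto
      then show ?thesis using key[OF y, of x] s0[OF y(1)] x X ab by (simp add: C_def algebra_simps)
    qed
    show "Re_RG x y \<le> C * sqrt y" if x: "x \<in> {-X..a}"
    proof -
      have "Re (R (Complex x y)) * g x \<le> 0"
        using Re_sqrt_branch(2)[OF ab y(1), of x] g_pos[of x] x ab by (intro mult_nonpos_nonneg) auto
      then show ?thesis using key[OF y, of x] s0[OF y(1)] x X ab by (simp add: C_def algebra_simps)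
    qed
  qed (use y0 in auto)
qed

text \<open>At height y the derivative of \<open>\<Phi> y - U y\<close> is \<open>Re_RG\<close>, so
  the one-sided bounds of order sqrt y integrate to bounds on increments and become exact signs as y
  -> 0. The detour avoids differentiating the potential on the cut itself.\<close>

lemma potential_increments:
  shows "x \<in> {a..b} \<Longrightarrow> \<Phi> 0 x - U 0 x = \<Phi> 0 b - U 0 b"
    and "x \<ge> b \<Longrightarrow> \<Phi> 0 x - U 0 x \<ge> \<Phi> 0 b - U 0 b"
    and "x \<le> a \<Longrightarrow> \<Phi> 0 x - U 0 x \<ge> \<Phi> 0 a - U 0 a"
proof -
  define X where "X = \<bar>x\<bar> + \<bar>a\<bar> + \<bar>b\<bar>"
  have X: "-X \<le> a" "b \<le> X" "-X \<le> x" "x \<le> X" by (auto simp: X_def)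
  obtain C y0 where C: "C \<ge> 0" "y0 > 0" "y0 \<le> 1" "\<And>j. j \<in> {1..q} \<Longrightarrow> y0 \<le> Im (w j)"
    "\<And>x y. 0 < y \<Longrightarrow> y < y0 \<Longrightarrow> x \<in> {a..b} \<Longrightarrow> \<bar>Re_RG x y\<bar> \<le> C * sqrt y"
    "\<And>x y. 0 < y \<Longrightarrow> y < y0 \<Longrightarrow> x \<in> {b..X} \<Longrightarrow> - (C * sqrt y) \<le> Re_RG x y"
    "\<And>x y. 0 < y \<Longrightarrow> y < y0 \<Longrightarrow> x \<in> {-X..a} \<Longrightarrow> Re_RG x y \<le> C * sqrt y"
    using RG_estimate[OF X(1,2)] by blast
  define F where "F y x = \<Phi> y x - U y x" for y x
  define e where "e n = inverse (real (Suc n))" for n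
  have lim: "(\<lambda>n. F (e n) x) \<longlonglongrightarrow> F 0 x" for x
    unfolding F_def e_def by (intro tendsto_diff \<Phi>_tendsto U_tendsto)
  have e0: "e \<longlonglongrightarrow> 0" unfolding e_def by (rule LIMSEQ_inverse_real_of_nat)
  have ev: "\<forall>\<^sub>F n in sequentially. 0 < e n \<and> e n < y0"
    using order_tendstoD(2)[OF e0 C(2)] by (rule eventually_mono) (simp add: e_def)
  have d: "(F y has_real_derivative Re_RG x y) (at x)" if y: "0 < y" "y < y0" for x y
  proof -
    have yw: "y < Im (w j)" if "j \<in> {1..q}" for j using C(4)[OF that] y by simp
    have 1: "Complex x y \<notin> complex_of_real ` {a..b}" using y by (auto simp: complex_eq_iff)
    have 2: "Complex x y \<noteq> w j \<and> Complex x y \<noteq> cnj (w j)" if "j \<in> {1..q}" for j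
      using yw[OF that] y by (auto simp: complex_eq_iff)
    have "(F y has_real_derivative Re (ext_field_deriv q \<gamma> w (Complex x y)) - Re (cauchy_transform \<nu> (Complex x y))) (at x)"
      unfolding F_def[abs_def] using y yw by (intro DERIV_diff DERIV_\<Phi> DERIV_U) auto
    then show ?thesis using cauchy_transform_\<nu>[OF 1 2] by simp
  qed
  \<comment> \<open>The factor s, taken as 1 or -1, selects the direction of the inequality; on the
    cut both choices apply and force equality.\<close>
  have limit: "0 \<le> s * (F 0 v - F 0 u)"
    if "u \<le> v" and lo: "\<And>x y. 0 < y \<Longrightarrow> y < y0 \<Longrightarrow> u \<le> x \<Longrightarrow> x \<le> v \<Longrightarrow> - (C * sqrt y) \<le> s * Re_RG x y"
    for s u v :: real
  proof (rule tendsto_le[OF sequentially_bot])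
    show "(\<lambda>n. s * (F (e n) v - F (e n) u)) \<longlonglongrightarrow> s * (F 0 v - F 0 u)" by (intro tendsto_intros lim)
    have "(\<lambda>n. - (C * sqrt (e n)) * (v - u)) \<longlonglongrightarrow> - (C * sqrt 0) * (v - u)" by (intro tendsto_intros e0)
    then show "(\<lambda>n. - (C * sqrt (e n)) * (v - u)) \<longlonglongrightarrow> 0" by simp
    show "\<forall>\<^sub>F n in sequentially. - (C * sqrt (e n)) * (v - u) \<le> s * (F (e n) v - F (e n) u)"
      using ev
    proof (rule eventually_mono)
      fix n assume n: "0 < e n \<and> e n < y0"
      have "- (C * sqrt (e n)) * (v - u) \<le> s * F (e n) v - s * F (e n) u"
        using n lo that(1) d by (intro DERIV_lower_bound_increment[where f' = "\<lambda>x. s * Re_RG x (e n)"] DERIV_cmult) auto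
      then show "- (C * sqrt (e n)) * (v - u) \<le> s * (F (e n) v - F (e n) u)" by (simp add: right_diff_distrib)
    qed
  qed
  show "\<Phi> 0 x - U 0 x = \<Phi> 0 b - U 0 b" if x: "x \<in> {a..b}"
  proof -
    have "- (C * sqrt y) \<le> 1 * Re_RG u y" "- (C * sqrt y) \<le> (-1) * Re_RG u y"
      if "0 < y" "y < y0" "x \<le> u" "u \<le> b" for u y
      using C(5)[OF that(1,2), of u] that x by auto
    then have "0 \<le> 1 * (F 0 b - F 0 x)" "0 \<le> (-1) * (F 0 b - F 0 x)"
      using x by (intro limit; simp)+
    then show ?thesis by (auto simp: F_def)
  qed
  show "\<Phi> 0 x - U 0 x \<ge> \<Phi> 0 b - U 0 b" if x: "x \<ge> b"
  proof -
    have "- (C * sqrt y) \<le> 1 * Re_RG u y" if "0 < y" "y < y0" "b \<le> u" "u \<le> x" for u y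
      using C(6)[OF that(1,2), of u] that X by auto
    from limit[OF x this] show ?thesis by (auto simp: F_def)
  qed
  show "\<Phi> 0 x - U 0 x \<ge> \<Phi> 0 a - U 0 a" if x: "x \<le> a"
  proof -
    have "- (C * sqrt y) \<le> (-1) * Re_RG u y" if "0 < y" "y < y0" "x \<le> u" "u \<le> a" for u y
      using C(7)[OF that(1,2), of u] that X by auto
    from limit[OF x this] show ?thesis by (auto simp: F_def)
  qed
qed

theorem is_equilibrium_measure_\<nu>: "is_equilibrium_measure (ext_field q \<gamma> w) t \<nu>"
proof -
  have eq: "log_potential \<nu> x + ereal (ext_field q \<gamma> w x) = ereal (\<Phi> 0 x - U 0 x)" for x
    by (simp add: log_potential_\<nu> \<Phi>_0)
  have ends: "\<Phi> 0 a - U 0 a = \<Phi> 0 b - U 0 b"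
    by (rule potential_increments(1)) (use ab in simp)
  have ge: "\<Phi> 0 b - U 0 b \<le> \<Phi> 0 x - U 0 x" for x
  proof -
    consider "x \<le> a" | "x \<in> {a..b}" | "b \<le> x" by fastforce
    then show ?thesis
    proof cases
      case 1
      then show ?thesis using potential_increments(3)[of x] ends by simp
    next
      case 2
      then show ?thesis using potential_increments(1)[of x] by simp
    next
      case 3
      then show ?thesis by (rule potential_increments(2))
    qed
  qed
  show ?thesis
    unfolding is_equilibrium_measure_def eq measure_support_\<nu>
  proof (intro conjI exI[of _ "\<Phi> 0 b - U 0 b"] ballI allI)
    show "ereal (\<Phi> 0 x - U 0 x) = ereal (\<Phi> 0 b - U 0 b)" if "x \<in> {a..b}" for x
      using potential_increments(1)[OF that] by simp
    show "ereal (\<Phi> 0 b - U 0 b) \<le> ereal (\<Phi> 0 x - U 0 x)" for x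
      using ge[of x] by simp
  qed (simp_all add: emeasure_\<nu>)
qed

end

section \<open>The endpoints of the support\<close>

lemma abs_mult_le:
  fixes c :: real
  assumes "0 < c" "\<bar>x\<bar> \<le> y"
  shows "\<bar>c * x\<bar> \<le> c * y"
  using assms by (simp add: abs_mult mult_left_mono)

text \<open>For p = csqrt(1 - \<xi>) one has \<xi> = (1 - p)(1 + p) with |1 + p| \<ge> 1, hence |1 -
  p| \<le> |\<xi>|. The second-order remainder is controlled by the factorisation (1/p - 1 -
  \<xi>/2) 2 p = (1 - p)^2 (2 + p).\<close>

lemma csqrt_one_minus:
  fixes \<xi> :: complex
  assumes "norm \<xi> \<le> 1/2"
  shows "norm (1 / csqrt (1 - \<xi>) - 1 - \<xi> / 2) \<le> 2 * (norm \<xi>)\<^sup>2"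
    and "norm (1 / csqrt (1 - \<xi>) - 1) \<le> 2 * norm \<xi>"
proof -
  define p where "p = csqrt (1 - \<xi>)"
  have p2: "p * p = 1 - \<xi>" by (simp add: p_def flip: power2_eq_square)
  have "Re p \<ge> 0" using Re_csqrt[of "1 - \<xi>"] by (simp add: p_def)
  then have n1: "norm (1 + p) \<ge> 1" using complex_Re_le_cmod[of "1 + p"] by simp
  then have nz1: "1 + p \<noteq> 0" by auto
  have "(1 - p) * (1 + p) = \<xi>" using p2 by (simp add: algebra_simps)
  then have "norm (1 - p) * norm (1 + p) = norm \<xi>" by (metis norm_mult)
  then have d: "norm (1 - p) \<le> norm \<xi>" using n1 by (metis mult_left_mono mult.right_neutral norm_ge_zero)
  have np: "norm p \<ge> 1/2" using norm_triangle_ineq2[of 1 "1 - p"] d assms by simp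
  then have nz: "p \<noteq> 0" by auto
  have e: "1 / p - 1 = (1 - p) / p" using nz by (simp add: diff_divide_distrib)
  have "norm (1 / p - 1) \<le> norm \<xi> / (1/2)"
    unfolding e norm_divide using d np by (intro frac_le) auto
  then show "norm (1 / csqrt (1 - \<xi>) - 1) \<le> 2 * norm \<xi>" by (simp add: p_def)
  have "(1 / p - 1 - \<xi> / 2) * (2 * p) = (1 - p) * (1 - p) * (2 + p)"
  proof -
    have "(1 / p - 1 - \<xi> / 2) * (2 * p) = 2 - 2 * p - \<xi> * p" using nz by (simp add: algebra_simps)
    also have "\<dots> = (1 - p) * (1 - p) * (2 + p)"
    proof -
      have \<xi>: "\<xi> = 1 - p * p" using p2 by simp
      show ?thesis unfolding \<xi> by (simp add: algebra_simps)
    qed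
    finally show ?thesis .
  qed
  then have "norm (1 / p - 1 - \<xi> / 2) * (2 * norm p) = norm (1 - p) * norm ((1 - p) * (2 + p))"
    by (metis mult.assoc norm_mult norm_numeral)
  moreover have "norm ((1 - p) * (2 + p)) \<le> 2 * norm \<xi>"
  proof -
    have "norm (2 + p) \<le> 2 * norm (1 + p)" using norm_triangle_ineq[of 1 "1 + p"] n1 by (simp add: add.assoc[symmetric])
    then have "norm (1 - p) * norm (2 + p) \<le> norm (1 - p) * (2 * norm (1 + p))" by (intro mult_left_mono) auto
    also have "\<dots> = 2 * norm \<xi>" using \<open>norm (1 - p) * norm (1 + p) = norm \<xi>\<close> by simp
    finally show ?thesis by (simp add: norm_mult)
  qed
  ultimately have "norm (1 / p - 1 - \<xi> / 2) * (2 * norm p) \<le> norm \<xi> * (2 * norm \<xi>)"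
    using d by (metis mult_mono norm_ge_zero)
  moreover have "norm (1 / p - 1 - \<xi> / 2) * 1 \<le> norm (1 / p - 1 - \<xi> / 2) * (2 * norm p)"
    using np by (intro mult_left_mono) auto
  ultimately show "norm (1 / csqrt (1 - \<xi>) - 1 - \<xi> / 2) \<le> 2 * (norm \<xi>)\<^sup>2"
    unfolding p_def[symmetric] by (simp add: power2_eq_square)
qed

text \<open>Both sides have the same square, and positivity of the imaginary part selects the sign.
  This form exhibits the behaviour i h for large h.\<close>

lemma sqrt_branch_centered:
  assumes "h > 0" "Im z > 0"
  shows "sqrt_branch (m - h) (m + h) z = \<i> * of_real h * csqrt (1 - ((z - of_real m) / of_real h)\<^sup>2)"
proof -
  let ?r = "sqrt_branch (m - h) (m + h) z"
  have pos: "Im ?r > 0" by (rule Im_sqrt_branch_pos) (use assms in auto)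
  have r2: "?r\<^sup>2 = (z - of_real (m - h)) * (z - of_real (m + h))"
    by (rule power2_sqrt_branch) (use assms in \<open>auto simp: complex_eq_iff\<close>)
  have h: "of_real h \<noteq> (0::complex)" using assms by simp
  have "csqrt (1 - ((z - of_real m) / of_real h)\<^sup>2) = - \<i> * ?r / of_real h"
  proof (rule csqrt_unique)
    have "(- \<i> * ?r / of_real h)\<^sup>2 = - ?r\<^sup>2 / (of_real h)\<^sup>2"
      by (simp add: power_divide power_mult_distrib)
    also have "- ?r\<^sup>2 = (of_real h)\<^sup>2 - (z - of_real m)\<^sup>2" unfolding r2
      by (simp add: algebra_simps power2_eq_square)
    finally show "(- \<i> * ?r / of_real h)\<^sup>2 = 1 - ((z - of_real m) / of_real h)\<^sup>2"
    proof -
      have "(H\<^sup>2 - Y\<^sup>2) / H\<^sup>2 = 1 - (Y / H)\<^sup>2" if "H \<noteq> 0" for H Y :: complex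
        using that by (simp add: diff_divide_distrib power_divide)
      from this[OF h] show "(- \<i> * ?r / of_real h)\<^sup>2 = ((of_real h)\<^sup>2 - (z - of_real m)\<^sup>2) / (of_real h)\<^sup>2
        \<Longrightarrow> (- \<i> * ?r / of_real h)\<^sup>2 = 1 - ((z - of_real m) / of_real h)\<^sup>2" by simp
    qed
    show "0 < Re (- \<i> * ?r / of_real h) \<or> Re (- \<i> * ?r / of_real h) = 0 \<and> 0 \<le> Im (- \<i> * ?r / of_real h)"
      using pos assms by (simp add: Re_divide_of_real)
  qed
  then show ?thesis using h by (simp add: field_simps)
qed

locale upper_points =
  fixes q :: nat and \<gamma> :: "nat \<Rightarrow> real" and w :: "nat \<Rightarrow> complex"
  assumes q: "q \<ge> 1" and w: "\<And>j. j \<in> {1..q} \<Longrightarrow> Im (w j) > 0" and \<gamma>: "\<And>j. j \<in> {1..q} \<Longrightarrow> \<gamma> j > 0"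
begin

abbreviation root :: "real \<Rightarrow> real \<Rightarrow> nat \<Rightarrow> complex" where
  "root m h j \<equiv> sqrt_branch (m - h) (m + h) (w j)"

abbreviation eqn1 :: "real \<Rightarrow> real \<Rightarrow> real" where
  "eqn1 m h \<equiv> \<Sum>j=1..q. \<gamma> j * Re (1 / root m h j)"

abbreviation eqn2 :: "real \<Rightarrow> real \<Rightarrow> real" where
  "eqn2 m h \<equiv> \<Sum>j=1..q. \<gamma> j * Re (w j / root m h j)"

definition T where "T = (\<Sum>j=1..q. \<gamma> j)"
text \<open>\<open>M\<close> and \<open>m0\<close> are the leading data of the endpoint equations:
  for large h, \<open>eqn1 m h\<close> is M (m0 - m)/h^3 and \<open>eqn2 m h\<close> is M/h, up to
  terms of higher order in 1/h.\<close>

definition M where "M = (\<Sum>j=1..q. \<gamma> j * Im (w j))"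
definition m0 where "m0 = (\<Sum>j=1..q. \<gamma> j * Im (w j) * Re (w j)) / M"
text \<open>One bound for all |w_j| and for all |w_j - m| with |m - m0| \<le> 1, made at least 1 so
  that its powers can be compared.\<close>

definition L where "L = (\<Sum>j=1..q. cmod (w j)) + \<bar>m0\<bar> + 1"

text \<open>A sum of Poisson kernels; \<open>P x / pi\<close> is the density of the limit measure,
  which has mass \<open>T\<close>.\<close>

definition P :: "real \<Rightarrow> real" where
  "P x = (\<Sum>j=1..q. \<gamma> j * Im (w j) / ((x - Re (w j))\<^sup>2 + (Im (w j))\<^sup>2))"

text \<open>With endpoints $m \mp h$, the square root at $w_j$ is $i h / (1 + \kappa_j)$.\<close>

definition \<kappa> :: "real \<Rightarrow> real \<Rightarrow> nat \<Rightarrow> complex" where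
  "\<kappa> m h j = 1 / csqrt (1 - ((w j - of_real m) / of_real h)\<^sup>2) - 1"

lemma T_pos: "T > 0" and M_pos: "M > 0"
  unfolding T_def M_def using q \<gamma> w by (intro sum_pos; auto)+

lemma norm_w_le: "j \<in> {1..q} \<Longrightarrow> cmod (w j) \<le> L"
proof -
  assume j: "j \<in> {1..q}"
  have "cmod (w j) \<le> (\<Sum>j=1..q. cmod (w j))" by (rule member_le_sum) (use j in auto)
  then show ?thesis by (simp add: L_def)
qed

lemma L_ge_1: "L \<ge> 1"
  unfolding L_def by (simp add: sum_nonneg)

lemma norm_w_minus_le:
  assumes j: "j \<in> {1..q}" and m: "\<bar>m - m0\<bar> \<le> 1"
  shows "cmod (w j - of_real m) \<le> L"
proof -
  have "cmod (w j - of_real m) \<le> cmod (w j) + \<bar>m\<bar>" using norm_triangle_ineq4[of "w j" "of_real m"] by simp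
  also have "cmod (w j) \<le> (\<Sum>j=1..q. cmod (w j))" by (rule member_le_sum) (use j in auto)
  finally show ?thesis using m by (simp add: L_def)
qed

lemma \<xi>_bound:
  assumes j: "j \<in> {1..q}" and m: "\<bar>m - m0\<bar> \<le> 1" and h: "h \<ge> 2 * L"
  shows "norm (((w j - of_real m) / of_real h)\<^sup>2) \<le> L\<^sup>2 / h\<^sup>2" "L\<^sup>2 / h\<^sup>2 \<le> 1/2"
proof -
  have "(cmod (w j - of_real m))\<^sup>2 \<le> L\<^sup>2" using norm_w_minus_le[OF j m] by (intro power_mono) auto
  then show "norm (((w j - of_real m) / of_real h)\<^sup>2) \<le> L\<^sup>2 / h\<^sup>2"
    by (simp add: norm_power norm_divide power_divide divide_right_mono)
  have "(2 * L)\<^sup>2 \<le> h\<^sup>2" using h L_ge_1 by (intro power_mono) auto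
  then have "4 * L\<^sup>2 \<le> h\<^sup>2" by (simp add: power_mult_distrib)
  then have "2 * L\<^sup>2 \<le> h\<^sup>2" using zero_le_power2[of L] by linarith
  moreover have "h\<^sup>2 > 0" using h L_ge_1 by simp
  ultimately show "L\<^sup>2 / h\<^sup>2 \<le> 1/2" by (simp add: field_simps)
qed

text \<open>The first-order bound suffices for \<open>eqn2\<close> and for the density. In
  \<open>eqn1\<close> the leading 1 has imaginary part zero, so there the quadratic term of \<kappa>
  is itself the main term and the remainder must be of fourth order.\<close>

lemma \<kappa>_bound:
  assumes "j \<in> {1..q}" "\<bar>m - m0\<bar> \<le> 1" "h \<ge> 2 * L"
  shows "cmod (\<kappa> m h j) \<le> 2 * L\<^sup>2 / h\<^sup>2"
    and "cmod (\<kappa> m h j - ((w j - of_real m) / of_real h)\<^sup>2 / 2) \<le> 2 * L ^ 4 / h ^ 4"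
proof -
  note b = \<xi>_bound[OF assms]
  show "cmod (\<kappa> m h j) \<le> 2 * L\<^sup>2 / h\<^sup>2"
    unfolding \<kappa>_def using csqrt_one_minus(2)[OF order.trans[OF b]] b(1) by linarith
  have "(norm (((w j - of_real m) / of_real h)\<^sup>2))\<^sup>2 \<le> (L\<^sup>2 / h\<^sup>2)\<^sup>2" using b(1) by (intro power_mono) auto
  also have "\<dots> = L ^ 4 / h ^ 4" by (simp add: power_divide flip: power_mult)
  finally show "cmod (\<kappa> m h j - ((w j - of_real m) / of_real h)\<^sup>2 / 2) \<le> 2 * L ^ 4 / h ^ 4"
    unfolding \<kappa>_def using csqrt_one_minus(1)[OF order.trans[OF b]] by linarith
qed

lemma inverse_sqrt_branch:
  assumes "j \<in> {1..q}" "h > 0"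
  shows "1 / root m h j = - \<i> * (1 + \<kappa> m h j) / of_real h"
proof -
  have "1 / (\<i> * H * c) = - \<i> * (1 / c) / H" if "H \<noteq> 0" for H c :: complex
    using that by (cases "c = 0") (simp_all add: field_simps)
  then show ?thesis
    unfolding sqrt_branch_centered[OF assms(2) w[OF assms(1)]] \<kappa>_def using assms(2) by simp
qed

lemma Re_inverse_sqrt_branch:
  assumes "j \<in> {1..q}" "h > 0"
  shows "Re (u / root m h j) = Im (u * (1 + \<kappa> m h j)) / h"
proof -
  have "u / root m h j = u * (1 / root m h j)" by simp
  also have "\<dots> = - \<i> * (u * (1 + \<kappa> m h j)) / of_real h" unfolding inverse_sqrt_branch[OF assms] by simp
  finally have e: "u / root m h j = - \<i> * (u * (1 + \<kappa> m h j)) / of_real h" .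
  have "Re (- \<i> * X / of_real h) = Im X / h" for X by (simp add: Re_divide_of_real)
  then show ?thesis unfolding e .
qed

text \<open>With $h = \eta/\delta$ the equations read $m = m_0 + o(1)$ and $\eta = M + o(1)$ as
  $\delta \to 0$, so Brouwer's theorem applies on a fixed rectangle.\<close>

lemma endpoint_equations_solvable:
  obtains H where "H \<ge> 2 * L" "\<And>\<delta>. 0 < \<delta> \<Longrightarrow> \<delta> \<le> M / (2 * H) \<Longrightarrow>
    \<exists>m h. \<bar>m - m0\<bar> \<le> 1 \<and> M / (2 * \<delta>) \<le> h \<and>
      eqn1 m h = 0 \<and>
      eqn2 m h = \<delta>"
proof -
  \<comment> \<open>The summands serve, in this order, the validity of the expansion, an error of at
    most M/2 in both equations, and h \<le> h^2.\<close>
  define H where "H = 2 * L + 4 * T * L ^ 4 / M + 1"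
  have HL: "H \<ge> 2 * L" "H \<ge> 1" "H \<ge> 4 * T * L ^ 4 / M" using L_ge_1 T_pos M_pos by (auto simp: H_def)
  \<comment> \<open>\<open>E1\<close> is h^3 times the first equation and \<open>E2\<close> is h
    times the second, so that both have nontrivial limits, M (m0 - m) and M.\<close>
  define E1 where "E1 m h = (\<Sum>j=1..q. \<gamma> j * (h\<^sup>2 * Im (1 + \<kappa> m h j)))" for m h
  define E2 where "E2 m h = (\<Sum>j=1..q. \<gamma> j * Im (w j * (1 + \<kappa> m h j)))" for m h
  have Hsq: "T * (2 * L ^ 4 / h\<^sup>2) \<le> M / 2" if "h \<ge> H" for h
  proof -
    have "4 * T * L ^ 4 / M \<le> h" using HL(3) that by linarith
    then have "4 * T * L ^ 4 \<le> M * h" using M_pos by (simp add: pos_divide_le_eq mult.commute)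
    also have "\<dots> \<le> M * h\<^sup>2" using that HL(2) M_pos by (intro mult_left_mono) (auto simp: power2_eq_square)
    finally show ?thesis using that HL(2) by (simp add: field_simps)
  qed
  have E1: "\<bar>E1 m h - M * (m0 - m)\<bar> \<le> M / 2" if m: "\<bar>m - m0\<bar> \<le> 1" and h: "h \<ge> H" for m h
  proof -
    have h0: "h > 0" "h \<ge> 2 * L" using h HL by auto
    have "M * (m0 - m) = (\<Sum>j=1..q. \<gamma> j * (Im (w j) * (Re (w j) - m)))"
    proof -
      have "M * (m0 - m) = (\<Sum>j=1..q. \<gamma> j * Im (w j) * Re (w j)) - M * m"
        using M_pos by (simp add: m0_def right_diff_distrib)
      also have "\<dots> = (\<Sum>j=1..q. \<gamma> j * (Im (w j) * (Re (w j) - m)))"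
        unfolding M_def sum_distrib_right sum_subtractf[symmetric] by (intro sum.cong) (auto simp: algebra_simps)
      finally show ?thesis .
    qed
    then have "E1 m h - M * (m0 - m) = (\<Sum>j=1..q. \<gamma> j * (h\<^sup>2 * Im (1 + \<kappa> m h j) - Im (w j) * (Re (w j) - m)))"
      unfolding E1_def by (simp add: sum_subtractf right_diff_distrib)
    also have "\<bar>\<dots>\<bar> \<le> (\<Sum>j=1..q. \<gamma> j * (2 * L ^ 4 / h\<^sup>2))"
    proof (rule order.trans[OF sum_abs sum_mono])
      fix j assume j: "j \<in> {1..q}"
      have "h\<^sup>2 * Im (1 + \<kappa> m h j) - Im (w j) * (Re (w j) - m) = h\<^sup>2 * Im (\<kappa> m h j - ((w j - of_real m) / of_real h)\<^sup>2 / 2)"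
      proof -
        have A: "Im (((w j - of_real m) / of_real h)\<^sup>2 / 2) = Im (w j) * (Re (w j) - m) / h\<^sup>2"
          by (simp add: power_divide flip: of_real_power) (simp add: power2_eq_square)
        have "H * (k - I / H) = H * k - I" if "H \<noteq> 0" for H k I :: real using that by (simp add: right_diff_distrib)
        from this[of "h\<^sup>2"] show ?thesis unfolding minus_complex.sel A using h0 by simp
      qed
      also have "\<bar>\<dots>\<bar> \<le> h\<^sup>2 * (2 * L ^ 4 / h ^ 4)"
      proof -
        have "\<bar>h\<^sup>2 * X\<bar> \<le> h\<^sup>2 * Y" if "\<bar>X\<bar> \<le> Y" for X Y using that by (simp add: abs_mult mult_left_mono)
        from this[OF order.trans[OF abs_Im_le_cmod \<kappa>_bound(2)[OF j m h0(2)]]] show ?thesis .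
      qed
      also have "\<dots> = 2 * L ^ 4 / h\<^sup>2" using h0 by (simp add: field_simps flip: power_add)
      finally show "\<bar>\<gamma> j * (h\<^sup>2 * Im (1 + \<kappa> m h j) - Im (w j) * (Re (w j) - m))\<bar> \<le> \<gamma> j * (2 * L ^ 4 / h\<^sup>2)"
        by (rule abs_mult_le[OF \<gamma>[OF j]])
    qed
    also have "\<dots> = T * (2 * L ^ 4 / h\<^sup>2)" by (simp only: T_def sum_distrib_right)
    finally show ?thesis using Hsq[OF h] by linarith
  qed
  have E2: "\<bar>E2 m h - M\<bar> \<le> M / 2" if m: "\<bar>m - m0\<bar> \<le> 1" and h: "h \<ge> H" for m h
  proof -
    have h0: "h > 0" "h \<ge> 2 * L" using h HL by auto
    have "E2 m h - M = (\<Sum>j=1..q. \<gamma> j * Im (w j * \<kappa> m h j))"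
      unfolding E2_def M_def sum_subtractf[symmetric] by (intro sum.cong) (auto simp: algebra_simps)
    also have "\<bar>\<dots>\<bar> \<le> (\<Sum>j=1..q. \<gamma> j * (2 * L ^ 4 / h\<^sup>2))"
    proof (rule order.trans[OF sum_abs sum_mono])
      fix j assume j: "j \<in> {1..q}"
      have "\<bar>Im (w j * \<kappa> m h j)\<bar> \<le> cmod (w j) * cmod (\<kappa> m h j)" by (metis abs_Im_le_cmod norm_mult)
      also have "\<dots> \<le> L * (2 * L\<^sup>2 / h\<^sup>2)" using norm_w_le[OF j] \<kappa>_bound(1)[OF j m h0(2)] L_ge_1 by (intro mult_mono) auto
      also have "\<dots> \<le> 2 * L ^ 4 / h\<^sup>2"
      proof -
        have "L ^ 3 \<le> L ^ 4" using L_ge_1 by (intro power_increasing) auto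
        then show ?thesis using h0 by (simp add: divide_right_mono power3_eq_cube power2_eq_square mult.assoc)
      qed
      finally show "\<bar>\<gamma> j * Im (w j * \<kappa> m h j)\<bar> \<le> \<gamma> j * (2 * L ^ 4 / h\<^sup>2)"
        by (rule abs_mult_le[OF \<gamma>[OF j]])
    qed
    also have "\<dots> = T * (2 * L ^ 4 / h\<^sup>2)" by (simp only: T_def sum_distrib_right)
    finally show ?thesis using Hsq[OF h] by linarith
  qed
  show thesis
  proof (rule that[OF HL(1)])
    fix \<delta> :: real assume \<delta>: "0 < \<delta>" "\<delta> \<le> M / (2 * H)"
    define S where "S = {m0 - 1..m0 + 1} \<times> {M / 2..3 * M / 2}"
    \<comment> \<open>The bound M/(2 H) on \<delta> is exactly what makes h = \<eta>/\<delta> at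
      least H on the whole rectangle.\<close>
    have hH: "\<eta> / \<delta> \<ge> H" if "\<eta> \<ge> M / 2" for \<eta>
    proof -
      have "\<delta> * H \<le> M / 2" using \<delta> HL by (simp add: field_simps)
      then have "H * \<delta> \<le> \<eta>" using that by (simp add: mult.commute)
      then show ?thesis using \<delta> by (simp add: le_divide_eq)
    qed
    \<comment> \<open>A fixed point satisfies \<open>E1 = 0\<close> and
      \<open>E2 = \<eta> = h * \<delta>\<close>, the two equations. The increment
      \<open>E1 / M\<close> is close to m0 - m, so the first component stays near m0 whatever m is;
      the second stays near M.\<close>
    define f where "f p = (fst p + E1 (fst p) (snd p / \<delta>) / M, E2 (fst p) (snd p / \<delta>))" for p
    have "continuous_on S f"
    proof -
      have c\<kappa>: "continuous_on S (\<lambda>p. \<kappa> (fst p) (snd p / \<delta>) j)" if j: "j \<in> {1..q}" for j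
      proof -
        have nz: "snd p / \<delta> \<noteq> 0" "1 - ((w j - of_real (fst p)) / of_real (snd p / \<delta>))\<^sup>2 \<notin> \<real>\<^sub>\<le>\<^sub>0" if p: "p \<in> S" for p
        proof -
          have m: "\<bar>fst p - m0\<bar> \<le> 1" and h: "snd p / \<delta> \<ge> H" using p hH by (auto simp: S_def abs_le_iff)
          then have h0: "snd p / \<delta> \<ge> 2 * L" "snd p / \<delta> > 0" using HL by linarith+
          then show "snd p / \<delta> \<noteq> 0" by linarith
          let ?\<xi> = "((w j - of_real (fst p)) / of_real (snd p / \<delta>))\<^sup>2"
          have "norm ?\<xi> \<le> 1/2" using \<xi>_bound[OF j m h0(1)] by linarith
          then have "Re (1 - ?\<xi>) > 0" using complex_Re_le_cmod[of ?\<xi>] by simp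
          then show "1 - ?\<xi> \<notin> \<real>\<^sub>\<le>\<^sub>0" unfolding complex_nonpos_Reals_iff by linarith
        qed
        then have nz': "csqrt (1 - ((w j - of_real (fst p)) / of_real (snd p / \<delta>))\<^sup>2) \<noteq> 0" if "p \<in> S" for p
          using that by fastforce
        have d: "continuous_on S (\<lambda>p. snd p / \<delta>)" using \<delta> by (intro continuous_intros) auto
        have "continuous_on S (\<lambda>p. 1 - ((w j - of_real (fst p)) / of_real (snd p / \<delta>))\<^sup>2)"
          using nz(1) by (intro continuous_intros d) (auto simp del: of_real_divide)
        then have "continuous_on S (\<lambda>p. csqrt (1 - ((w j - of_real (fst p)) / of_real (snd p / \<delta>))\<^sup>2))"
          using nz(2) by (intro continuous_on_compose2[OF continuous_on_csqrt]) auto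
        then show ?thesis unfolding \<kappa>_def using nz' by (intro continuous_intros) auto
      qed
      show ?thesis unfolding f_def E1_def E2_def
        using \<delta> M_pos by (intro continuous_intros c\<kappa>) auto
    qed
    moreover have "f \<in> S \<rightarrow> S"
    proof
      fix p assume p: "p \<in> S"
      have m: "\<bar>fst p - m0\<bar> \<le> 1" and h: "snd p / \<delta> \<ge> H" using p hH by (auto simp: S_def abs_le_iff)
      have e1: "fst p + E1 (fst p) (snd p / \<delta>) / M - m0 = (E1 (fst p) (snd p / \<delta>) - M * (m0 - fst p)) / M"
        using M_pos by (simp add: field_simps)
      have e2: "\<bar>e / M\<bar> \<le> 1" if "\<bar>e\<bar> \<le> M / 2" for e
        using that M_pos by (simp add: abs_divide pos_divide_le_eq)
      have "\<bar>fst p + E1 (fst p) (snd p / \<delta>) / M - m0\<bar> \<le> 1" unfolding e1 by (rule e2[OF E1[OF m h]])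
      moreover have "M / 2 \<le> E2 (fst p) (snd p / \<delta>)" "E2 (fst p) (snd p / \<delta>) \<le> 3 * M / 2"
        using E2[OF m h] unfolding abs_le_iff by linarith+
      ultimately show "f p \<in> S" by (auto simp: f_def S_def abs_le_iff)
    qed
    moreover have "compact S" "convex S" "S \<noteq> {}"
      unfolding S_def using M_pos by (auto intro!: compact_Times convex_Times)
    ultimately obtain p where p: "p \<in> S" "f p = p" using brouwer by metis
    define m h where "m = fst p" and "h = snd p / \<delta>"
    have m: "\<bar>m - m0\<bar> \<le> 1" and h: "h \<ge> H" using p hH by (auto simp: S_def abs_le_iff m_def h_def)
    have h0: "h > 0" using h HL by auto
    have fp: "E1 m h = 0" "E2 m h = h * \<delta>"
      using p(2) M_pos \<delta> unfolding f_def m_def h_def by (auto simp: prod_eq_iff)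
    have "eqn1 m h = (\<Sum>j=1..q. \<gamma> j * (h\<^sup>2 * Im (1 + \<kappa> m h j))) / (h\<^sup>2 * h)"
      unfolding sum_divide_distrib using h0 by (intro sum.cong) (simp_all add: Re_inverse_sqrt_branch del: plus_complex.sel)
    then have 1: "eqn1 m h = 0"
      using fp(1) by (simp add: E1_def)
    have "eqn2 m h = E2 m h / h"
      unfolding E2_def sum_divide_distrib using h0 by (intro sum.cong) (simp_all add: Re_inverse_sqrt_branch del: times_complex.sel)
    then have 2: "eqn2 m h = \<delta>"
      using fp(2) h0 by simp
    have "M / (2 * \<delta>) \<le> h"
      using p(1) \<delta> by (auto simp: S_def h_def field_simps)
    then show "\<exists>m h. \<bar>m - m0\<bar> \<le> 1 \<and> M / (2 * \<delta>) \<le> h \<and>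
      eqn1 m h = 0 \<and>
      eqn2 m h = \<delta>"
      using m 1 2 by blast
  qed
qed

section \<open>Comparison with the limit density\<close>

lemma Im_inverse_diff: "Im (1 / (of_real x - w j)) = Im (w j) / ((x - Re (w j))\<^sup>2 + (Im (w j))\<^sup>2)"
  by (simp add: Im_divide)

lemma Im_w_ge: obtains v where "v > 0" "\<And>j. j \<in> {1..q} \<Longrightarrow> v \<le> Im (w j)"
proof
  show "Min ((\<lambda>j. Im (w j)) ` {1..q}) > 0" using q w by (subst Min_gr_iff) auto
  show "Min ((\<lambda>j. Im (w j)) ` {1..q}) \<le> Im (w j)" if "j \<in> {1..q}" for j using that by (intro Min_le) auto
qed

text \<open>|x - w_j|^2 \<le> 2 L^2 (x^2 + 1) in each summand. An absolute error of order 1/(x^2 +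
  1) thereby becomes an error relative to \<open>P x\<close>.\<close>

lemma P_lower: "M / (2 * L\<^sup>2 * (x\<^sup>2 + 1)) \<le> P x"
proof -
  have "M / (2 * L\<^sup>2 * (x\<^sup>2 + 1)) = (\<Sum>j=1..q. \<gamma> j * Im (w j) / (2 * L\<^sup>2 * (x\<^sup>2 + 1)))"
    by (simp add: M_def sum_divide_distrib)
  also have "\<dots> \<le> P x"
    unfolding P_def
  proof (rule sum_mono)
    fix j assume j: "j \<in> {1..q}"
    have pos: "0 < (x - Re (w j))\<^sup>2 + (Im (w j))\<^sup>2" using w[OF j] by (simp add: add_nonneg_pos)
    have "(cmod (w j))\<^sup>2 \<le> L\<^sup>2" using norm_w_le[OF j] by (intro power_mono) auto
    then have 1: "(Re (w j))\<^sup>2 + (Im (w j))\<^sup>2 \<le> L\<^sup>2" by (simp add: cmod_power2)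
    have 2: "(x - Re (w j))\<^sup>2 \<le> 2 * x\<^sup>2 + 2 * (Re (w j))\<^sup>2"
      using zero_le_power2[of "x + Re (w j)"] by (simp add: power2_eq_square algebra_simps)
    have 3: "1 * x\<^sup>2 \<le> L\<^sup>2 * x\<^sup>2" using L_ge_1 by (intro mult_right_mono) (simp_all add: one_le_power)
    have "(x - Re (w j))\<^sup>2 + (Im (w j))\<^sup>2 \<le> 2 * L\<^sup>2 * (x\<^sup>2 + 1)"
    proof -
      have "2 * L\<^sup>2 * (x\<^sup>2 + 1) = 2 * (L\<^sup>2 * x\<^sup>2) + 2 * L\<^sup>2" by (simp add: algebra_simps)
      then show ?thesis using 1 2 3 zero_le_power2[of "Im (w j)"] by linarith
    qed
    then show "\<gamma> j * Im (w j) / (2 * L\<^sup>2 * (x\<^sup>2 + 1)) \<le> \<gamma> j * Im (w j) / ((x - Re (w j))\<^sup>2 + (Im (w j))\<^sup>2)"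
      using pos \<gamma>[OF j] w[OF j] by (intro divide_left_mono) (auto intro!: mult_pos_pos add_nonneg_pos)
  qed
  finally show ?thesis .
qed

lemma P_pos: "P x > 0"
  by (rule less_le_trans[OF _ P_lower]) (use M_pos L_ge_1 in \<open>auto intro!: divide_pos_pos mult_pos_pos add_nonneg_pos\<close>)

text \<open>Subtracting the multiple $x/(x^2+1)$ of the first endpoint equation makes the error term
  $O(1/x^2)$, so that it is controlled by the limit density even far outside the interval.\<close>

lemma density_estimate:
  obtains K where "K > 0" "\<And>m h x. \<bar>m - m0\<bar> \<le> 1 \<Longrightarrow> h \<ge> 2 * L \<Longrightarrow>
    eqn1 m h = 0 \<Longrightarrow>
    \<bar>h * (\<Sum>j=1..q. \<gamma> j * Re (1 / (root m h j * (of_real x - w j)))) - P x\<bar> \<le> K / h\<^sup>2 * P x"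
proof -
  obtain v where v: "v > 0" "\<And>j. j \<in> {1..q} \<Longrightarrow> v \<le> Im (w j)" using Im_w_ge by blast
  \<comment> \<open>Chosen so that |1 + x w_j| \<le> C |x - w_j|: from |x| \<le> |x - w_j| + L the
    left side is at most L |x - w_j| + 1 + L^2, and the constant is absorbed by |x - w_j| \<ge>
    v.\<close>
  define C where "C = L + (1 + L\<^sup>2) / v"
  have C: "C > 0" using L_ge_1 v by (auto simp: C_def intro!: add_pos_pos divide_pos_pos)
  \<comment> \<open>The factors are the total weight, the bound on \<kappa> without 1/h^2, the
    constant \<open>C\<close>, and the inverse of the constant in \<open>P_lower\<close>.\<close>
  define K where "K = T * (2 * L\<^sup>2) * C * (2 * L\<^sup>2 / M)"
  have K: "K > 0" using T_pos M_pos L_ge_1 C by (simp add: K_def)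
  show thesis
  proof (rule that[OF K])
    fix m h x :: real assume m: "\<bar>m - m0\<bar> \<le> 1" and h: "h \<ge> 2 * L"
      and eq: "eqn1 m h = 0"
    have h0: "h > 0" using h L_ge_1 by simp
    define e where "e = x / (x\<^sup>2 + 1)"
    have x1: "x\<^sup>2 + 1 > 0" by (simp add: add_nonneg_pos)
    have "(\<Sum>j=1..q. \<gamma> j * Im (1 + \<kappa> m h j)) / h = 0"
      unfolding eq[symmetric] sum_divide_distrib using h0 by (intro sum.cong) (simp_all add: Re_inverse_sqrt_branch del: plus_complex.sel)
    then have eq': "(\<Sum>j=1..q. \<gamma> j * Im (1 + \<kappa> m h j)) = 0" using h0 by simp
    have "h * (\<Sum>j=1..q. \<gamma> j * Re (1 / (root m h j * (of_real x - w j)))) - P x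
      = (\<Sum>j=1..q. \<gamma> j * Im (1 / (of_real x - w j) * (1 + \<kappa> m h j))) - e * (\<Sum>j=1..q. \<gamma> j * Im (1 + \<kappa> m h j)) - P x"
    proof -
      have "h * (\<gamma> j * Re (1 / (root m h j * (of_real x - w j)))) = \<gamma> j * Im (1 / (of_real x - w j) * (1 + \<kappa> m h j))"
        if j: "j \<in> {1..q}" for j
      proof -
        have "1 / (root m h j * (of_real x - w j)) = (1 / (of_real x - w j)) / root m h j" by simp
        then have "Re (1 / (root m h j * (of_real x - w j))) = Im (1 / (of_real x - w j) * (1 + \<kappa> m h j)) / h"
          by (simp only: Re_inverse_sqrt_branch[OF j h0])
        then show ?thesis using h0 by simp
      qed
      then have "h * (\<Sum>j=1..q. \<gamma> j * Re (1 / (root m h j * (of_real x - w j))))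
          = (\<Sum>j=1..q. \<gamma> j * Im (1 / (of_real x - w j) * (1 + \<kappa> m h j)))"
        unfolding sum_distrib_left by (rule sum.cong[OF refl])
      then show ?thesis unfolding eq' by simp
    qed
    also have "\<dots> = (\<Sum>j=1..q. \<gamma> j * Im (\<kappa> m h j * (1 / (of_real x - w j) - of_real e)))"
      unfolding P_def sum_distrib_left sum_subtractf[symmetric]
    proof (rule sum.cong[OF refl])
      fix j
      have "\<gamma> j * Im (A * (1 + k)) - e * (\<gamma> j * Im (1 + k)) - \<gamma> j * Im A = \<gamma> j * Im (k * (A - of_real e))" for A k
        by (simp add: algebra_simps)
      from this[of "1 / (of_real x - w j)" "\<kappa> m h j"]
      show "\<gamma> j * Im (1 / (of_real x - w j) * (1 + \<kappa> m h j)) - e * (\<gamma> j * Im (1 + \<kappa> m h j)) - \<gamma> j * Im (w j) / ((x - Re (w j))\<^sup>2 + (Im (w j))\<^sup>2)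
        = \<gamma> j * Im (\<kappa> m h j * (1 / (of_real x - w j) - of_real e))"
        unfolding Im_inverse_diff by simp
    qed
    also have "\<bar>\<dots>\<bar> \<le> (\<Sum>j=1..q. \<gamma> j * (2 * L\<^sup>2 / h\<^sup>2 * (C / (x\<^sup>2 + 1))))"
    proof (rule order.trans[OF sum_abs sum_mono])
      fix j assume j: "j \<in> {1..q}"
      have dv: "cmod (of_real x - w j) \<ge> v" using abs_Im_le_cmod[of "of_real x - w j"] v(2)[OF j] v(1) by simp
      have nz: "of_real x - w j \<noteq> 0" using dv v by auto
      have "1 / (of_real x - w j) - of_real e = (1 + of_real x * w j) / ((of_real x - w j) * of_real (x\<^sup>2 + 1))"
      proof -
        have "1 / d - X / (X\<^sup>2 + 1) = (1 + X * W) / (d * (X\<^sup>2 + 1))" if "d = X - W" "d \<noteq> 0" "X\<^sup>2 + 1 \<noteq> 0" for d X W :: complex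
        proof -
          have "1 / d - X / (X\<^sup>2 + 1) = (1 * (X\<^sup>2 + 1) - X * d) / (d * (X\<^sup>2 + 1))" by (rule diff_frac_eq[OF that(2,3)])
          also have "1 * (X\<^sup>2 + 1) - X * d = 1 + X * W" unfolding that(1) by (simp add: algebra_simps power2_eq_square)
          finally show ?thesis .
        qed
        from this[OF refl nz] x1 show ?thesis
          by (simp add: e_def) (metis less_irrefl of_real_1 of_real_add of_real_eq_0_iff of_real_power)
      qed
      then have "cmod (1 / (of_real x - w j) - of_real e) = cmod (1 + of_real x * w j) / (cmod (of_real x - w j) * (x\<^sup>2 + 1))"
        using x1 by (simp only: norm_divide norm_mult norm_of_real abs_of_pos)
      also have "\<dots> \<le> (C * cmod (of_real x - w j)) / (cmod (of_real x - w j) * (x\<^sup>2 + 1))"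
      proof (rule divide_right_mono)
        have "\<bar>x\<bar> \<le> cmod (of_real x - w j) + cmod (w j)" using norm_triangle_ineq[of "of_real x - w j" "w j"] by simp
        then have "\<bar>x\<bar> \<le> cmod (of_real x - w j) + L" using norm_w_le[OF j] by simp
        then have "\<bar>x\<bar> * cmod (w j) \<le> (cmod (of_real x - w j) + L) * L" using norm_w_le[OF j] L_ge_1 by (intro mult_mono) auto
        moreover have "cmod (1 + of_real x * w j) \<le> 1 + \<bar>x\<bar> * cmod (w j)" using norm_triangle_ineq[of 1 "of_real x * w j"] by (simp add: norm_mult)
        moreover have "1 + L\<^sup>2 \<le> (1 + L\<^sup>2) / v * cmod (of_real x - w j)"
          using mult_left_mono[OF dv, of "(1 + L\<^sup>2) / v"] v(1) by simp
        ultimately show "cmod (1 + of_real x * w j) \<le> C * cmod (of_real x - w j)"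
          by (simp add: C_def algebra_simps power2_eq_square)
      qed (use x1 in auto)
      also have "\<dots> = C / (x\<^sup>2 + 1)" using nz by simp
      finally have "cmod (1 / (of_real x - w j) - of_real e) \<le> C / (x\<^sup>2 + 1)" .
      then have "cmod (\<kappa> m h j) * cmod (1 / (of_real x - w j) - of_real e) \<le> 2 * L\<^sup>2 / h\<^sup>2 * (C / (x\<^sup>2 + 1))"
        using \<kappa>_bound(1)[OF j m h] by (intro mult_mono) auto
      then have "\<bar>Im (\<kappa> m h j * (1 / (of_real x - w j) - of_real e))\<bar> \<le> 2 * L\<^sup>2 / h\<^sup>2 * (C / (x\<^sup>2 + 1))"
        using abs_Im_le_cmod[of "\<kappa> m h j * (1 / (of_real x - w j) - of_real e)"] unfolding norm_mult by linarith
      then show "\<bar>\<gamma> j * Im (\<kappa> m h j * (1 / (of_real x - w j) - of_real e))\<bar> \<le> \<gamma> j * (2 * L\<^sup>2 / h\<^sup>2 * (C / (x\<^sup>2 + 1)))"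
        by (rule abs_mult_le[OF \<gamma>[OF j]])
    qed
    also have "\<dots> = T * (2 * L\<^sup>2 / h\<^sup>2 * (C / (x\<^sup>2 + 1)))" by (simp only: T_def sum_distrib_right)
    also have "\<dots> = K / h\<^sup>2 * (M / (2 * L\<^sup>2 * (x\<^sup>2 + 1)))"
    proof -
      have gen: "T * (A / H * (C / Y)) = T * A * C * (A / M) / H * (M / (A * Y))" if "A \<noteq> 0" "M \<noteq> 0" for A H Y M :: real
        using that by simp
      show ?thesis unfolding K_def by (rule gen) (use M_pos L_ge_1 in auto)
    qed
    also have "\<dots> \<le> K / h\<^sup>2 * P x"
      using P_lower[of x] K by (intro mult_left_mono) auto
    finally show "\<bar>h * (\<Sum>j=1..q. \<gamma> j * Re (1 / (root m h j * (of_real x - w j)))) - P x\<bar> \<le> K / h\<^sup>2 * P x" .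
  qed
qed

lemma P_measurable[measurable]: "P \<in> borel_measurable borel"
  unfolding P_def[abs_def] by measurable

lemma integrable_P: "integrable lborel P"
proof -
  obtain v where v: "v > 0" "\<And>j. j \<in> {1..q} \<Longrightarrow> v \<le> Im (w j)" using Im_w_ge by blast
  \<comment> \<open>From 1 + x^2 \<le> 2 D + (2 L^2 + 1), with the constant absorbed by D \<ge> v^2;
    this compares each Poisson kernel with 1/(1 + x^2).\<close>
  define C where "C = 2 + (2 * L\<^sup>2 + 1) / v\<^sup>2"
  have le: "P x \<le> M * C * inverse (1 + x\<^sup>2)" for x
  proof -
    have "P x \<le> (\<Sum>j=1..q. \<gamma> j * Im (w j) * (C * inverse (1 + x\<^sup>2)))"
      unfolding P_def
    proof (rule sum_mono)
      fix j assume j: "j \<in> {1..q}"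
      define D where "D = (x - Re (w j))\<^sup>2 + (Im (w j))\<^sup>2"
      have "v\<^sup>2 \<le> (Im (w j))\<^sup>2" using v j by (intro power_mono) auto
      then have D: "D \<ge> v\<^sup>2" "v\<^sup>2 > 0"
        unfolding D_def using v(1) zero_le_power2[of "x - Re (w j)"] by (linarith, simp)
      have "(cmod (w j))\<^sup>2 \<le> L\<^sup>2" using norm_w_le[OF j] by (intro power_mono) auto
      then have "(Re (w j))\<^sup>2 + (Im (w j))\<^sup>2 \<le> L\<^sup>2" by (simp add: cmod_power2)
      moreover have "x\<^sup>2 \<le> 2 * (x - Re (w j))\<^sup>2 + 2 * (Re (w j))\<^sup>2"
        using zero_le_power2[of "x - 2 * Re (w j)"] by (simp add: power2_eq_square algebra_simps)
      moreover have "1 + X \<le> 2 * (U + I) + (2 * Q + 1)" if "R + I \<le> Q" "X \<le> 2 * U + 2 * R" "0 \<le> I" for X U I R Q :: real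
        using that by simp
      ultimately have "1 + x\<^sup>2 \<le> 2 * D + (2 * L\<^sup>2 + 1)" unfolding D_def using zero_le_power2 by blast
      also have "2 * L\<^sup>2 + 1 \<le> (2 * L\<^sup>2 + 1) / v\<^sup>2 * D"
        using mult_left_mono[OF D(1), of "(2 * L\<^sup>2 + 1) / v\<^sup>2"] D(2) by simp
      finally have "1 + x\<^sup>2 \<le> C * D" by (simp add: C_def distrib_right)
      then have "1 / D \<le> C * inverse (1 + x\<^sup>2)"
      proof -
        have "0 < 1 + x\<^sup>2" by (simp add: add_pos_nonneg)
        moreover have "0 < D" using D by linarith
        ultimately show ?thesis using \<open>1 + x\<^sup>2 \<le> C * D\<close>
          unfolding inverse_eq_divide by (simp only: times_divide_eq_right pos_le_divide_eq times_divide_eq_left pos_divide_le_eq mult_1 mult_1_right)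
      qed
      then have "\<gamma> j * Im (w j) * (1 / D) \<le> \<gamma> j * Im (w j) * (C * inverse (1 + x\<^sup>2))"
        using \<gamma>[OF j] w[OF j] by (intro mult_left_mono) auto
      then show "\<gamma> j * Im (w j) / ((x - Re (w j))\<^sup>2 + (Im (w j))\<^sup>2) \<le> \<gamma> j * Im (w j) * (C * inverse (1 + x\<^sup>2))"
        by (simp add: D_def)
    qed
    then show ?thesis by (simp add: M_def sum_distrib_right mult.assoc)
  qed
  have "integrable lborel (\<lambda>x::real. inverse (1 + x\<^sup>2))"
    using integrable_inverse_1_plus_square by (simp add: set_integrable_def)
  then have "integrable lborel (\<lambda>x. M * C * inverse (1 + x\<^sup>2))" by (rule integrable_mult_right)
  then show ?thesis
    by (rule Bochner_Integration.integrable_bound) (auto intro!: AE_I2 order.trans[OF _ abs_ge_self] simp: abs_of_pos[OF P_pos] le)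
qed

end

section \<open>Zeros of polynomials and the polynomial $B$\<close>

lemma degree_0_monic: "degree p = 0 \<Longrightarrow> lead_coeff p = 1 \<Longrightarrow> p = 1"
  by (elim degree_eq_zeroE) simp

text \<open>A monic polynomial is the product of the differences to its roots, each at least \<eta>
  in modulus. It is used with \<eta> the distance to the nearest root, which a small value of the
  polynomial forces to be small.\<close>

lemma norm_poly_ge_power:
  fixes p :: "complex poly"
  assumes "lead_coeff p = 1" "\<And>b. poly p b = 0 \<Longrightarrow> \<eta> \<le> cmod (\<zeta> - b)" "\<eta> \<ge> 0"
  shows "\<eta> ^ degree p \<le> cmod (poly p \<zeta>)"
  using assms
proof (induction "degree p" arbitrary: p)
  case 0
  then have "p = 1" by (auto intro: degree_0_monic)
  then show ?case by simp
next
  case (Suc n)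
  then have "\<not> constant (poly p)" by (simp add: constant_degree)
  then obtain b where b: "poly p b = 0" using fundamental_theorem_of_algebra by blast
  then obtain s where s: "p = [:- b, 1:] * s" by (metis dvdE poly_eq_0_iff_dvd)
  have s0: "s \<noteq> 0" using s Suc.prems(1) by auto
  have ls: "lead_coeff s = 1" using Suc.prems(1) unfolding s lead_coeff_mult by simp
  have ds: "degree p = Suc (degree s)" unfolding s using s0 by (subst degree_mult_eq) auto
  have "\<eta> ^ degree s \<le> cmod (poly s \<zeta>)"
    by (rule Suc.hyps(1)) (use Suc ds ls s in auto)
  moreover have "\<eta> \<le> cmod (\<zeta> - b)" using Suc.prems(2) b by blast
  ultimately have "\<eta> * \<eta> ^ degree s \<le> cmod (\<zeta> - b) * cmod (poly s \<zeta>)"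
    using Suc.prems(3) by (intro mult_mono) auto
  moreover have "poly p \<zeta> = (\<zeta> - b) * poly s \<zeta>" unfolding s by (simp add: algebra_simps)
  ultimately show ?case unfolding ds by (simp only: norm_mult power_Suc)
qed

text \<open>Induction on the degree: a root \<zeta> of the limit is matched with the nearest root of
  \<open>p t\<close>, which converges to \<zeta> because \<open>poly (p t) \<zeta>\<close> tends to
  0. Dividing both linear factors out preserves convergence of coefficients. Matching one root at a
  time keeps track of multiplicities.\<close>

lemma proots_tendsto:
  fixes p :: "'b \<Rightarrow> complex poly"
  assumes "\<forall>\<^sub>F t in F. lead_coeff (p t) = 1 \<and> degree (p t) = n" and "lead_coeff P = 1" "degree P = n"
    and "\<And>k. ((\<lambda>t. coeff (p t) k) \<longlongrightarrow> coeff P k) F" and \<epsilon>: "\<epsilon> > 0"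
  shows "\<forall>\<^sub>F t in F. rel_mset (\<lambda>b \<zeta>. dist b \<zeta> < \<epsilon>) (proots (p t)) (proots P)"
  using assms(1-4)
proof (induction n arbitrary: p P)
  case 0
  have "P = 1" using 0 by (auto intro: degree_0_monic)
  show ?case
    using 0(1)
  proof (rule eventually_mono)
    fix t assume "lead_coeff (p t) = 1 \<and> degree (p t) = 0"
    then have "p t = 1" by (auto intro: degree_0_monic)
    then show "rel_mset (\<lambda>b \<zeta>. dist b \<zeta> < \<epsilon>) (proots (p t)) (proots P)"
      using \<open>P = 1\<close> by (simp add: rel_mset_Zero)
  qed
next
  case (Suc n)
  have "\<not> constant (poly P)" using Suc.prems by (simp add: constant_degree)
  then obtain \<zeta> where \<zeta>: "poly P \<zeta> = 0" using fundamental_theorem_of_algebra by blast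
  then obtain P1 where P1: "P = [:- \<zeta>, 1:] * P1" by (metis dvdE poly_eq_0_iff_dvd)
  \<comment> \<open>The nearest root is chosen separately for each t; no continuity of the choice is
    required, only its distance to \<zeta>.\<close>
  define b where "b t = arg_min_on (\<lambda>b. cmod (\<zeta> - b)) {b. poly (p t) b = 0}" for t
  define Q where "Q t = synthetic_div (p t) (b t)" for t
  have factor: "lead_coeff s = 1 \<and> degree s = n" if "r = [:- c, 1:] * s" "lead_coeff r = 1" "degree r = Suc n" for r s :: "complex poly" and c
  proof -
    have "s \<noteq> 0" using that by auto
    then have "degree r = Suc (degree s)" unfolding that(1) by (subst degree_mult_eq) auto
    moreover have "lead_coeff s = 1" using that(2) unfolding that(1) lead_coeff_mult by simp
    ultimately show ?thesis using that(3) by simp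
  qed
  have good: "poly (p t) (b t) = 0 \<and> p t = [:- b t, 1:] * Q t \<and> lead_coeff (Q t) = 1 \<and> degree (Q t) = n
      \<and> cmod (\<zeta> - b t) ^ Suc n \<le> cmod (poly (p t) \<zeta>)"
    if t: "lead_coeff (p t) = 1 \<and> degree (p t) = Suc n" for t
  proof -
    have p0: "p t \<noteq> 0" using t by auto
    have "\<not> constant (poly (p t))" using t by (simp add: constant_degree)
    then have ne: "{b. poly (p t) b = 0} \<noteq> {}" using fundamental_theorem_of_algebra by blast
    have fin: "finite {b. poly (p t) b = 0}" using p0 by (rule poly_roots_finite)
    have root: "poly (p t) (b t) = 0" using arg_min_if_finite(1)[OF fin ne] by (simp add: b_def)
    have "cmod (\<zeta> - b t) \<le> cmod (\<zeta> - c)" if "poly (p t) c = 0" for c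
      unfolding b_def by (rule arg_min_least[OF fin ne]) (use that in simp)
    then have 1: "cmod (\<zeta> - b t) ^ degree (p t) \<le> cmod (poly (p t) \<zeta>)"
      using t by (intro norm_poly_ge_power) auto
    have 2: "p t = [:- b t, 1:] * Q t"
      using synthetic_div_correct'[of "b t" "p t"] root by (simp add: Q_def)
    have 3: "lead_coeff (Q t) = 1 \<and> degree (Q t) = n"
      by (rule factor[OF 2]) (use t in auto)
    show ?thesis using root 1 2 3 conjunct2[OF t] by metis
  qed
  have "((\<lambda>t. \<Sum>k\<le>Suc n. coeff (p t) k * \<zeta> ^ k) \<longlongrightarrow> (\<Sum>k\<le>Suc n. coeff P k * \<zeta> ^ k)) F"
    by (intro tendsto_intros Suc.prems)
  also have "(\<Sum>k\<le>Suc n. coeff P k * \<zeta> ^ k) = 0" using \<zeta> Suc.prems(3) by (simp add: poly_altdef)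
  finally have "((\<lambda>t. poly (p t) \<zeta>) \<longlongrightarrow> 0) F"
    by (rule Lim_transform_eventually) (use Suc.prems(1) in \<open>auto elim!: eventually_mono simp: poly_altdef\<close>)
  then have small: "\<forall>\<^sub>F t in F. cmod (poly (p t) \<zeta>) < e" if "e > 0" for e
    using that by (auto simp: tendsto_iff)
  have b: "(b \<longlongrightarrow> \<zeta>) F"
    unfolding tendsto_iff
  proof (intro allI impI)
    fix e :: real assume e: "e > 0"
    have "\<forall>\<^sub>F t in F. cmod (poly (p t) \<zeta>) < e ^ Suc n" using e by (intro small) simp
    then show "\<forall>\<^sub>F t in F. dist (b t) \<zeta> < e"
      using Suc.prems(1)
    proof eventually_elim
      case (elim t)
      then have "cmod (\<zeta> - b t) ^ Suc n < e ^ Suc n" using good[of t] by linarith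
      then have "cmod (\<zeta> - b t) < e" using e by (meson less_imp_le power_less_imp_less_base)
      then show ?case by (simp add: dist_norm norm_minus_commute)
    qed
  qed
  have rec: "coeff ([:- c, 1:] * s) (Suc k) = coeff s k - c * coeff s (Suc k)" for c k and s :: "complex poly"
    by simp
  have P1n: "lead_coeff P1 = 1 \<and> degree P1 = n" using factor P1 Suc.prems by blast
  have high: "((\<lambda>t. coeff (Q t) k) \<longlongrightarrow> coeff P1 k) F" if "k > n" for k
  proof -
    have c: "coeff P1 k = 0" using P1n that by (simp add: coeff_eq_0)
    have e: "\<forall>\<^sub>F t in F. 0 = coeff (Q t) k"
      using Suc.prems(1)
    proof (rule eventually_mono)
      fix t assume "lead_coeff (p t) = 1 \<and> degree (p t) = Suc n"
      from good[OF this] have "degree (Q t) = n" by blast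
      then show "0 = coeff (Q t) k" using that by (simp add: coeff_eq_0)
    qed
    show ?thesis unfolding c by (rule Lim_transform_eventually[OF tendsto_const e])
  qed
  \<comment> \<open>Synthetic division expresses a quotient coefficient through the next higher one,
    so convergence descends from the coefficients above n, which vanish.\<close>
  have coeffs: "((\<lambda>t. coeff (Q t) k) \<longlongrightarrow> coeff P1 k) F" for k
  proof (cases "k > n")
    case False
    then have "k \<le> Suc n" by simp
    then show ?thesis
    proof (induction rule: inc_induct)
      case base
      show ?case by (rule high) simp
    next
      case (step k)
      have "((\<lambda>t. coeff (p t) (Suc k) + b t * coeff (Q t) (Suc k)) \<longlongrightarrow> coeff P (Suc k) + \<zeta> * coeff P1 (Suc k)) F"
        by (intro tendsto_intros Suc.prems b step)
      also have "coeff P (Suc k) + \<zeta> * coeff P1 (Suc k) = coeff P1 k" unfolding P1 rec by simp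
      finally show ?case
      proof (rule Lim_transform_eventually)
        show "\<forall>\<^sub>F t in F. coeff (p t) (Suc k) + b t * coeff (Q t) (Suc k) = coeff (Q t) k"
          using Suc.prems(1)
        proof (rule eventually_mono)
          fix t assume t: "lead_coeff (p t) = 1 \<and> degree (p t) = Suc n"
          have "coeff (p t) (Suc k) = coeff (Q t) k - b t * coeff (Q t) (Suc k)"
            using good[OF t] rec by metis
          then show "coeff (p t) (Suc k) + b t * coeff (Q t) (Suc k) = coeff (Q t) k" by simp
        qed
      qed
    qed
  qed (rule high)
  have "\<forall>\<^sub>F t in F. rel_mset (\<lambda>b \<zeta>. dist b \<zeta> < \<epsilon>) (proots (Q t)) (proots P1)"
  proof (rule Suc.IH)
    show "\<forall>\<^sub>F t in F. lead_coeff (Q t) = 1 \<and> degree (Q t) = n"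
      using Suc.prems(1) by (rule eventually_mono) (use good in blast)
  qed (use P1n coeffs in blast)+
  moreover have "\<forall>\<^sub>F t in F. dist (b t) \<zeta> < \<epsilon>" using b \<epsilon> by (auto simp: tendsto_iff)
  ultimately show ?case
    using Suc.prems(1)
  proof eventually_elim
    case (elim t)
    have pr: "proots ([:- c, 1:] * s) = add_mset c (proots s)" if "s \<noteq> 0" for c and s :: "complex poly"
      using that by (subst proots_mult) auto
    have "Q t \<noteq> 0" "P1 \<noteq> 0" using good[OF elim(3)] P1n by auto
    then have "proots (p t) = add_mset (b t) (proots (Q t))" "proots P = add_mset \<zeta> (proots P1)"
      using good[OF elim(3)] P1 pr by metis+
    then show ?case using rel_mset_Plus[of "\<lambda>b \<zeta>. dist b \<zeta> < \<epsilon>", OF elim(2,1)] by simp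
  qed
qed

section \<open>Numerators over the common denominator \<open>D_poly\<close>\<close>

definition D_omit :: "nat \<Rightarrow> (nat \<Rightarrow> complex) \<Rightarrow> nat \<Rightarrow> complex poly" where
  "D_omit q w j = (\<Prod>i\<in>{1..q} - {j}. [:- w i, 1:] * [:- cnj (w i), 1:])"

lemma D_poly_eq_omit: "j \<in> {1..q} \<Longrightarrow> D_poly q w = [:- w j, 1:] * [:- cnj (w j), 1:] * D_omit q w j"
  unfolding D_poly_def D_omit_def by (subst prod.remove[of "{1..q}" j]) (simp_all only: finite_atLeastAtMost)

lemma poly_D_poly: "poly (D_poly q w) z = (\<Prod>i=1..q. (z - w i) * (z - cnj (w i)))"
  unfolding D_poly_def poly_prod by (intro prod.cong) (auto simp: algebra_simps)

lemma D_poly_0_iff: "poly (D_poly q w) z = 0 \<longleftrightarrow> (\<exists>j\<in>{1..q}. z = w j \<or> z = cnj (w j))"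
  unfolding poly_D_poly by auto

lemma lead_coeff_D_omit: "lead_coeff (D_omit q w j) = 1"
  unfolding D_omit_def by (simp add: lead_coeff_prod lead_coeff_mult del: mult_pCons_left)

lemma degree_D_omit: "j \<in> {1..q} \<Longrightarrow> degree (D_omit q w j) = 2 * q - 2"
proof -
  assume j: "j \<in> {1..q}"
  have "degree (D_omit q w j) = (\<Sum>i\<in>{1..q} - {j}. degree ([:- w i, 1:] * [:- cnj (w i), 1:]))"
    unfolding D_omit_def by (rule degree_prod_sum_eq) (auto simp del: mult_pCons_left)
  also have "\<dots> = (\<Sum>i\<in>{1..q} - {j}. 2)" by (intro sum.cong) (auto simp: degree_mult_eq simp del: mult_pCons_left)
  finally show ?thesis using j by simp
qed

lemma coeff_D_omit:
  assumes "j \<in> {1..q}"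
  shows "coeff (D_omit q w j) (2 * q - 2) = 1" "k > 2 * q - 2 \<Longrightarrow> coeff (D_omit q w j) k = 0"
  using lead_coeff_D_omit[of q w j] degree_D_omit[OF assms, of w] by (auto simp: coeff_eq_0)

text \<open>The numerator of the limit function over \<open>D_poly\<close>, up to the factor i; the
  factor is split off so that the leading coefficient is the positive number M.\<close>

definition limit_num :: "nat \<Rightarrow> (nat \<Rightarrow> real) \<Rightarrow> (nat \<Rightarrow> complex) \<Rightarrow> complex poly" where
  "limit_num q \<gamma> w = (\<Sum>j=1..q. smult (of_real (\<gamma> j * Im (w j))) (D_omit q w j))"

lemma limit_fun_eq:
  assumes z: "poly (D_poly q w) z \<noteq> 0"
  shows "limit_fun q \<gamma> w z = \<i> * poly (limit_num q \<gamma> w) z / poly (D_poly q w) z"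
proof -
  have "\<i> * poly (limit_num q \<gamma> w) z / poly (D_poly q w) z
    = (\<Sum>j=1..q. \<i> * (of_real (\<gamma> j * Im (w j)) * poly (D_omit q w j) z) / poly (D_poly q w) z)"
    by (simp add: limit_num_def poly_sum sum_distrib_left sum_divide_distrib)
  also have "\<dots> = limit_fun q \<gamma> w z"
    unfolding limit_fun_def
  proof (rule sum.cong[OF refl])
    fix j assume j: "j \<in> {1..q}"
    define A B E where "A = z - w j" and "B = z - cnj (w j)" and "E = poly (D_omit q w j) z"
    have D: "poly (D_poly q w) z = A * B * E" unfolding D_poly_eq_omit[OF j] by (simp add: A_def B_def E_def algebra_simps)
    have nz: "A \<noteq> 0" "B \<noteq> 0" "E \<noteq> 0" using z D by auto
    have "B - A = 2 * \<i> * of_real (Im (w j))" by (simp add: A_def B_def complex_eq_iff)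
    then have i: "\<i> * of_real (Im (w j)) = (B - A) / 2" by simp
    have "\<i> * (of_real (\<gamma> j * Im (w j)) * E) / (A * B * E) = of_real (\<gamma> j) * (\<i> * of_real (Im (w j))) / (A * B)"
      using nz(3) by (simp add: mult_ac)
    also have "\<dots> = of_real (\<gamma> j) / (2 * A) - of_real (\<gamma> j) / (2 * B)"
      unfolding i using nz by (simp add: field_simps)
    finally show "\<i> * (of_real (\<gamma> j * Im (w j)) * poly (D_omit q w j) z) / poly (D_poly q w) z
      = of_real (\<gamma> j) / (2 * (z - w j)) - of_real (\<gamma> j) / (2 * (z - cnj (w j)))"
      unfolding D by (simp add: A_def B_def E_def)
  qed
  finally show ?thesis by simp
qed

context one_cut
begin

text \<open>The numerator of \<open>G\<close> over \<open>D_poly\<close>. Each linear factor is half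
  of (z - cnj w)/r + (z - w)/cnj r, the combined numerator of the conjugate pair of poles with r =
  R(w).\<close>

definition N :: "complex poly" where
  "N = (\<Sum>j=1..q. smult (of_real (\<gamma> j)) (D_omit q w j * [:- of_real (Re (cnj (w j) / R (w j))), of_real (Re (1 / R (w j))):]))"

lemma G_eq_quotient:
  assumes z: "poly (D_poly q w) z \<noteq> 0"
  shows "G z = poly N z / poly (D_poly q w) z"
proof -
  have "poly N z / poly (D_poly q w) z = (\<Sum>j=1..q. of_real (\<gamma> j) * (poly (D_omit q w j) z * (of_real (Re (1 / R (w j))) * z - of_real (Re (cnj (w j) / R (w j))))) / poly (D_poly q w) z)"
    by (simp add: N_def poly_sum sum_divide_distrib algebra_simps)
  also have "\<dots> = G z"
    unfolding G_def
  proof (rule sum.cong[OF refl])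
    fix j assume j: "j \<in> {1..q}"
    define A B E r where "A = z - w j" and "B = z - cnj (w j)" and "E = poly (D_omit q w j) z" and "r = R (w j)"
    have D: "poly (D_poly q w) z = A * B * E" unfolding D_poly_eq_omit[OF j] by (simp add: A_def B_def E_def algebra_simps)
    have nz: "A \<noteq> 0" "B \<noteq> 0" "E \<noteq> 0" "r \<noteq> 0" using z D R_nz[OF j] by (auto simp: r_def)
    have "2 * (of_real (Re (1 / r)) * z - of_real (Re (cnj (w j) / r))) = (1 / r + cnj (1 / r)) * z - (cnj (w j) / r + cnj (cnj (w j) / r))"
      unfolding complex_add_cnj by (simp add: algebra_simps)
    also have "\<dots> = B / r + A / cnj r"
      by (simp add: A_def B_def diff_divide_distrib algebra_simps)
    finally have tw: "2 * (of_real (Re (1 / r)) * z - of_real (Re (cnj (w j) / r))) = B / r + A / cnj r" .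
    have "X = Y / 2" if "2 * X = Y" for X Y :: complex using that by auto
    from this[OF tw] have "of_real (Re (1 / r)) * z - of_real (Re (cnj (w j) / r)) = (B / r + A / cnj r) / 2" .
    note tw = this
    have gen: "c * (E * ((B / r + A / s) / 2)) / (A * B * E) = c / 2 * (1 / (r * A) + 1 / (s * B))" if "s \<noteq> 0" for c s
      using nz that by (simp add: field_simps)
    show "of_real (\<gamma> j) * (poly (D_omit q w j) z * (of_real (Re (1 / R (w j))) * z - of_real (Re (cnj (w j) / R (w j))))) / poly (D_poly q w) z
      = of_real (\<gamma> j / 2) * (1 / (R (w j) * (z - w j)) + 1 / (cnj (R (w j)) * (z - cnj (w j))))"
      unfolding D E_def[symmetric] r_def[symmetric] A_def[symmetric] B_def[symmetric] tw
      by (subst gen) (use nz in auto)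
  qed
  finally show ?thesis by simp
qed

text \<open>Multiplying $N$ by the variable makes the vanishing of its top coefficient, which is the
  first endpoint equation, and the value of the next one visible.\<close>

lemma pCons_N: "pCons 0 N = (\<Sum>j=1..q. smult (of_real (\<gamma> j)) (D_omit q w j *
    [:- of_real (Re (1 / R (w j)) * (cmod (w j))\<^sup>2), of_real (Re (w j / R (w j))):]))" (is "_ = ?Q")
proof -
  have "pCons 0 N = (\<Sum>j=1..q. smult (of_real (\<gamma> j)) (D_omit q w j * 
      ([:0, 1:] * [:- of_real (Re (cnj (w j) / R (w j))), of_real (Re (1 / R (w j))):])))"
  proof -
    have "pCons 0 N = [:0, 1:] * N" by simp
    also have "\<dots> = (\<Sum>j=1..q. [:0, 1:] * smult (of_real (\<gamma> j)) (D_omit q w j * [:- of_real (Re (cnj (w j) / R (w j))), of_real (Re (1 / R (w j))):]))"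
      unfolding N_def by (rule sum_distrib_left)
    also have "\<dots> = (\<Sum>j=1..q. smult (of_real (\<gamma> j)) (D_omit q w j * 
      ([:0, 1:] * [:- of_real (Re (cnj (w j) / R (w j))), of_real (Re (1 / R (w j))):])))"
      by (intro sum.cong refl) (metis mult.left_commute mult_smult_right)
    finally show ?thesis .
  qed
  also have "\<dots> = (\<Sum>j=1..q. smult (of_real (\<gamma> j * Re (1 / R (w j)))) (D_poly q w) + smult (of_real (\<gamma> j)) (D_omit q w j *
    [:- of_real (Re (1 / R (w j)) * (cmod (w j))\<^sup>2), of_real (Re (w j / R (w j))):]))"
  proof (rule sum.cong[OF refl])
    fix j assume j: "j \<in> {1..q}"
    define \<alpha> \<beta> k where "\<alpha> = Re (1 / R (w j))" and "\<beta> = Re (cnj (w j) / R (w j))" and "k = Re (w j / R (w j))"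
    have "k + \<beta> = Re ((w j + cnj (w j)) * (1 / R (w j)))" unfolding k_def \<beta>_def
      by (simp add: add_divide_distrib)
    also have "\<dots> = 2 * Re (w j) * \<alpha>"
    proof -
      have "Re (of_real c * Y) = c * Re Y" for c Y by simp
      then show ?thesis unfolding complex_add_cnj \<alpha>_def .
    qed
    finally have \<beta>: "\<beta> = 2 * Re (w j) * \<alpha> - k" by simp
    \<comment> \<open>Division of z (\<alpha> z - \<beta>) by the quadratic factor: the quotient
      \<alpha> produces the sum that \<open>eq1\<close> annihilates, and the remainder has top
      coefficient k, the summand of \<open>eq2\<close>.\<close>
    have "[:0, 1:] * [:- of_real \<beta>, of_real \<alpha>:] = smult (of_real \<alpha>) ([:- w j, 1:] * [:- cnj (w j), 1:]) + [:- of_real (\<alpha> * (cmod (w j))\<^sup>2), complex_of_real k:]"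
      unfolding \<beta> cmod_power2 by (simp add: complex_eq_iff power2_eq_square algebra_simps)
    then have "D_omit q w j * ([:0, 1:] * [:- of_real \<beta>, of_real \<alpha>:]) = smult (of_real \<alpha>) (D_poly q w) + D_omit q w j * [:- of_real (\<alpha> * (cmod (w j))\<^sup>2), of_real k:]"
      unfolding D_poly_eq_omit[OF j] by (simp only: distrib_left mult_smult_right mult.commute)
    then show "smult (of_real (\<gamma> j)) (D_omit q w j * ([:0, 1:] * [:- of_real (Re (cnj (w j) / R (w j))), of_real (Re (1 / R (w j))):]))
      = smult (of_real (\<gamma> j * Re (1 / R (w j)))) (D_poly q w) + smult (of_real (\<gamma> j)) (D_omit q w j *
    [:- of_real (Re (1 / R (w j)) * (cmod (w j))\<^sup>2), of_real (Re (w j / R (w j))):])"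
      unfolding \<alpha>_def \<beta>_def k_def by (simp only: smult_add_right smult_smult of_real_mult)
  qed
  also have "\<dots> = smult (of_real (\<Sum>j=1..q. \<gamma> j * Re (1 / R (w j)))) (D_poly q w) + ?Q"
    unfolding sum.distrib of_real_sum smult_sum ..
  finally show ?thesis unfolding eq1 by simp
qed

text \<open>In \<open>pCons_N\<close> each summand is monic of degree 2q - 2 times a linear factor,
  so after the shift by one index the top coefficient is the sum in \<open>eq2\<close>.\<close>

lemma coeff_N:
  shows "coeff N (2 * q - 2) = of_real ((\<Sum>j=1..q. \<gamma> j) - t)" "k > 2 * q - 2 \<Longrightarrow> coeff N k = 0"
proof -
  have c: "coeff N k = (\<Sum>j=1..q. of_real (\<gamma> j) * (coeff (D_omit q w j) k * of_real (Re (w j / R (w j)))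
     + coeff (D_omit q w j) (Suc k) * (- of_real (Re (1 / R (w j)) * (cmod (w j))\<^sup>2))))" for k
  proof -
    have "coeff N k = coeff (pCons 0 N) (Suc k)" by simp
    also have "\<dots> = (\<Sum>j=1..q. of_real (\<gamma> j) * coeff ([:- of_real (Re (1 / R (w j)) * (cmod (w j))\<^sup>2), of_real (Re (w j / R (w j))):] * D_omit q w j) (Suc k))"
      unfolding pCons_N coeff_sum coeff_smult by (simp only: mult.commute[of "D_omit q w _"])
    also have "\<dots> = (\<Sum>j=1..q. of_real (\<gamma> j) * (coeff (D_omit q w j) k * of_real (Re (w j / R (w j)))
     + coeff (D_omit q w j) (Suc k) * (- of_real (Re (1 / R (w j)) * (cmod (w j))\<^sup>2))))"
      by (intro sum.cong refl arg_cong[where f = "\<lambda>x. _ * x"]) (simp add: mult.commute)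
    finally show ?thesis .
  qed
  have "coeff N (2 * q - 2) = of_real (\<Sum>j=1..q. \<gamma> j * Re (w j / R (w j)))"
    unfolding c of_real_sum by (intro sum.cong refl) (simp add: coeff_D_omit)
  then show "coeff N (2 * q - 2) = of_real ((\<Sum>j=1..q. \<gamma> j) - t)" unfolding eq2 .
  show "coeff N k = 0" if "k > 2 * q - 2"
    unfolding c using that by (intro sum.neutral) (simp add: coeff_D_omit)
qed

end

section \<open>The limit $t \to T$\<close>

lemma upper_eq: "upper z = (if Im z \<ge> 0 then z else cnj z)"
  by (simp add: upper_def complex_eq_iff)

lemma D_poly_upper: "D_poly q (\<lambda>j. upper (z j)) = D_poly q z"
  unfolding D_poly_def by (intro prod.cong refl) (simp add: upper_eq mult.commute del: mult_pCons_left mult_pCons_right)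

lemma ext_field_upper: "ext_field q \<gamma> (\<lambda>j. upper (z j)) = ext_field q \<gamma> z"
proof -
  have "cmod (of_real x - upper u) = cmod (of_real x - u)" for x u
    by (simp add: upper_def cmod_def)
  then show ?thesis by (simp add: ext_field_def fun_eq_iff)
qed

lemma ext_field_deriv_upper: "ext_field_deriv q \<gamma> (\<lambda>j. upper (z j)) = ext_field_deriv q \<gamma> z"
proof
  fix \<zeta>
  have "(\<zeta> - upper u) * (\<zeta> - cnj (upper u)) = (\<zeta> - u) * (\<zeta> - cnj u)" for u
    by (simp add: upper_eq mult.commute)
  moreover have "Re (upper u) = Re u" for u by (simp add: upper_def)
  ultimately show "ext_field_deriv q \<gamma> (\<lambda>j. upper (z j)) \<zeta> = ext_field_deriv q \<gamma> z \<zeta>"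
    by (simp add: ext_field_deriv_def)
qed

lemma continuous_on_ext_field:
  assumes "\<And>j. j \<in> {1..q} \<Longrightarrow> Im (w j) > 0"
  shows "continuous_on UNIV (ext_field q \<gamma> w)"
proof -
  have "of_real x - w j \<noteq> 0" if "j \<in> {1..q}" for x j
    using assms[OF that] by (auto simp: complex_eq_iff)
  then show ?thesis unfolding ext_field_def[abs_def] by (intro continuous_intros) auto
qed

context one_cut
begin

text \<open>The identity is \<open>R G\<close> = field derivative minus Cauchy transform, with
  \<open>G\<close> written over \<open>D_poly\<close>. Dividing \<open>N\<close> by its top
  coefficient makes \<open>B\<close> monic and produces the factor T - t.\<close>

lemma is_AB_representation_\<nu>:
  assumes t_less: "t < (\<Sum>j=1..q. \<gamma> j)" and q: "q \<ge> 1" and e: "e 1 = a" "e 2 = b"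
  defines "B \<equiv> smult (of_real (1 / ((\<Sum>j=1..q. \<gamma> j) - t))) N"
  shows "is_AB_representation q \<gamma> w t \<nu> 1 e B" "lead_coeff B = 1" "degree B = 2 * q - 2"
proof -
  define \<delta> where "\<delta> = (\<Sum>j=1..q. \<gamma> j) - t"
  have \<delta>: "\<delta> > 0" using t_less by (simp add: \<delta>_def)
  have c: "coeff B (2 * q - 2) = 1" unfolding B_def coeff_smult coeff_N(1) \<delta>_def[symmetric] using \<delta> by simp
  have "coeff B k = 0" if "k > 2 * q - 2" for k using coeff_N(2)[OF that] by (simp add: B_def)
  then have "degree B \<le> 2 * q - 2" by (intro degree_le) auto
  moreover have "degree B \<ge> 2 * q - 2" by (rule le_degree) (simp add: c)
  ultimately show deg: "degree B = 2 * q - 2" by simp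
  then show lead: "lead_coeff B = 1" using c by simp
  have set2: "{1..2 * 1} = {1, 2::nat}" by auto
  have branch: "is_sqrt_branch (A_poly 1 e) 1 (complex_of_real ` {a..b}) R"
    unfolding is_sqrt_branch_def
  proof (intro conjI ballI)
    show "R holomorphic_on - complex_of_real ` {a..b}" by (rule holomorphic_on_sqrt_branch[OF ab])
    show "((\<lambda>\<zeta>. R \<zeta> / \<zeta> ^ 1) \<longlongrightarrow> 1) at_infinity" using sqrt_branch_at_infinity[of a b] by simp
    fix \<zeta> assume "\<zeta> \<in> - complex_of_real ` {a..b}"
    then have "\<zeta> \<noteq> of_real a" using sqrt_branch_quotient_notin(1)[OF ab] by simp
    then show "(R \<zeta>)\<^sup>2 = poly (A_poly 1 e) \<zeta>"
      unfolding A_poly_def set2 by (simp add: power2_sqrt_branch e(2) e(1)[unfolded One_nat_def] algebra_simps)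
  qed
  have id: "- cauchy_transform \<nu> \<zeta> + ext_field_deriv q \<gamma> w \<zeta> = of_real \<delta> * (poly B \<zeta> * R \<zeta> / poly (D_poly q w) \<zeta>)"
    if "\<zeta> \<notin> complex_of_real ` {a..b}" "poly (D_poly q w) \<zeta> \<noteq> 0" for \<zeta>
  proof -
    have "- cauchy_transform \<nu> \<zeta> + ext_field_deriv q \<gamma> w \<zeta> = R \<zeta> * G \<zeta>"
      using that by (subst cauchy_transform_\<nu>) (auto simp: D_poly_0_iff)
    also have "\<dots> = of_real \<delta> * (poly B \<zeta> * R \<zeta> / poly (D_poly q w) \<zeta>)"
      unfolding G_eq_quotient[OF that(2)] B_def \<delta>_def[symmetric] using \<delta> by simp
    finally show ?thesis .
  qed
  show "is_AB_representation q \<gamma> w t \<nu> 1 e B"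
    unfolding is_AB_representation_def measure_support_\<nu> \<delta>_def[symmetric]
  proof (intro conjI exI[of _ R] allI impI)
    show "strict_mono_on {1..2 * 1} e" unfolding set2 using ab e by (auto intro!: strict_mono_onI)
    show "{a..b} = (\<Union>j\<in>{1..1}. {e (2 * j - 1)..e (2 * j)})" using e by simp
    show "degree B + 1 + 1 = 2 * q" using deg q by simp
  qed (use lead branch id in auto)
qed

end

context upper_points
begin

section \<open>Asymptotics as the half-length tends to infinity\<close>

text \<open>A relative error below 1, uniformly in x, yields at once positivity of the density
  factor on the whole line, which is the missing assumption of \<open>one_cut\<close>, and
  domination by twice the limit density.\<close>

lemma one_cut_eventually:
  assumes h: "filterlim h at_top F" and ev: "\<forall>\<^sub>F t in F. 0 < t \<and> \<bar>m t - m0\<bar> \<le> 1 \<and>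
      eqn1 (m t) (h t) = 0 \<and>
      eqn2 (m t) (h t) = T - t"
  shows "\<forall>\<^sub>F t in F. one_cut q \<gamma> w (m t - h t) (m t + h t) t"
    and "\<forall>\<^sub>F t in F. \<forall>x. one_cut.\<rho> q \<gamma> w (m t - h t) (m t + h t) x \<le> 2 / pi * P x"
    and "((\<lambda>t. one_cut.\<rho> q \<gamma> w (m t - h t) (m t + h t) x) \<longlongrightarrow> P x / pi) F"
proof -
  obtain K where K: "K > 0" "\<And>m h x. \<bar>m - m0\<bar> \<le> 1 \<Longrightarrow> h \<ge> 2 * L \<Longrightarrow>
    eqn1 m h = 0 \<Longrightarrow>
    \<bar>h * (\<Sum>j=1..q. \<gamma> j * Re (1 / (root m h j * (of_real x - w j)))) - P x\<bar> \<le> K / h\<^sup>2 * P x"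
    using density_estimate by blast
  define \<sigma> where "\<sigma> t x = (\<Sum>j=1..q. \<gamma> j * Re (1 / (root (m t) (h t) j * (of_real x - w j))))" for t x
  have h2: "filterlim (\<lambda>t. (h t)\<^sup>2) at_top F"
    using h by (intro filterlim_pow_at_top) auto
  have lim0: "((\<lambda>t. K / (h t)\<^sup>2) \<longlongrightarrow> 0) F"
    by (rule real_tendsto_divide_at_top[OF tendsto_const h2])
  have small: "\<forall>\<^sub>F t in F. K / (h t)\<^sup>2 < 1" using order_tendstoD(2)[OF lim0, of 1] by simp
  have large: "\<forall>\<^sub>F t in F. 2 * L \<le> h t" using h by (simp add: filterlim_at_top)
  have est: "\<forall>\<^sub>F t in F. h t > 0 \<and> (\<forall>x. \<bar>h t * \<sigma> t x - P x\<bar> \<le> K / (h t)\<^sup>2 * P x)"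
    using ev large by eventually_elim (use K(2) L_ge_1 in \<open>auto simp: \<sigma>_def\<close>)
  have gpos: "\<forall>\<^sub>F t in F. \<forall>x. 0 < \<sigma> t x \<and> h t * \<sigma> t x \<le> 2 * P x"
    using est small
  proof eventually_elim
    case (elim t)
    show ?case
    proof
      fix x
      have "K / (h t)\<^sup>2 * P x < 1 * P x" using elim P_pos[of x] by (intro mult_strict_right_mono) auto
      moreover have "\<bar>h t * \<sigma> t x - P x\<bar> \<le> K / (h t)\<^sup>2 * P x" using elim by blast
      ultimately have "0 < h t * \<sigma> t x" "h t * \<sigma> t x \<le> 2 * P x" by linarith+
      then show "0 < \<sigma> t x \<and> h t * \<sigma> t x \<le> 2 * P x" using elim by (simp add: zero_less_mult_iff)
    qed
  qed
  show oc: "\<forall>\<^sub>F t in F. one_cut q \<gamma> w (m t - h t) (m t + h t) t"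
    using ev gpos est
  proof eventually_elim
    case (elim t)
    then show ?case
      by unfold_locales (use w \<gamma> in \<open>auto simp: \<sigma>_def T_def\<close>)
  qed
  have \<rho>: "\<forall>\<^sub>F t in F. \<forall>x. one_cut.\<rho> q \<gamma> w (m t - h t) (m t + h t) x
     = indicator {m t - h t..m t + h t} x * (sqrt ((m t + h t - x) * (x - (m t - h t))) * \<sigma> t x / pi)"
    using oc
  proof eventually_elim
    case (elim t)
    then interpret one_cut q \<gamma> w "m t - h t" "m t + h t" t .
    show ?case unfolding \<rho>_def by (simp add: g_def \<sigma>_def)
  qed
  have sq: "(m t + h t - x) * (x - (m t - h t)) = (h t)\<^sup>2 - (x - m t)\<^sup>2" for t x
    by (simp add: power2_eq_square algebra_simps)
  show "\<forall>\<^sub>F t in F. \<forall>x. one_cut.\<rho> q \<gamma> w (m t - h t) (m t + h t) x \<le> 2 / pi * P x"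
    using \<rho> gpos est
  proof eventually_elim
    case (elim t)
    show ?case
    proof
      fix x
      \<comment> \<open>The half-length that normalises the density factor is the maximum of the
        semicircle, so the bound holds on the entire cut.\<close>
      have "sqrt ((h t)\<^sup>2 - (x - m t)\<^sup>2) \<le> h t" using elim by (intro real_le_lsqrt) auto
      then have "sqrt ((h t)\<^sup>2 - (x - m t)\<^sup>2) * \<sigma> t x \<le> h t * \<sigma> t x"
        using elim by (intro mult_right_mono) (auto intro: less_imp_le)
      also have "\<dots> \<le> 2 * P x" using elim by blast
      finally have "sqrt ((h t)\<^sup>2 - (x - m t)\<^sup>2) * \<sigma> t x / pi \<le> 2 * P x / pi" by (intro divide_right_mono) auto
      moreover have "0 \<le> 2 * P x / pi" using P_pos[of x] by simp
      moreover have "one_cut.\<rho> q \<gamma> w (m t - h t) (m t + h t) x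
        = indicator {m t - h t..m t + h t} x * (sqrt ((h t)\<^sup>2 - (x - m t)\<^sup>2) * \<sigma> t x / pi)"
        using elim sq by simp
      ultimately show "one_cut.\<rho> q \<gamma> w (m t - h t) (m t + h t) x \<le> 2 / pi * P x"
        by (simp add: indicator_def)
    qed
  qed
  have A: "((\<lambda>t. h t * \<sigma> t x) \<longlongrightarrow> P x) F"
  proof (rule Lim_transform_bound[of _ "\<lambda>t. K / (h t)\<^sup>2 * P x", THEN LIM_zero_cancel])
    show "\<forall>\<^sub>F t in F. norm (h t * \<sigma> t x - P x) \<le> norm (K / (h t)\<^sup>2 * P x)"
      using est
    proof eventually_elim
      case (elim t)
      then have "\<bar>h t * \<sigma> t x - P x\<bar> \<le> K / (h t)\<^sup>2 * P x" by blast
      then show ?case unfolding real_norm_def by (rule order.trans[OF _ abs_ge_self])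
    qed
    show "((\<lambda>t. K / (h t)\<^sup>2 * P x) \<longlongrightarrow> 0) F" using tendsto_mult_right[OF lim0, of "P x"] by simp
  qed
  have B: "((\<lambda>t. sqrt (1 - ((x - m t) / h t)\<^sup>2)) \<longlongrightarrow> sqrt (1 - 0\<^sup>2)) F"
  proof (intro tendsto_intros)
    show "((\<lambda>t. (x - m t) / h t) \<longlongrightarrow> 0) F"
    proof (rule Lim_null_comparison)
      show "\<forall>\<^sub>F t in F. norm ((x - m t) / h t) \<le> (\<bar>x\<bar> + \<bar>m0\<bar> + 1) / h t"
        using ev est
      proof eventually_elim
        case (elim t)
        then have "\<bar>x - m t\<bar> \<le> \<bar>x\<bar> + \<bar>m0\<bar> + 1" by linarith
        then show ?case using elim by (simp add: abs_divide divide_right_mono)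
      qed
      show "((\<lambda>t. (\<bar>x\<bar> + \<bar>m0\<bar> + 1) / h t) \<longlongrightarrow> 0) F" by (rule real_tendsto_divide_at_top[OF tendsto_const h])
    qed
  qed
  have "((\<lambda>t. sqrt (1 - ((x - m t) / h t)\<^sup>2) * (h t * \<sigma> t x) / pi) \<longlongrightarrow> sqrt (1 - 0\<^sup>2) * P x / pi) F"
    by (intro tendsto_divide tendsto_mult A B tendsto_const) simp
  then have "((\<lambda>t. sqrt (1 - ((x - m t) / h t)\<^sup>2) * (h t * \<sigma> t x) / pi) \<longlongrightarrow> P x / pi) F" by simp
  then show "((\<lambda>t. one_cut.\<rho> q \<gamma> w (m t - h t) (m t + h t) x) \<longlongrightarrow> P x / pi) F"
  proof (rule Lim_transform_eventually)
    \<comment> \<open>The fixed point x eventually lies inside the cut, so the indicator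
      disappears.\<close>
    have "\<forall>\<^sub>F t in F. \<bar>x\<bar> + \<bar>m0\<bar> + 1 \<le> h t" using h by (simp add: filterlim_at_top)
    then show "\<forall>\<^sub>F t in F. sqrt (1 - ((x - m t) / h t)\<^sup>2) * (h t * \<sigma> t x) / pi = one_cut.\<rho> q \<gamma> w (m t - h t) (m t + h t) x"
      using \<rho> est ev
    proof eventually_elim
      case (elim t)
      have "x \<in> {m t - h t..m t + h t}" using elim by auto
      moreover have "sqrt ((h t)\<^sup>2 - (x - m t)\<^sup>2) = sqrt (1 - ((x - m t) / h t)\<^sup>2) * h t"
      proof -
        have "(H\<^sup>2 - Y\<^sup>2) = (1 - (Y / H)\<^sup>2) * H\<^sup>2" if "H > 0" for H Y :: real using that by (simp add: left_diff_distrib power_divide)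
        then show ?thesis using elim by (simp add: real_sqrt_mult)
      qed
      ultimately show ?case using elim sq by simp
    qed
  qed
qed

text \<open>Re(u/R(w_j)) = Im(u (1 + \<kappa>))/h, and h (T - t) tends to M, so the quotient by T -
  t tends to Im u/M. With u = cnj w_j this gives the weights Im w_j/M of the limit; with u = 1 it
  gives 0, and the terms raising the degree vanish.\<close>

lemma coeff_N_tendsto:
  assumes h: "filterlim h at_top F" and ev: "\<forall>\<^sub>F t in F. 0 < t \<and> t < T \<and> \<bar>m t - m0\<bar> \<le> 1 \<and>
      eqn1 (m t) (h t) = 0 \<and>
      eqn2 (m t) (h t) = T - t"
  shows "((\<lambda>t. coeff (smult (of_real (1 / (T - t))) (one_cut.N q \<gamma> w (m t - h t) (m t + h t))) k)
    \<longlongrightarrow> coeff (smult (of_real (1 / M)) (limit_num q \<gamma> w)) k) F"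
proof -
  have large: "\<forall>\<^sub>F t in F. 2 * L \<le> h t" using h by (simp add: filterlim_at_top)
  have h2: "filterlim (\<lambda>t. (h t)\<^sup>2) at_top F"
    using h by (intro filterlim_pow_at_top) auto
  have \<kappa>0: "((\<lambda>t. \<kappa> (m t) (h t) j) \<longlongrightarrow> 0) F" if j: "j \<in> {1..q}" for j
  proof (rule Lim_null_comparison)
    show "\<forall>\<^sub>F t in F. norm (\<kappa> (m t) (h t) j) \<le> 2 * L\<^sup>2 / (h t)\<^sup>2"
      using ev large by eventually_elim (use \<kappa>_bound(1)[OF j] in blast)
    show "((\<lambda>t. 2 * L\<^sup>2 / (h t)\<^sup>2) \<longlongrightarrow> 0) F" by (rule real_tendsto_divide_at_top[OF tendsto_const h2])
  qed
  have im: "((\<lambda>t. Im (u * (1 + \<kappa> (m t) (h t) j))) \<longlongrightarrow> Im u) F" if j: "j \<in> {1..q}" for u j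
  proof -
    have "((\<lambda>t. Im (u * (1 + \<kappa> (m t) (h t) j))) \<longlongrightarrow> Im (u * (1 + 0))) F"
      by (intro tendsto_intros \<kappa>0[OF j])
    then show ?thesis by simp
  qed
  have "((\<lambda>t. \<Sum>j=1..q. \<gamma> j * Im (w j * (1 + \<kappa> (m t) (h t) j))) \<longlongrightarrow> M) F"
    unfolding M_def by (intro tendsto_sum tendsto_mult_left im)
  \<comment> \<open>This is the second endpoint equation multiplied by h, with no error
    term.\<close>
  moreover have "\<forall>\<^sub>F t in F. (\<Sum>j=1..q. \<gamma> j * Im (w j * (1 + \<kappa> (m t) (h t) j))) = h t * (T - t)"
    using ev large
  proof eventually_elim
    case (elim t)
    then have h0: "h t > 0" using L_ge_1 by linarith
    have "T - t = (\<Sum>j=1..q. \<gamma> j * Im (w j * (1 + \<kappa> (m t) (h t) j))) / h t"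
      unfolding sum_divide_distrib using elim h0 by (auto intro!: sum.cong simp: Re_inverse_sqrt_branch simp del: times_complex.sel)
    then show ?case using h0 by (simp add: field_simps)
  qed
  ultimately have h\<delta>: "((\<lambda>t. h t * (T - t)) \<longlongrightarrow> M) F" by (rule Lim_transform_eventually)
  have re: "((\<lambda>t. Re (u / root (m t) (h t) j) / (T - t)) \<longlongrightarrow> Im u / M) F" if j: "j \<in> {1..q}" for u j
  proof -
    have "((\<lambda>t. Im (u * (1 + \<kappa> (m t) (h t) j)) / (h t * (T - t))) \<longlongrightarrow> Im u / M) F"
      using M_pos by (intro tendsto_divide im[OF j] h\<delta>) auto
    then show ?thesis
    proof (rule Lim_transform_eventually)
      show "\<forall>\<^sub>F t in F. Im (u * (1 + \<kappa> (m t) (h t) j)) / (h t * (T - t)) = Re (u / root (m t) (h t) j) / (T - t)"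
        using large
      proof eventually_elim
        case (elim t)
        then have h0: "h t > 0" using L_ge_1 by linarith
        show ?case unfolding Re_inverse_sqrt_branch[OF j h0] by simp
      qed
    qed
  qed
  have "((\<lambda>t. \<Sum>j=1..q. of_real (\<gamma> j) * (coeff (D_omit q w j) k * (- of_real (Re (cnj (w j) / root (m t) (h t) j) / (T - t)))
      + coeff (pCons 0 (D_omit q w j)) k * of_real (Re (1 / root (m t) (h t) j) / (T - t))))
    \<longlongrightarrow> (\<Sum>j=1..q. of_real (\<gamma> j) * (coeff (D_omit q w j) k * (- of_real (Im (cnj (w j)) / M)) + coeff (pCons 0 (D_omit q w j)) k * of_real (Im 1 / M)))) F"
    by (intro tendsto_sum tendsto_intros re) auto
  also have "(\<Sum>j=1..q. of_real (\<gamma> j) * (coeff (D_omit q w j) k * (- of_real (Im (cnj (w j)) / M)) + coeff (pCons 0 (D_omit q w j)) k * of_real (Im 1 / M)))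
     = coeff (smult (of_real (1 / M)) (limit_num q \<gamma> w)) k"
    by (simp add: limit_num_def coeff_sum sum_divide_distrib mult_ac)
  finally show ?thesis
  proof (rule Lim_transform_eventually)
    have "\<forall>\<^sub>F t in F. one_cut q \<gamma> w (m t - h t) (m t + h t) t"
      by (rule one_cut_eventually(1)[OF h]) (use ev in \<open>auto elim: eventually_mono\<close>)
    then show "\<forall>\<^sub>F t in F. (\<Sum>j=1..q. of_real (\<gamma> j) * (coeff (D_omit q w j) k * (- of_real (Re (cnj (w j) / root (m t) (h t) j) / (T - t)))
      + coeff (pCons 0 (D_omit q w j)) k * of_real (Re (1 / root (m t) (h t) j) / (T - t))))
      = coeff (smult (of_real (1 / (T - t))) (one_cut.N q \<gamma> w (m t - h t) (m t + h t))) k"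
    proof eventually_elim
      case (elim t)
      have "coeff (p * [:x, y:]) k = coeff p k * x + coeff (pCons 0 p) k * y" for p :: "complex poly" and x y
        by (cases k) (simp_all add: mult.commute[of p] mult.commute[of x] mult.commute[of y])
      moreover have "of_real g * (c * (- of_real (y / \<delta>)) + c' * of_real (x / \<delta>)) = of_real (1 / \<delta>) * (of_real g * (c * (- of_real y) + c' * of_real x))"
        for g x y \<delta> :: real and c c' :: complex
        by (cases "\<delta> = 0") (simp_all add: field_simps)
      ultimately show ?case
        unfolding one_cut.N_def[OF elim] coeff_smult coeff_sum sum_distrib_left by (simp only:)
    qed
  qed
qed

lemma limit_monic:
  shows "lead_coeff (smult (of_real (1 / M)) (limit_num q \<gamma> w)) = 1"
    and "degree (smult (of_real (1 / M)) (limit_num q \<gamma> w)) = 2 * q - 2"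
proof -
  let ?P = "smult (of_real (1 / M)) (limit_num q \<gamma> w)"
  have top: "coeff (limit_num q \<gamma> w) (2 * q - 2) = of_real M"
    unfolding limit_num_def M_def coeff_sum coeff_smult of_real_sum by (intro sum.cong refl) (simp add: coeff_D_omit)
  have c: "coeff ?P (2 * q - 2) = 1" unfolding coeff_smult top using M_pos by simp
  have "coeff ?P k = 0" if "k > 2 * q - 2" for k
    using that by (simp add: limit_num_def coeff_sum coeff_D_omit)
  then have "degree ?P \<le> 2 * q - 2" by (intro degree_le) auto
  moreover have "degree ?P \<ge> 2 * q - 2" by (rule le_degree) (unfold c, simp)
  ultimately show deg: "degree ?P = 2 * q - 2" by (rule order.antisym)
  show "lead_coeff ?P = 1" unfolding deg by (rule c)
qed

lemma limit_num_nz: "limit_num q \<gamma> w \<noteq> 0"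
proof
  assume z: "limit_num q \<gamma> w = 0"
  from limit_monic(1) show False unfolding z by simp
qed

text \<open>As \<open>P\<close> is positive, this excludes real zeros of the limit function.\<close>

lemma limit_fun_of_real: "limit_fun q \<gamma> w (of_real x) = \<i> * of_real (P x)"
  unfolding limit_fun_def P_def of_real_sum sum_distrib_left
proof (rule sum.cong[OF refl])
  fix j
  define u where "u = 1 / (of_real x - w j)"
  have "of_real (\<gamma> j) / (2 * (of_real x - w j)) - of_real (\<gamma> j) / (2 * (of_real x - cnj (w j))) = of_real (\<gamma> j) / 2 * (u - cnj u)"
    by (simp add: u_def right_diff_distrib)
  also have "\<dots> = \<i> * of_real (\<gamma> j * Im u)" unfolding complex_diff_cnj by simp
  finally show "of_real (\<gamma> j) / (2 * (of_real x - w j)) - of_real (\<gamma> j) / (2 * (of_real x - cnj (w j)))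
     = \<i> * of_real (\<gamma> j * Im (w j) / ((x - Re (w j))\<^sup>2 + (Im (w j))\<^sup>2))"
    unfolding u_def Im_inverse_diff by simp
qed

lemma D_poly_of_real: "poly (D_poly q w) (of_real x) \<noteq> 0"
proof -
  have "of_real x \<noteq> w j \<and> of_real x \<noteq> cnj (w j)" if "j \<in> {1..q}" for j
    using w[OF that] by (auto simp: complex_eq_iff)
  then show ?thesis unfolding D_poly_0_iff by blast
qed

lemma limit_num_roots_not_real: "poly (limit_num q \<gamma> w) \<zeta> = 0 \<Longrightarrow> \<zeta> \<notin> \<real>"
proof
  assume "poly (limit_num q \<gamma> w) \<zeta> = 0" "\<zeta> \<in> \<real>"
  then obtain x where "\<zeta> = of_real x" "poly (limit_num q \<gamma> w) (of_real x) = 0" by (auto elim: Reals_cases)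
  then have "\<i> * of_real (P x) = 0" using limit_fun_eq[OF D_poly_of_real, of \<gamma> x] limit_fun_of_real by simp
  then show False using P_pos[of x] by simp
qed

text \<open>At a zero w_k of the denominator, or its conjugate, only the k-th summand of the
  numerator survives, and it is nonzero when the points are distinct. Coinciding points would give
  numerator and denominator a common zero.\<close>

lemma limit_num_roots:
  assumes inj: "inj_on w {1..q}"
  shows "poly (limit_num q \<gamma> w) \<zeta> = 0 \<longleftrightarrow> poly (D_poly q w) \<zeta> \<noteq> 0 \<and> limit_fun q \<gamma> w \<zeta> = 0"
proof (cases "poly (D_poly q w) \<zeta> = 0")
  case False
  then show ?thesis using limit_fun_eq[OF False] by simp
next
  case True
  then obtain k where k: "k \<in> {1..q}" "\<zeta> = w k \<or> \<zeta> = cnj (w k)" by (auto simp: D_poly_0_iff)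
  have poly_omit: "poly (D_omit q w j) \<zeta> = (\<Prod>i\<in>{1..q} - {j}. (\<zeta> - w i) * (\<zeta> - cnj (w i)))" for j
    unfolding D_omit_def poly_prod by (intro prod.cong) (auto simp: algebra_simps)
  have "(\<Sum>j\<in>{1..q} - {k}. of_real (\<gamma> j * Im (w j)) * poly (D_omit q w j) \<zeta>) = 0"
  proof (intro sum.neutral ballI)
    fix j assume "j \<in> {1..q} - {k}"
    then have "poly (D_omit q w j) \<zeta> = 0" unfolding poly_omit using k by (intro prod_zero) auto
    then show "of_real (\<gamma> j * Im (w j)) * poly (D_omit q w j) \<zeta> = 0" by simp
  qed
  then have "poly (limit_num q \<gamma> w) \<zeta> = of_real (\<gamma> k * Im (w k)) * poly (D_omit q w k) \<zeta>"
    unfolding limit_num_def poly_sum poly_smult using k(1) by (subst sum.remove[of _ k]) auto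
  moreover have "poly (D_omit q w k) \<zeta> \<noteq> 0"
    unfolding poly_omit
  proof
    assume "(\<Prod>i\<in>{1..q} - {k}. (\<zeta> - w i) * (\<zeta> - cnj (w i))) = 0"
    then have "\<exists>i\<in>{1..q} - {k}. (\<zeta> - w i) * (\<zeta> - cnj (w i)) = 0"
      by (subst (asm) prod_zero_iff) simp_all
    then obtain i where i: "i \<in> {1..q}" "i \<noteq> k" "(\<zeta> - w i) * (\<zeta> - cnj (w i)) = 0" by blast
    have "w i \<noteq> w k" using inj_onD[OF inj _ i(1) k(1)] i(2) by blast
    moreover have "w i \<noteq> cnj (w k)" "w k \<noteq> cnj (w i)" using w[OF i(1)] w[OF k(1)] by (auto simp: complex_eq_iff)
    ultimately show False using i(3) k(2) by auto
  qed
  ultimately show ?thesis using True \<gamma>[OF k(1)] w[OF k(1)] by simp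
qed

end

theorem theorem2p2:
  fixes q :: nat and z w :: "nat \<Rightarrow> complex" and \<gamma> :: "nat \<Rightarrow> real" and T :: real
    and \<mu> :: "real \<Rightarrow> real measure"
  assumes "q \<ge> 1"
    and "\<And>j. j \<in> {1..q} \<Longrightarrow> z j \<notin> \<real>"
    and "\<And>j. j \<in> {1..q} \<Longrightarrow> \<gamma> j > 0"
    and "T = (\<Sum>j=1..q. \<gamma> j)"
    and "\<And>t. t \<in> {0<..<T} \<Longrightarrow> is_equilibrium_measure (ext_field q \<gamma> z) t (\<mu> t)"
    and "w = (\<lambda>j. upper (z j))"
  shows "(\<exists>\<mu>\<^sub>T :: real measure. sets \<mu>\<^sub>T = sets borel \<and> finite_measure \<mu>\<^sub>T \<and>
      (\<forall>I\<in>sets borel. ((\<lambda>t. measure (\<mu> t) I) \<longlongrightarrow> measure \<mu>\<^sub>T I) (at_left T)) \<and>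
      scale_measure (ennreal (1 / T)) \<mu>\<^sub>T =
        density lborel (\<lambda>x. ennreal (1 / (T * pi) *
          (\<Sum>j=1..q. \<gamma> j * Im (w j) / ((x - Re (w j))\<^sup>2 + (Im (w j))\<^sup>2)))))
    \<and> (\<exists>(a :: real \<Rightarrow> nat \<Rightarrow> real) (B :: real \<Rightarrow> complex poly) (Z :: complex multiset).
      (\<forall>\<^sub>F t in at_left T. a t 1 < a t 2 \<and> measure_support (\<mu> t) = {a t 1..a t 2} \<and>
         is_AB_representation q \<gamma> z t (\<mu> t) 1 (a t) (B t)) \<and>
      filterlim (\<lambda>t. a t 1) at_bot (at_left T) \<and>
      filterlim (\<lambda>t. a t 2) at_top (at_left T) \<and>
      is_zeros_of_fraction (limit_fun q \<gamma> w) (D_poly q z) Z \<and>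
      (inj_on w {1..q} \<longrightarrow>
         set_mset Z = {\<zeta>. poly (D_poly q z) \<zeta> \<noteq> 0 \<and> limit_fun q \<gamma> w \<zeta> = 0}) \<and>
      (\<forall>\<zeta>\<in>#Z. \<zeta> \<notin> \<real>) \<and>
      zeros_tendsto B Z (at_left T))"
proof -
  have w: "Im (w j) > 0" if "j \<in> {1..q}" for j
    using assms(2)[OF that] by (simp add: assms(6) upper_def complex_is_Real_iff)
  interpret upper_points q \<gamma> w
    by unfold_locales (use assms(1,3) w in auto)
  have T: "T = (\<Sum>j=1..q. \<gamma> j)" "upper_points.T q \<gamma> = T"
    using assms(4) T_def by simp_all
  note D = D_poly_upper[of q z, folded assms(6)] and ef = ext_field_upper[of q \<gamma> z, folded assms(6)]
    and efd = ext_field_deriv_upper[of q \<gamma> z, folded assms(6)]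
  have T_pos: "T > 0" using T_pos T(2) by simp
  obtain H where H: "H \<ge> 2 * L" "\<And>\<delta>. 0 < \<delta> \<Longrightarrow> \<delta> \<le> M / (2 * H) \<Longrightarrow>
    \<exists>m h. \<bar>m - m0\<bar> \<le> 1 \<and> M / (2 * \<delta>) \<le> h \<and>
      eqn1 m h = 0 \<and>
      eqn2 m h = \<delta>"
    using endpoint_equations_solvable by blast
  have Hpos: "M / (2 * H) > 0" using M_pos H(1) L_ge_1 by simp
  \<comment> \<open>Beyond \<open>T0\<close> the value \<delta> = T - t is admissible for the
    endpoint equations, and t is positive.\<close>
  define T0 where "T0 = max 0 (T - M / (2 * H))"
  have T0: "T0 < T" "0 \<le> T0" using T_pos Hpos by (auto simp: T0_def)
  define sol where "sol t m h \<longleftrightarrow> \<bar>m - m0\<bar> \<le> 1 \<and> M / (2 * (T - t)) \<le> h \<and>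
      eqn1 m h = 0 \<and>
      eqn2 m h = T - t" for t m h
  have "\<exists>m h. sol t m h" if "t \<in> {T0<..<T}" for t
  proof -
    have "0 < T - t" "T - t \<le> M / (2 * H)" using that by (auto simp: T0_def)
    from H(2)[OF this] show ?thesis unfolding sol_def by blast
  qed
  then obtain m h where "\<And>t. t \<in> {T0<..<T} \<Longrightarrow> sol t (m t) (h t)" by metis
  note mh = this[unfolded sol_def]
  have near: "\<forall>\<^sub>F t in at_left T. t \<in> {T0<..<T}"
    using eventually_at_left_real[OF T0(1)] by simp
  have h_top: "filterlim h at_top (at_left T)"
  proof (rule filterlim_at_top_mono)
    have "((\<lambda>t. T - t) \<longlongrightarrow> T - T) (at_left T)" by (intro tendsto_intros)
    then have "filterlim (\<lambda>t. T - t) (at_right 0) (at_left T)"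
      unfolding filterlim_at using eventually_mono[OF near, of "\<lambda>t. T - t \<in> {0<..} \<and> T - t \<noteq> 0"] by auto
    then have "filterlim (\<lambda>t. M / 2 * inverse (T - t)) at_top (at_left T)"
      using M_pos by (intro filterlim_tendsto_pos_mult_at_top[OF tendsto_const] filterlim_compose[OF filterlim_inverse_at_top_right]) auto
    then show "filterlim (\<lambda>t. M / (2 * (T - t))) at_top (at_left T)"
      by (simp only: divide_inverse inverse_mult_distrib mult.assoc)
    show "\<forall>\<^sub>F t in at_left T. M / (2 * (T - t)) \<le> h t"
      using near by (rule eventually_mono) (use mh in blast)
  qed
  have ev: "\<forall>\<^sub>F t in at_left T. 0 < t \<and> t < upper_points.T q \<gamma> \<and> \<bar>m t - m0\<bar> \<le> 1 \<and>
      eqn1 (m t) (h t) = 0 \<and>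
      eqn2 (m t) (h t) = upper_points.T q \<gamma> - t"
    unfolding T(2) using near by (rule eventually_mono) (use mh T0 in auto)
  then have ev': "\<forall>\<^sub>F t in at_left T. 0 < t \<and> \<bar>m t - m0\<bar> \<le> 1 \<and>
      eqn1 (m t) (h t) = 0 \<and>
      eqn2 (m t) (h t) = upper_points.T q \<gamma> - t"
    by (rule eventually_mono) blast
  note oc = one_cut_eventually[OF h_top ev']
  define \<rho>' where "\<rho>' t = one_cut.\<rho> q \<gamma> w (m t - h t) (m t + h t)" for t
  \<comment> \<open>The given measure and the constructed one are equilibrium measures of the same
    mass in the same field, so uniqueness identifies them.\<close>
  have \<mu>: "\<forall>\<^sub>F t in at_left T. \<mu> t = one_cut.\<nu> q \<gamma> w (m t - h t) (m t + h t)"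
    using oc(1) near
  proof eventually_elim
    case (elim t)
    then interpret one_cut q \<gamma> w "m t - h t" "m t + h t" t by blast
    have "t \<in> {0<..<T}" using elim T0 by auto
    from assms(5)[OF this] have "is_equilibrium_measure (ext_field q \<gamma> w) t (\<mu> t)" unfolding ef .
    then show ?case
      by (rule equilibrium_measure_unique[OF _ is_equilibrium_measure_\<nu> t continuous_on_ext_field[OF w]])
  qed
  define \<mu>T where "\<mu>T = density lborel (\<lambda>x. ennreal (P x / pi))"
  have P_int: "integrable lborel (\<lambda>x. P x / pi)" using integrable_P by simp
  have P_nn: "0 \<le> P x / pi" for x using P_pos[of x] by simp
  have meas: "measure (density lborel (\<lambda>x. ennreal (f x))) I = (\<integral>x. indicator I x * f x \<partial>lborel)"
    if [measurable]: "f \<in> borel_measurable borel" "I \<in> sets borel" and "\<And>x. 0 \<le> f x" for f :: "real \<Rightarrow> real" and I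
  proof -
    have "emeasure (density lborel (\<lambda>x. ennreal (f x))) I = (\<integral>\<^sup>+x. ennreal (indicator I x * f x) \<partial>lborel)"
      by (subst emeasure_density) (auto intro!: nn_integral_cong simp: indicator_def)
    then show ?thesis using that(3) by (subst integral_eq_nn_integral) (auto simp: measure_def)
  qed
  have "emeasure \<mu>T UNIV = ennreal (\<integral>x. P x / pi \<partial>lborel)"
    unfolding \<mu>T_def using nn_integral_eq_integral[OF P_int] P_nn by (simp add: emeasure_density)
  then have "finite_measure \<mu>T" by (intro finite_measureI) (simp add: \<mu>T_def)
  have conv: "((\<lambda>t. measure (\<mu> t) I) \<longlongrightarrow> measure \<mu>T I) (at_left T)" if I[measurable]: "I \<in> sets borel" for I
  proof -
    \<comment> \<open>The dominated convergence theorem asks for measurability and domination at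
      every term of the sequence, but both are known only for t near T. Elsewhere the density is
      replaced by the limit density, which obeys the same bound.\<close>
    define good where "good t \<longleftrightarrow> \<rho>' t \<in> borel_measurable borel \<and> (\<forall>x. 0 \<le> \<rho>' t x \<and> \<rho>' t x \<le> 2 / pi * P x)" for t
    define r where "r t x = (if good t then \<rho>' t x else P x / pi)" for t x
    have r: "0 \<le> r t x" "r t x \<le> 2 / pi * P x" for t x
      using P_nn[of x] unfolding r_def good_def by auto
    have good: "\<forall>\<^sub>F t in at_left T. good t \<and> measure (\<mu> t) I = (\<integral>x. indicator I x * \<rho>' t x \<partial>lborel)"
      using oc(1,2) \<mu>
    proof eventually_elim
      case (elim t)
      then interpret one_cut q \<gamma> w "m t - h t" "m t + h t" t by blast
      have "measure (\<mu> t) I = (\<integral>x. indicator I x * \<rho>' t x \<partial>lborel)"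
        unfolding elim(3) \<rho>'_def \<nu>_def by (rule meas) (simp_all add: \<rho>_nonneg)
      then show ?case using elim(2) \<rho>_nonneg unfolding good_def \<rho>'_def by simp
    qed
    have "((\<lambda>t. \<integral>x. indicator I x * r t x \<partial>lborel) \<longlongrightarrow> (\<integral>x. indicator I x * (P x / pi) \<partial>lborel)) (at_left T)"
    proof (rule tendsto_at_left_sequentially[OF T0(1)])
      fix S :: "nat \<Rightarrow> real" assume S: "\<And>n. S n < T" "S \<longlonglongrightarrow> T"
      have SL: "filterlim S (at_left T) sequentially"
        using S by (intro tendsto_imp_filterlim_at_left) (simp_all add: always_eventually)
      show "(\<lambda>n. \<integral>x. indicator I x * r (S n) x \<partial>lborel) \<longlonglongrightarrow> (\<integral>x. indicator I x * (P x / pi) \<partial>lborel)"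
      proof (rule integral_dominated_convergence)
        show "integrable lborel (\<lambda>x. 2 / pi * P x)" using integrable_P by simp
        show "(\<lambda>x. indicator I x * r (S n) x) \<in> borel_measurable lborel" for n
        proof -
          have "r (S n) = (if good (S n) then \<rho>' (S n) else (\<lambda>x. P x / pi))" by (simp add: r_def fun_eq_iff)
          then have "r (S n) \<in> borel_measurable borel" by (cases "good (S n)") (simp add: good_def, simp)
          then show ?thesis by measurable
        qed
        show "AE x in lborel. norm (indicator I x * r (S n) x) \<le> 2 / pi * P x" for n
        proof (rule AE_I2)
          fix x
          have "0 \<le> 2 / pi * P x" using r[of undefined x] by linarith
          then show "norm (indicator I x * r (S n) x) \<le> 2 / pi * P x" using r[of "S n" x] by (cases "x \<in> I") simp_all
        qed
        show "AE x in lborel. (\<lambda>n. indicator I x * r (S n) x) \<longlonglongrightarrow> indicator I x * (P x / pi)"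
        proof (rule AE_I2, rule tendsto_mult_left)
          fix x
          have "\<forall>\<^sub>F t in at_left T. \<rho>' t x = r t x" using good by (rule eventually_mono) (simp add: r_def)
          from Lim_transform_eventually[OF oc(3)[of x, folded \<rho>'_def] this]
          show "(\<lambda>n. r (S n) x) \<longlonglongrightarrow> P x / pi" by (rule filterlim_compose) (rule SL)
        qed
      qed measurable
    qed
    then show ?thesis unfolding \<mu>T_def meas[OF borel_measurable_divide[OF P_measurable borel_measurable_const] I P_nn]
      by (rule Lim_transform_eventually) (use good in \<open>rule eventually_mono, simp add: r_def\<close>)
  qed
  \<comment> \<open>The measures \<mu>_t have mass t, so their limit has mass T, while the stated
    density is that of a probability measure.\<close>
  have scale: "scale_measure (ennreal (1 / T)) \<mu>T =
        density lborel (\<lambda>x. ennreal (1 / (T * pi) *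
          (\<Sum>j=1..q. \<gamma> j * Im (w j) / ((x - Re (w j))\<^sup>2 + (Im (w j))\<^sup>2))))"
    unfolding P_def[symmetric]
  proof (rule measure_eqI)
    fix A assume "A \<in> sets (scale_measure (ennreal (1 / T)) \<mu>T)"
    then have [measurable]: "A \<in> sets borel" by (simp add: \<mu>T_def)
    have "ennreal (1 / T) * (\<integral>\<^sup>+x. ennreal (P x / pi) * indicator A x \<partial>lborel)
      = (\<integral>\<^sup>+x. ennreal (1 / T) * (ennreal (P x / pi) * indicator A x) \<partial>lborel)"
      by (rule nn_integral_cmult[symmetric]) measurable
    also have "\<dots> = (\<integral>\<^sup>+x. ennreal (1 / (T * pi) * P x) * indicator A x \<partial>lborel)"
      using T_pos P_nn by (intro nn_integral_cong) (simp add: mult.assoc[symmetric] ennreal_mult'[symmetric])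
    finally show "emeasure (scale_measure (ennreal (1 / T)) \<mu>T) A = emeasure (density lborel (\<lambda>x. ennreal (1 / (T * pi) * P x))) A"
      by (simp add: \<mu>T_def emeasure_density)
  qed (simp add: \<mu>T_def)
  define a where "a t i = (if i = (1::nat) then m t - h t else m t + h t)" for t i
  define B where "B t = smult (of_real (1 / (T - t))) (one_cut.N q \<gamma> w (m t - h t) (m t + h t))" for t
  define Z where "Z = proots (limit_num q \<gamma> w)"
  have a12: "a t 1 = m t - h t" "a t 2 = m t + h t" for t by (auto simp: a_def)
  have AB: "\<forall>\<^sub>F t in at_left T. a t 1 < a t 2 \<and> measure_support (\<mu> t) = {a t 1..a t 2} \<and>
         is_AB_representation q \<gamma> z t (\<mu> t) 1 (a t) (B t) \<and> lead_coeff (B t) = 1 \<and> degree (B t) = 2 * q - 2"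
    using oc(1) near \<mu>
  proof eventually_elim
    case (elim t)
    then interpret one_cut q \<gamma> w "m t - h t" "m t + h t" t by blast
    have tT: "t < (\<Sum>j=1..q. \<gamma> j)" using elim T by auto
    note AB = is_AB_representation_\<nu>[OF tT assms(1), of "a t", OF a12, folded T(1), folded B_def]
    have "is_AB_representation q \<gamma> z t (\<mu> t) 1 (a t) (B t)"
      using AB(1) unfolding is_AB_representation_def D efd elim(3) .
    then show ?case using ab AB(2,3) measure_support_\<nu> unfolding a12 elim(3) by simp
  qed
  have m_bd: "\<forall>\<^sub>F t in at_left T. m0 - 1 \<le> m t \<and> m t \<le> m0 + 1"
    using near by (rule eventually_mono) (use mh in fastforce)
  have h_shift: "\<forall>\<^sub>F t in at_left T. c \<le> h t" for c using h_top by (simp add: filterlim_at_top)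
  have lim1: "filterlim (\<lambda>t. a t 1) at_bot (at_left T)"
    unfolding filterlim_at_bot
  proof
    fix c
    show "\<forall>\<^sub>F t in at_left T. a t 1 \<le> c"
      using m_bd h_shift[of "m0 + 1 - c"] by eventually_elim (simp add: a_def)
  qed
  have lim2: "filterlim (\<lambda>t. a t 2) at_top (at_left T)"
    unfolding filterlim_at_top
  proof
    fix c
    show "\<forall>\<^sub>F t in at_left T. c \<le> a t 2"
      using m_bd h_shift[of "c - m0 + 1"] by eventually_elim (simp add: a_def)
  qed
  have Z_mem: "\<zeta> \<in># Z \<longleftrightarrow> poly (limit_num q \<gamma> w) \<zeta> = 0" for \<zeta>
    unfolding Z_def using limit_num_nz by simp
  \<comment> \<open>The numerator is i times \<open>limit_num\<close>; the constant does not change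
    the multiset of roots.\<close>
  have frac: "is_zeros_of_fraction (limit_fun q \<gamma> w) (D_poly q z) Z"
    unfolding is_zeros_of_fraction_def D[symmetric]
    by (rule exI[of _ "smult \<i> (limit_num q \<gamma> w)"]) (simp add: limit_num_nz limit_fun_eq Z_def)
  have zt: "zeros_tendsto B Z (at_left T)"
    unfolding zeros_tendsto_def
  proof (intro allI impI)
    fix \<epsilon> :: real assume "\<epsilon> > 0"
    moreover have "\<forall>\<^sub>F t in at_left T. lead_coeff (B t) = 1 \<and> degree (B t) = 2 * q - 2"
      using AB by (rule eventually_mono) blast
    moreover have "((\<lambda>t. coeff (B t) k) \<longlongrightarrow> coeff (smult (of_real (1 / M)) (limit_num q \<gamma> w)) k) (at_left T)" for k
      using coeff_N_tendsto[OF h_top ev, of k] unfolding B_def T(2) .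
    ultimately have "\<forall>\<^sub>F t in at_left T. rel_mset (\<lambda>b \<zeta>. dist b \<zeta> < \<epsilon>) (proots (B t)) (proots (smult (of_real (1 / M)) (limit_num q \<gamma> w)))"
      using limit_monic by (intro proots_tendsto)
    then show "\<forall>\<^sub>F t in at_left T. rel_mset (\<lambda>b \<zeta>. dist b \<zeta> < \<epsilon>) (proots (B t)) Z"
      using M_pos by (simp add: Z_def)
  qed
  show ?thesis
  proof (intro conjI exI[of _ \<mu>T] exI[of _ a] exI[of _ B] exI[of _ Z] ballI impI)
    show "sets \<mu>T = sets borel" by (simp add: \<mu>T_def)
    show "\<forall>\<^sub>F t in at_left T. a t 1 < a t 2 \<and> measure_support (\<mu> t) = {a t 1..a t 2} \<and>
         is_AB_representation q \<gamma> z t (\<mu> t) 1 (a t) (B t)"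
      using AB by (rule eventually_mono) blast
    show "set_mset Z = {\<zeta>. poly (D_poly q z) \<zeta> \<noteq> 0 \<and> limit_fun q \<gamma> w \<zeta> = 0}" if "inj_on w {1..q}"
      using Z_mem limit_num_roots[OF that] unfolding D by auto
    show "\<zeta> \<notin> \<real>" if "\<zeta> \<in># Z" for \<zeta>
      using that limit_num_roots_not_real unfolding Z_mem by blast
  qed (fact \<open>finite_measure \<mu>T\<close> conv scale lim1 lim2 frac zt)+
qed

end
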